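(* Fix an integer $n\ge 2$. The set of lengths of maximal green sequences for the cyclic Tamari algebra $C_{\mathcal Q}$ is exactly the set of integers in the interval $\left[2n-1,\binom{n+1}{2}\right]$. Moreover, the set of lengths of maximal green sequences for the completed path algebra of the oriented $n$-cycle quiver $\mathcal Q$ is also exactly the set of integers in the interval $\left[2n-1,\binom{n+1}{2}\right]$.
   Context: Let $\mathcal Q$ be the oriented cycle quiver with vertices $\mathbb Z/n\mathbb Z$ and arrows $i\to i+1$. The path algebra $\mathbb C[\mathcal Q]$ has as basis the paths in $\mathcal Q$ (including the trivial path at each vertex), with multiplication given by concatenation. The cyclic Tamari algebra $C_{\mathcal Q}$ is the quotient of $\mathbb C[\mathcal Q]$ by the ideal generated by all paths of length $n$. The completed path algebra is the completion of $\mathbb C[\mathcal Q]$ at the ideal generated by the arrows of $\mathcal Q$. For an algebra $\Lambda$, representations are modules that are finite-dimensional over $\mathbb C$; a torsion class is a collection of representations closed under isomorphisms, quotients, and extensions; $\mathsf{Tors}(\Lambda)$ is the poset of torsion classes under inclusion. A maximal green sequence for $\Lambda$ is a finite maximal chain in $\mathsf{Tors}(\Lambda)$; its length is one less than its number of elements. *)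

theory Defs
  imports
    Complex_Main
    "HOL-Algebra.QuotRing"
    "HOL-Algebra.Ideal_Product"
    "HOL-Algebra.Module"
    "Graph_Theory.Arc_Walk"
begin

section \<open>Path algebras\<close>

text \<open>
  A quiver is a \<^typ>\<open>('a, 'b) pre_digraph\<close>. A path is a pair of its starting vertex and its list of
  arrows, so that every vertex \<open>u\<close> carries a trivial path \<open>(u, [])\<close>. A \<open>\<complex>\<close>-algebra is an
  HOL-Algebra record with scalar multiplication; multiplication need not be commutative.
\<close>

type_synonym ('a, 'b) path = "'a \<times> 'b list"

definition paths :: "('a, 'b) pre_digraph \<Rightarrow> ('a, 'b) path set" where
  "paths Q = {(u, p). \<exists>v. pre_digraph.awalk Q u p v}"

definition path_end :: "('a, 'b) pre_digraph \<Rightarrow> ('a, 'b) path \<Rightarrow> 'a" where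
  "path_end Q = (\<lambda>(u, p). pre_digraph.awlast Q u p)"

text \<open>All pairs of composable paths whose concatenation is \<open>r\<close>.\<close>

definition path_splits ::
  "('a, 'b) pre_digraph \<Rightarrow> ('a, 'b) path \<Rightarrow> (('a, 'b) path \<times> ('a, 'b) path) set" where
  "path_splits Q r = {(p, q). p \<in> paths Q \<and> q \<in> paths Q \<and> path_end Q p = fst q
     \<and> (fst p, snd p @ snd q) = r}"

definition path_algebra ::
  "('a, 'b) pre_digraph \<Rightarrow> (complex, ('a, 'b) path \<Rightarrow> complex) module" where
  "path_algebra Q =
    \<lparr>carrier = {f. finite {r. f r \<noteq> 0} \<and> {r. f r \<noteq> 0} \<subseteq> paths Q},
     mult = (\<lambda>f g r. \<Sum>(p, q) \<in> path_splits Q r. f p * g q),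
     one = (\<lambda>r. of_bool (\<exists>u \<in> verts Q. r = (u, []))),
     zero = (\<lambda>_. 0),
     add = (\<lambda>f g r. f r + g r),
     smult = (\<lambda>c f r. c * f r)\<rparr>"

definition path_elem :: "('a, 'b) path \<Rightarrow> ('a, 'b) path \<Rightarrow> complex" where
  "path_elem r = (\<lambda>s. of_bool (s = r))"


section \<open>Quotients and completions of algebras\<close>

text \<open>The library's quotient ring \<open>R Quot I\<close>, together with the induced scalar multiplication.\<close>

definition quot_algebra :: "(complex, 'x) module \<Rightarrow> 'x set \<Rightarrow> (complex, 'x set) module" where
  "quot_algebra R I =
    \<lparr>carrier = carrier (R Quot I), mult = mult (R Quot I), one = one (R Quot I),
     zero = zero (R Quot I), add = add (R Quot I),
     smult = (\<lambda>c X. \<Union>x \<in> X. I +>\<^bsub>R\<^esub> (c \<odot>\<^bsub>R\<^esub> x))\<rparr>"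

primrec ideal_power :: "(complex, 'x) module \<Rightarrow> 'x set \<Rightarrow> nat \<Rightarrow> 'x set" where
  "ideal_power R I 0 = carrier R"
| "ideal_power R I (Suc k) = ideal_power R I k \<cdot>\<^bsub>R\<^esub> I"

text \<open>
  The inverse limit of the quotients \<open>R / I\<^sup>k\<close>. The canonical projection from \<open>R / I\<^sup>k\<^sup>+\<^sup>1\<close> to
  \<open>R / I\<^sup>k\<close> sends a coset \<open>X\<close> to \<open>I\<^sup>k + X\<close>.
\<close>

definition completion :: "(complex, 'x) module \<Rightarrow> 'x set \<Rightarrow> (complex, nat \<Rightarrow> 'x set) module" where
  "completion R I = (let A = (\<lambda>k. quot_algebra R (ideal_power R I k)) in
    \<lparr>carrier = {x. (\<forall>k. x k \<in> carrier (A k))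
                 \<and> (\<forall>k. ideal_power R I k <+>\<^bsub>R\<^esub> x (Suc k) = x k)},
     mult = (\<lambda>x y k. x k \<otimes>\<^bsub>A k\<^esub> y k),
     one = (\<lambda>k. \<one>\<^bsub>A k\<^esub>),
     zero = (\<lambda>k. \<zero>\<^bsub>A k\<^esub>),
     add = (\<lambda>x y k. x k \<oplus>\<^bsub>A k\<^esub> y k),
     smult = (\<lambda>c x k. c \<odot>\<^bsub>A k\<^esub> x k)\<rparr>)"


section \<open>The algebras of the oriented cycle\<close>

text \<open>The arrow \<open>i\<close> is the one from \<open>i\<close> to \<open>i + 1\<close>, where \<open>\<int>/n\<int>\<close> is represented by \<open>{0..<n}\<close>.\<close>

definition cycle_quiver :: "nat \<Rightarrow> (nat, nat) pre_digraph" where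
  "cycle_quiver n =
    \<lparr>verts = {0..<n}, arcs = {0..<n}, tail = (\<lambda>i. i), head = (\<lambda>i. (i + 1) mod n)\<rparr>"

definition cyclic_tamari_algebra ::
  "nat \<Rightarrow> (complex, ((nat, nat) path \<Rightarrow> complex) set) module" where
  "cyclic_tamari_algebra n = (let R = path_algebra (cycle_quiver n) in
     quot_algebra R (Idl\<^bsub>R\<^esub> (path_elem ` {r \<in> paths (cycle_quiver n). length (snd r) = n})))"

definition arrow_ideal :: "('a, 'b) pre_digraph \<Rightarrow> (('a, 'b) path \<Rightarrow> complex) set" where
  "arrow_ideal Q = Idl\<^bsub>path_algebra Q\<^esub> ((\<lambda>a. path_elem (tail Q a, [a])) ` arcs Q)"

definition completed_path_algebra ::
  "('a, 'b) pre_digraph \<Rightarrow> (complex, nat \<Rightarrow> (('a, 'b) path \<Rightarrow> complex) set) module" where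
  "completed_path_algebra Q = completion (path_algebra Q) (arrow_ideal Q)"


section \<open>Finite-dimensional modules\<close>

text \<open>
  Modules are left modules. (The library's locale \<^locale>\<open>module\<close> requires a commutative base
  ring.) \<open>\<complex>\<close> acts on a module through the scalar multiples of the unit of the algebra.
  All modules have their underlying set inside the fixed type \<open>nat \<Rightarrow> complex\<close>. This is large
  enough to contain a copy of every \<open>\<complex>\<^sup>d\<close> and hence of every finite-dimensional module, so nothing
  is lost up to isomorphism. The fields \<^const>\<open>mult\<close> and \<^const>\<open>one\<close> of a module record carry
  no meaning.
\<close>

type_synonym 'x rep = "('x, nat \<Rightarrow> complex) module"

definition left_module :: "(complex, 'x) module \<Rightarrow> 'x rep \<Rightarrow> bool" where
  "left_module A M \<longleftrightarrow> abelian_group M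
    \<and> (\<forall>a \<in> carrier A. \<forall>x \<in> carrier M. a \<odot>\<^bsub>M\<^esub> x \<in> carrier M)
    \<and> (\<forall>a \<in> carrier A. \<forall>b \<in> carrier A. \<forall>x \<in> carrier M.
         (a \<oplus>\<^bsub>A\<^esub> b) \<odot>\<^bsub>M\<^esub> x = a \<odot>\<^bsub>M\<^esub> x \<oplus>\<^bsub>M\<^esub> b \<odot>\<^bsub>M\<^esub> x)
    \<and> (\<forall>a \<in> carrier A. \<forall>x \<in> carrier M. \<forall>y \<in> carrier M.
         a \<odot>\<^bsub>M\<^esub> (x \<oplus>\<^bsub>M\<^esub> y) = a \<odot>\<^bsub>M\<^esub> x \<oplus>\<^bsub>M\<^esub> a \<odot>\<^bsub>M\<^esub> y)
    \<and> (\<forall>a \<in> carrier A. \<forall>b \<in> carrier A. \<forall>x \<in> carrier M.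
         (a \<otimes>\<^bsub>A\<^esub> b) \<odot>\<^bsub>M\<^esub> x = a \<odot>\<^bsub>M\<^esub> (b \<odot>\<^bsub>M\<^esub> x))
    \<and> (\<forall>x \<in> carrier M. \<one>\<^bsub>A\<^esub> \<odot>\<^bsub>M\<^esub> x = x)"

definition fin_dim :: "(complex, 'x) module \<Rightarrow> 'x rep \<Rightarrow> bool" where
  "fin_dim A M \<longleftrightarrow> (\<exists>B. finite B \<and> B \<subseteq> carrier M \<and>
     (\<forall>x \<in> carrier M. \<exists>c. x = (\<Oplus>\<^bsub>M\<^esub> b \<in> B. (c b \<odot>\<^bsub>A\<^esub> \<one>\<^bsub>A\<^esub>) \<odot>\<^bsub>M\<^esub> b)))"

definition reps :: "(complex, 'x) module \<Rightarrow> 'x rep set" where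
  "reps A = {M. left_module A M \<and> fin_dim A M}"

definition rep_hom ::
  "(complex, 'x) module \<Rightarrow> 'x rep \<Rightarrow> 'x rep \<Rightarrow> ((nat \<Rightarrow> complex) \<Rightarrow> (nat \<Rightarrow> complex)) set" where
  "rep_hom A M N = {f. f \<in> carrier M \<rightarrow> carrier N
    \<and> (\<forall>x \<in> carrier M. \<forall>y \<in> carrier M. f (x \<oplus>\<^bsub>M\<^esub> y) = f x \<oplus>\<^bsub>N\<^esub> f y)
    \<and> (\<forall>a \<in> carrier A. \<forall>x \<in> carrier M. f (a \<odot>\<^bsub>M\<^esub> x) = a \<odot>\<^bsub>N\<^esub> f x)}"

definition rep_iso :: "(complex, 'x) module \<Rightarrow> 'x rep \<Rightarrow> 'x rep \<Rightarrow> bool" where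
  "rep_iso A M N \<longleftrightarrow> (\<exists>f \<in> rep_hom A M N. bij_betw f (carrier M) (carrier N))"

definition is_quotient :: "(complex, 'x) module \<Rightarrow> 'x rep \<Rightarrow> 'x rep \<Rightarrow> bool" where
  "is_quotient A M N \<longleftrightarrow> (\<exists>f \<in> rep_hom A M N. f ` carrier M = carrier N)"

text \<open>There is a short exact sequence \<open>0 \<rightarrow> L \<rightarrow> M \<rightarrow> N \<rightarrow> 0\<close>.\<close>

definition is_extension :: "(complex, 'x) module \<Rightarrow> 'x rep \<Rightarrow> 'x rep \<Rightarrow> 'x rep \<Rightarrow> bool" where
  "is_extension A L M N \<longleftrightarrow> (\<exists>f \<in> rep_hom A L M. \<exists>g \<in> rep_hom A M N.
     inj_on f (carrier L) \<and> f ` carrier L = {x \<in> carrier M. g x = \<zero>\<^bsub>N\<^esub>}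
     \<and> g ` carrier M = carrier N)"


section \<open>Torsion classes and maximal green sequences\<close>

text \<open>
  Torsion classes contain the zero module: the empty collection is excluded. Otherwise it would be
  an additional least element and would lengthen every maximal chain by one.
\<close>

definition torsion_class :: "(complex, 'x) module \<Rightarrow> 'x rep set \<Rightarrow> bool" where
  "torsion_class A T \<longleftrightarrow> T \<subseteq> reps A \<and> T \<noteq> {}
    \<and> (\<forall>M \<in> T. \<forall>N \<in> reps A. rep_iso A M N \<longrightarrow> N \<in> T)
    \<and> (\<forall>M \<in> T. \<forall>N \<in> reps A. is_quotient A M N \<longrightarrow> N \<in> T)
    \<and> (\<forall>L \<in> T. \<forall>N \<in> T. \<forall>M \<in> reps A. is_extension A L M N \<longrightarrow> M \<in> T)"

definition Tors :: "(complex, 'x) module \<Rightarrow> 'x rep set set" where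
  "Tors A = {T. torsion_class A T}"

definition maximal_green_sequence :: "(complex, 'x) module \<Rightarrow> 'x rep set set \<Rightarrow> bool" where
  "maximal_green_sequence A C \<longleftrightarrow> finite C \<and> subset.maxchain (Tors A) C"

definition mgs_lengths :: "(complex, 'x) module \<Rightarrow> nat set" where
  "mgs_lengths A = {card C - 1 | C. maximal_green_sequence A C}"

end

theory Submission
  imports "HOL-Computational_Algebra.Formal_Power_Series" Defs
begin

text \<open>
  Both algebras have the same lattice of torsion classes, and it is a lattice of integer functions.
  The bricks of either algebra are the uniserial modules of length at most \<open>n\<close>. Number the vertices so
  that every arrow acts by increasing the position by one, and unroll the cycle; a brick then is an
  interval \<open>[i, p)\<close> of integers with \<open>i < p \<le> i + n\<close>, up to simultaneous translation by \<open>n\<close>, where \<open>i\<close>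
  is the position of the top. Quotients of \<open>[i, p)\<close> are its initial segments, submodules are its final
  segments, and \<open>[i, p)\<close> is an extension of \<open>[i, j)\<close> by \<open>[j, p)\<close>. So the bricks in a torsion class are
  recorded by the function \<open>r\<close> that maps a top \<open>i\<close> to the largest \<open>p\<close> such that \<open>[i, p)\<close> lies in the
  class, and closure under extensions becomes the condition that \<open>i < j \<le> r i\<close> implies
  \<open>r j \<le> r i\<close>, unless \<open>r i\<close> already has its maximal value \<open>i + n\<close>. These are the reach functions below;
  they are cyclic analogues of the bracket vectors of the Tamari lattice.

  A torsion class consists of all modules whose brick quotients belong to it
  (\<open>tors_of_reach_of\<close>). The reason is that a module on which all long paths act by zero has a
  uniserial direct summand whose length is its Loewy length (\<open>split_uniserial\<close>), so that it can be
  built from its brick quotients by extensions. In the completed path algebra the sum \<open>z\<close> of the paths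
  of length \<open>n\<close> is central and \<open>1 - c z\<close> is invertible for all scalars \<open>c\<close>, hence \<open>z\<close> is nilpotent on every
  finite-dimensional module (\<open>nilpotent_on_vector\<close>), and long paths act by zero there too.

  It remains to find the lengths of the saturated chains of reach functions. For the bounds, observe
  that the last but one element of such a chain consists of the modules without a fixed simple module
  in their top. Below this element, deleting the corresponding vertex maps reach functions for \<open>n\<close> to
  reach functions for \<open>n - 1\<close>; a cover is either kept as a cover or collapsed (\<open>restr_covers\<close>). At least
  one step and at most \<open>n - 1\<close> steps collapse (\<open>restr_sat_chain\<close>). So the minimal length grows by
  at least \<open>2\<close> and the maximal length by at most \<open>n\<close> from \<open>n - 1\<close> to \<open>n\<close>, starting with \<open>1\<close> for \<open>n = 1\<close>.
  Conversely, chains that first build up the torsion class of all modules not supported at one vertex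
  (a linear quiver with \<open>n - 1\<close> vertices, \<open>linear_chains\<close>) and then go to the top in \<open>n\<close> further steps
  realise every length between the bounds.
\<close>

section \<open>Saturated chains\<close>

definition covers :: "'a::order set \<Rightarrow> 'a \<Rightarrow> 'a \<Rightarrow> bool" where
  "covers P x y \<longleftrightarrow> x \<in> P \<and> y \<in> P \<and> x < y \<and> (\<forall>z \<in> P. x \<le> z \<and> z \<le> y \<longrightarrow> z = x \<or> z = y)"

inductive sat_chain :: "'a::order set \<Rightarrow> 'a \<Rightarrow> 'a \<Rightarrow> nat \<Rightarrow> bool" for P where
  start: "x \<in> P \<Longrightarrow> sat_chain P x x 0"
| step: "sat_chain P x y k \<Longrightarrow> covers P y z \<Longrightarrow> sat_chain P x z (Suc k)"

lemma sat_chain_in: "sat_chain P x y k \<Longrightarrow> x \<in> P \<and> y \<in> P \<and> x \<le> y"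
  by (induction rule: sat_chain.induct) (auto simp: covers_def)

lemma sat_chain_trans:
  assumes "sat_chain P x y k" "sat_chain P y z l"
  shows "sat_chain P x z (k + l)"
  using assms(2,1) by (induction rule: sat_chain.induct) (auto intro: sat_chain.intros)

lemma sat_chain_single: "covers P x y \<Longrightarrow> sat_chain P x y 1"
  using sat_chain.step[OF sat_chain.start] by (auto simp: covers_def)

lemma sat_chain_iso:
  assumes bij: "bij_betw f P Q" and mono: "\<And>x y. x \<in> P \<Longrightarrow> y \<in> P \<Longrightarrow> f x \<le> f y \<longleftrightarrow> x \<le> y"
  shows "sat_chain P x y k \<Longrightarrow> sat_chain Q (f x) (f y) k"
proof (induction rule: sat_chain.induct)
  case (start x)
  then show ?case using bij by (auto intro: sat_chain.start simp: bij_betw_def)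
next
  case (step x y k z)
  have yz: "y \<in> P" "z \<in> P" "y < z"
    and mid: "\<And>w. w \<in> P \<Longrightarrow> y \<le> w \<Longrightarrow> w \<le> z \<Longrightarrow> w = y \<or> w = z"
    using step(2) by (auto simp: covers_def)
  have "covers Q (f y) (f z)"
    unfolding covers_def
  proof (intro conjI ballI impI)
    show "f y \<in> Q" "f z \<in> Q" using yz bij by (auto simp: bij_betw_def)
    show "f y < f z" using yz mono by (metis less_le_not_le)
    fix w assume w: "w \<in> Q" "f y \<le> w \<and> w \<le> f z"
    then obtain v where "v \<in> P" "w = f v" using bij by (auto simp: bij_betw_def)
    then show "w = f y \<or> w = f z" using mid[of v] w mono yz by auto
  qed
  then show ?case using step.IH by (rule sat_chain.step[rotated])
qed

lemma sat_chain_iso_iff: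
  assumes bij: "bij_betw f P Q" and mono: "\<And>x y. x \<in> P \<Longrightarrow> y \<in> P \<Longrightarrow> f x \<le> f y \<longleftrightarrow> x \<le> y"
    and x: "x \<in> P" "y \<in> P"
  shows "sat_chain Q (f x) (f y) k \<longleftrightarrow> sat_chain P x y k"
proof
  let ?g = "inv_into P f"
  have g: "bij_betw ?g Q P" using bij by (rule bij_betw_inv_into)
  have "?g (f x) = x" "?g (f y) = y" using bij x by (auto simp: bij_betw_def inv_into_f_f)
  moreover have "?g u \<le> ?g v \<longleftrightarrow> u \<le> v" if "u \<in> Q" "v \<in> Q" for u v
  proof -
    have "?g u \<in> P" "?g v \<in> P" using g that by (auto simp: bij_betw_def)
    then have "?g u \<le> ?g v \<longleftrightarrow> f (?g u) \<le> f (?g v)" using mono by blast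
    then show ?thesis using bij that by (simp add: bij_betw_def f_inv_into_f)
  qed
  ultimately show "sat_chain P x y k" if "sat_chain Q (f x) (f y) k"
    using sat_chain_iso[OF g _ that] by simp
qed (rule sat_chain_iso[OF bij mono])

text \<open>
  The last conjunct is the maximality that is needed of the chain: an element of the interval that is
  comparable to all its members already belongs to it.
\<close>

lemma maximal_chain_of_sat_chain:
  assumes "sat_chain P x y k"
  shows "\<exists>C. C \<subseteq> P \<and> finite C \<and> card C = Suc k \<and> x \<in> C \<and> y \<in> C
    \<and> (\<forall>c \<in> C. x \<le> c \<and> c \<le> y) \<and> (\<forall>c \<in> C. \<forall>d \<in> C. c \<le> d \<or> d \<le> c)
    \<and> (\<forall>z \<in> P. x \<le> z \<and> z \<le> y \<and> (\<forall>c \<in> C. c \<le> z \<or> z \<le> c) \<longrightarrow> z \<in> C)"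
  using assms
proof (induction rule: sat_chain.induct)
  case (start x)
  then show ?case by (intro exI[of _ "{x}"]) auto
next
  case (step x y k z)
  then obtain C where C: "C \<subseteq> P" "finite C" "card C = Suc k" "x \<in> C" "y \<in> C"
    "\<forall>c \<in> C. x \<le> c \<and> c \<le> y" "\<forall>c \<in> C. \<forall>d \<in> C. c \<le> d \<or> d \<le> c"
    "\<forall>z \<in> P. x \<le> z \<and> z \<le> y \<and> (\<forall>c \<in> C. c \<le> z \<or> z \<le> c) \<longrightarrow> z \<in> C" by blast
  have yz: "y \<in> P" "z \<in> P" "y < z"
    and mid: "\<And>w. w \<in> P \<Longrightarrow> y \<le> w \<Longrightarrow> w \<le> z \<Longrightarrow> w = y \<or> w = z"
    using step(2) by (auto simp: covers_def)
  have bnd: "x \<le> c" "c \<le> y" "c < z" if "c \<in> C" for c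
    using C(6) yz(3) that by (auto intro: le_less_trans)
  have nz: "z \<notin> C" using bnd(3) by blast
  have xz: "x \<le> z" using bnd(1)[OF C(5)] yz(3) by (rule order.trans[OF _ less_imp_le])
  show ?case
  proof (intro exI[of _ "insert z C"] conjI)
    show "\<forall>c \<in> insert z C. x \<le> c \<and> c \<le> z" using bnd xz by (auto intro: less_imp_le)
    show "\<forall>c\<in>insert z C. \<forall>d\<in>insert z C. c \<le> d \<or> d \<le> c"
      using C(7) bnd(3) by (auto intro: less_imp_le)
    show "\<forall>w\<in>P. x \<le> w \<and> w \<le> z \<and> (\<forall>c\<in>insert z C. c \<le> w \<or> w \<le> c) \<longrightarrow> w \<in> insert z C"
    proof (intro ballI impI)
      fix w assume w: "w \<in> P" "x \<le> w \<and> w \<le> z \<and> (\<forall>c\<in>insert z C. c \<le> w \<or> w \<le> c)"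
      then have "w \<le> y \<or> y \<le> w" using C(5) by blast
      then show "w \<in> insert z C"
      proof
        assume "w \<le> y"
        then show ?thesis using C(8) w by blast
      next
        assume "y \<le> w"
        then show ?thesis using mid[of w] w C(5) by blast
      qed
    qed
  qed (use C(1-4) yz nz in simp_all)
qed

lemma sat_chain_of_maximal_chain:
  fixes P :: "'a::order set"
  assumes fin: "finite C" and CP: "C \<subseteq> P" and b: "b \<in> C" "\<And>x. x \<in> P \<Longrightarrow> b \<le> x"
    and lin: "\<And>c d. c \<in> C \<Longrightarrow> d \<in> C \<Longrightarrow> c \<le> d \<or> d \<le> c"
    and max: "\<And>z. z \<in> P \<Longrightarrow> (\<And>c. c \<in> C \<Longrightarrow> c \<le> z \<or> z \<le> c) \<Longrightarrow> z \<in> C"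
  shows "c \<in> C \<Longrightarrow> sat_chain P b c (card {d \<in> C. d < c})"
proof (induction "card {d \<in> C. d < c}" arbitrary: c rule: less_induct)
  case less
  let ?D = "{d \<in> C. d < c}"
  show ?case
  proof (cases "c = b")
    case True
    then have "?D = {}" using b(2) CP leD by blast
    then have "card ?D = 0" by (simp only: card.empty)
    then show ?thesis using True b CP by (auto intro: sat_chain.start simp del: card_eq_0_iff)
  next
    case False
    have finD: "finite ?D" using fin by simp
    have "b \<in> ?D" using b False less.prems CP by (auto simp: less_le)
    then obtain m where m: "m \<in> ?D" "\<forall>d \<in> ?D. m \<le> d \<longrightarrow> m = d"
      using finite_has_maximal[OF finD] by blast
    have mx: "d \<le> m" if "d \<in> ?D" for d using m lin[of d m] that by auto
    have D: "?D = insert m {d \<in> C. d < m}"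
      using m mx by (auto simp: less_le)
    have card: "card ?D = Suc (card {d \<in> C. d < m})"
      unfolding D by (rule card_insert_disjoint) (use fin in auto)
    have "covers P m c"
      unfolding covers_def
    proof (intro conjI ballI impI)
      fix z assume z: "z \<in> P" "m \<le> z \<and> z \<le> c"
      have "d \<le> z \<or> z \<le> d" if d: "d \<in> C" for d
      proof (cases "d < c")
        case True
        then show ?thesis using mx[of d] z d by auto
      next
        case False
        then show ?thesis using lin[OF d less.prems] z by auto
      qed
      then have "z \<in> C" using max z by blast
      then show "z = m \<or> z = c" using mx[of z] z by force
    qed (use m less.prems CP in auto)
    moreover have "sat_chain P b m (card {d \<in> C. d < m})"
      by (rule less.hyps) (use card m in auto)
    ultimately show ?thesis unfolding card by (rule sat_chain.step[rotated])
  qed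
qed

text \<open>
  The elements of a finite maximal chain, listed in increasing order, cover each other: anything
  strictly between two neighbours would be comparable to the whole chain.
\<close>

lemma maxchain_lengths:
  fixes P :: "'a set set"
  assumes b: "b \<in> P" "\<And>x. x \<in> P \<Longrightarrow> b \<subseteq> x" and t: "t \<in> P" "\<And>x. x \<in> P \<Longrightarrow> x \<subseteq> t"
  shows "{card C - 1 | C. finite C \<and> subset.maxchain P C} = {k. sat_chain P b t k}"
proof (intro equalityI subsetI)
  fix k assume "k \<in> {card C - 1 | C. finite C \<and> subset.maxchain P C}"
  then obtain C where C: "finite C" "subset.maxchain P C" and k: "k = card C - 1" by blast
  have ch: "C \<subseteq> P" "\<And>c d. c \<in> C \<Longrightarrow> d \<in> C \<Longrightarrow> c \<subseteq> d \<or> d \<subseteq> c"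
    using C(2) by (auto simp: subset.maxchain_def subset_chain_def)
  have mx: "z \<in> C" if "z \<in> P" "\<And>c. c \<in> C \<Longrightarrow> c \<subseteq> z \<or> z \<subseteq> c" for z
  proof (rule ccontr)
    assume "z \<notin> C"
    moreover have "subset.chain P (insert z C)"
      unfolding subset_chain_def using ch that by blast
    ultimately show False using C(2) by (auto simp: subset.maxchain_def)
  qed
  have bC: "b \<in> C" by (rule mx) (use b ch in auto)
  have tC: "t \<in> C" by (rule mx) (use t ch in auto)
  have "sat_chain P b t (card {d \<in> C. d < t})"
    by (rule sat_chain_of_maximal_chain[OF C(1) ch(1) bC]) (use b ch mx tC in auto)
  moreover have "{d \<in> C. d < t} = C - {t}" using t ch by auto
  ultimately show "k \<in> {k. sat_chain P b t k}" using k tC C(1) by simp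
next
  fix k assume "k \<in> {k. sat_chain P b t k}"
  then have "sat_chain P b t k" by simp
  from maximal_chain_of_sat_chain[OF this] obtain C where C: "C \<subseteq> P" "finite C" "card C = Suc k"
      "\<forall>c \<in> C. \<forall>d \<in> C. c \<subseteq> d \<or> d \<subseteq> c"
      and mx: "\<forall>z \<in> P. b \<subseteq> z \<and> z \<subseteq> t \<and> (\<forall>c \<in> C. c \<subseteq> z \<or> z \<subseteq> c) \<longrightarrow> z \<in> C"
    by (elim exE conjE) (rule that)
  have "subset.maxchain P C"
    unfolding subset.maxchain_def
  proof (intro conjI notI)
    show ch: "subset.chain P C" using C by (simp add: subset_chain_def)
    assume "\<exists>S. subset.chain P S \<and> C \<subset> S"
    then obtain S z where S: "subset.chain P S" "C \<subset> S" and z: "z \<in> S" "z \<notin> C" by blast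
    have "z \<in> P" "\<forall>c \<in> C. c \<subseteq> z \<or> z \<subseteq> c"
      using S z unfolding subset_chain_def by blast+
    then show False using mx b(2) t(2) z by simp
  qed
  then have "k = card C - 1 \<and> finite C \<and> subset.maxchain P C" using C by simp
  then show "k \<in> {card C - 1 | C. finite C \<and> subset.maxchain P C}" by blast
qed

section \<open>Reach functions\<close>

text \<open>
  Every value \<open>r i\<close> lies in \<open>{i..i + n}\<close>. The intended reading is that the bricks with top \<open>i\<close> in a torsion
  class are the intervals \<open>[i, p)\<close> with \<open>i < p \<le> r i\<close>. If \<open>j \<le> r i\<close>, then \<open>[i, j)\<close> and \<open>[j, r j)\<close> have the
  extension \<open>[i, r j)\<close>, which explains the last condition; the alternative \<open>r i = i + n\<close> accounts for
  extensions that are longer than a brick.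
\<close>

definition reach :: "nat \<Rightarrow> (int \<Rightarrow> int) set" where
  "reach n = {r. \<forall>i. i \<le> r i \<and> r i \<le> i + int n \<and> r (i + int n) = r i + int n
     \<and> (\<forall>j. i < j \<and> j \<le> r i \<longrightarrow> r j \<le> r i \<or> r i = i + int n)}"

lemma reachI:
  assumes "\<And>i. i \<le> r i" "\<And>i. r i \<le> i + int n" "\<And>i. r (i + int n) = r i + int n"
    "\<And>i j. i < j \<Longrightarrow> j \<le> r i \<Longrightarrow> r i < i + int n \<Longrightarrow> r j \<le> r i"
  shows "r \<in> reach n"
  unfolding reach_def
proof (intro CollectI allI conjI impI)
  fix i j assume "i < j \<and> j \<le> r i"
  then show "r j \<le> r i \<or> r i = i + int n"
    using assms(2)[of i] assms(4)[of i j] by fastforce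
qed (use assms(1-3) in auto)

lemma reachD:
  assumes "r \<in> reach n"
  shows "i \<le> r i" "r i \<le> i + int n" "r (i + int n) = r i + int n"
    "i < j \<Longrightarrow> j \<le> r i \<Longrightarrow> r i < i + int n \<Longrightarrow> r j \<le> r i"
  using assms unfolding reach_def by (blast, blast, blast, force)

lemma periodic_shift:
  fixes f :: "int \<Rightarrow> 'a"
  assumes per: "\<And>i. f (i + p) = f i"
  shows "f (i + p * q) = f i"
proof -
  have up: "f (j + p * int m) = f j" for j m
  proof (induction m)
    case (Suc m)
    then show ?case using per[of "j + p * int m"] by (simp add: algebra_simps)
  qed simp
  show ?thesis
  proof (cases "0 \<le> q")
    case True
    then show ?thesis using up[of i "nat q"] by simp
  next
    case False
    then show ?thesis using up[of "i + p * q" "nat (- q)"] by simp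
  qed
qed

lemma reach_shift: "r \<in> reach n \<Longrightarrow> r (i + int n * q) = r i + int n * q"
  using periodic_shift[of "\<lambda>i. r i - i" "int n" i q] reachD(3)[of r n] by simp

lemma reach_congr:
  assumes r: "r \<in> reach n" and "i mod int n = a mod int n"
  shows "r i = r a + (i - a)"
proof -
  obtain q where "i - a = int n * q" using assms(2) by (auto simp: mod_eq_dvd_iff elim: dvdE)
  then have "i = a + int n * q" by simp
  then show ?thesis using reach_shift[OF r, of a q] by simp
qed

lemma reach_ge_iff:
  assumes "r \<in> reach n" "s \<in> reach n" "n > 0"
  shows "r \<le> s \<longleftrightarrow> (\<forall>i \<in> {0..<int n}. r i \<le> s i)"
proof
  assume *: "\<forall>i \<in> {0..<int n}. r i \<le> s i"
  show "r \<le> s"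
  proof (rule le_funI)
    fix i
    have "r (i mod int n + int n * (i div int n)) \<le> s (i mod int n + int n * (i div int n))"
      unfolding reach_shift[OF assms(1)] reach_shift[OF assms(2)] using * assms(3) by simp
    then show "r i \<le> s i" by simp
  qed
qed (auto simp: le_fun_def)

lemma reach_bot: "(\<lambda>i. i) \<in> reach n" by (rule reachI) auto
lemma reach_top: "(\<lambda>i. i + int n) \<in> reach n" by (rule reachI) auto

text \<open>
  The minimum is the intersection of torsion classes.
\<close>

lemma reach_min:
  assumes "r \<in> reach n" "s \<in> reach n"
  shows "(\<lambda>i. min (r i) (s i)) \<in> reach n"
proof (rule reachI)
  fix i j assume ij: "i < j" "j \<le> min (r i) (s i)" "min (r i) (s i) < i + int n"
  show "min (r j) (s j) \<le> min (r i) (s i)"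
    using reachD(2)[OF assms(1), of i] reachD(4)[OF assms(1), of i j]
      reachD(2)[OF assms(2), of i] reachD(4)[OF assms(2), of i j] reachD(2)[OF assms(1), of j] ij
    by (auto simp: min_def split: if_splits)
qed (use reachD[OF assms(1)] reachD[OF assms(2)] in \<open>auto simp: min_def\<close>)

section \<open>Changing one value\<close>

text \<open>
  The values at all positions congruent to \<open>a\<close> are changed simultaneously, to keep the function periodic.
\<close>

definition upd :: "nat \<Rightarrow> (int \<Rightarrow> int) \<Rightarrow> int \<Rightarrow> int \<Rightarrow> int \<Rightarrow> int" where
  "upd n r a v i = (if i mod int n = a mod int n then v + (i - a) else r i)"

lemma upd_same [simp]: "upd n r a v a = v" by (simp add: upd_def)

lemma upd_other: "0 \<le> i \<Longrightarrow> i < int n \<Longrightarrow> 0 \<le> a \<Longrightarrow> a < int n \<Longrightarrow> i \<noteq> a \<Longrightarrow> upd n r a v i = r i"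
  by (simp add: upd_def)

lemma upd_reach_iff:
  assumes r: "r \<in> reach n" and v: "a \<le> v" "v \<le> a + int n"
  shows "upd n r a v \<in> reach n \<longleftrightarrow>
    (\<forall>j. a < j \<and> j \<le> v \<and> v < a + int n \<longrightarrow> upd n r a v j \<le> v) \<and>
    (\<forall>i. i < a \<and> a \<le> r i \<and> r i < i + int n \<longrightarrow> v \<le> r i)" (is "?L \<longleftrightarrow> ?R")
proof
  assume L: ?L
  show ?R
  proof (intro conjI allI impI)
    fix j assume "a < j \<and> j \<le> v \<and> v < a + int n"
    then show "upd n r a v j \<le> v" using reachD(4)[OF L, of a j] by simp
  next
    fix i assume i: "i < a \<and> a \<le> r i \<and> r i < i + int n"
    then have "i mod int n \<noteq> a mod int n"
      using zdvd_not_zless[of "a - i" "int n"] by (auto simp: mod_eq_dvd_iff dvd_diff_commute)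
    then show "v \<le> r i" using reachD(4)[OF L, of i a] i by (simp add: upd_def)
  qed
next
  assume R: ?R
  show ?L
  proof (rule reachI)
    fix i j assume ij: "i < j" "j \<le> upd n r a v i" "upd n r a v i < i + int n"
    show "upd n r a v j \<le> upd n r a v i"
    proof (cases "i mod int n = a mod int n")
      case True
      have ai: "(j + (a - i)) mod int n = a mod int n \<longleftrightarrow> j mod int n = a mod int n"
      proof -
        have "int n dvd a - i" using True by (metis mod_eq_dvd_iff)
        then have "(j + (a - i)) mod int n = j mod int n" by (simp add: mod_eq_dvd_iff)
        then show ?thesis by simp
      qed
      obtain q where q: "a - i = int n * q" using True by (metis mod_eq_dvd_iff dvdE)
      have "upd n r a v (j + (a - i)) \<le> v" using R ij True by (auto simp: upd_def)
      moreover have "upd n r a v (j + (a - i)) = upd n r a v j + (a - i)"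
        using ai q reach_shift[OF r, of j q] by (simp add: upd_def)
      ultimately show ?thesis using True by (simp add: upd_def)
    next
      case False
      then have i: "upd n r a v i = r i" by (simp add: upd_def)
      show ?thesis
      proof (cases "j mod int n = a mod int n")
        case True
        then obtain q where q: "a - j = int n * q" by (metis mod_eq_dvd_iff dvdE)
        have "r (i + (a - j)) = r i + (a - j)" unfolding q by (rule reach_shift[OF r])
        then have "v \<le> r i + (a - j)" using R[THEN conjunct2, rule_format, of "i + (a - j)"] ij i
          by auto
        then show ?thesis using True i by (simp add: upd_def)
      next
        case False
        then show ?thesis using reachD(4)[OF r, of i j] ij i by (simp add: upd_def)
      qed
    qed
  qed (use reachD[OF r] v in \<open>auto simp: upd_def\<close>)
qed

text \<open>
  A function between \<open>r\<close> and an update of \<open>r\<close> in one place is itself such an update, so only the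
  intermediate values at this place have to be excluded.
\<close>

lemma upd_covers:
  assumes r: "r \<in> reach n" and n: "n > 0" and u: "upd n r a v \<in> reach n" and lt: "r a < v"
    and mid: "\<And>c. r a < c \<Longrightarrow> c < v \<Longrightarrow> upd n r a c \<notin> reach n"
  shows "covers (reach n) r (upd n r a v)"
  unfolding covers_def
proof (intro conjI ballI impI)
  show "r < upd n r a v"
  proof (rule le_neq_trans)
    show "r \<le> upd n r a v"
    proof (rule le_funI)
      show "r i \<le> upd n r a v i" for i using lt reach_congr[OF r, of i a] by (simp add: upd_def)
    qed
    show "r \<noteq> upd n r a v" using lt by (metis order_less_irrefl upd_same)
  qed
  fix z assume z: "z \<in> reach n" "r \<le> z \<and> z \<le> upd n r a v"
  have zle: "r i \<le> z i" "z i \<le> upd n r a v i" for i using z(2) by (auto simp: le_fun_def)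
  have "z i = upd n r a (z a) i" for i
    using zle[of i] reach_congr[OF z(1), of i a] by (auto simp: upd_def)
  then have e: "z = upd n r a (z a)" by blast
  have "upd n r a (r a) i = r i" for i using reach_congr[OF r, of i a] by (simp add: upd_def)
  then have "upd n r a (r a) = r" by blast
  moreover have "r a \<le> z a" "z a \<le> v" using zle[of a] by simp_all
  moreover have "\<not> (r a < z a \<and> z a < v)" using mid[of "z a"] e z(1) by auto
  ultimately show "z = r \<or> z = upd n r a v" using e by (metis order_le_less)
qed (use r u in auto)

text \<open>
  For torsion classes this is the passage to the modules whose top does not contain one given
  simple module; no condition on the remaining simple modules of the top can fail by it.
\<close>

lemma reach_reset:
  assumes "r \<in> reach n" "n > 0"
  shows "upd n r a a \<in> reach n" "upd n r a a \<le> r"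
proof -
  show "upd n r a a \<in> reach n"
    by (subst upd_reach_iff[OF assms(1)]) auto
  show "upd n r a a \<le> r" using reachD(1)[OF assms(1)] by (auto simp: upd_def le_fun_def)
qed

section \<open>Deleting a vertex\<close>

text \<open>
  The increasing enumeration of the integers that are not divisible by \<open>n\<close>, normalised such that
  \<open>1, \<dots>, n - 1\<close> are fixed. It turns the period \<open>n - 1\<close> into the period \<open>n\<close>.
\<close>

definition ins_pos :: "nat \<Rightarrow> int \<Rightarrow> int" where
  "ins_pos n k = k + (k - 1) div (int n - 1)"

text \<open>
  The left inverse of \<open>ins_pos\<close> that identifies a multiple of \<open>n\<close> with its predecessor.
\<close>

definition del_pos :: "nat \<Rightarrow> int \<Rightarrow> int" where
  "del_pos n p = p - p div int n"

text \<open>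
  The two maps form a Galois connection. Nearly all facts about the deletion of a vertex follow from
  this without looking at the definitions again.
\<close>

lemma ins_del_galois:
  assumes n: "n \<ge> 2"
  shows "ins_pos n k \<le> p \<longleftrightarrow> k \<le> del_pos n p"
proof -
  define m where "m = int n - 1"
  define q where "q = (k - 1) div m"
  define s where "s = (k - 1) mod m"
  define u where "u = p div int n"
  define v where "v = p mod int n"
  have m: "m \<ge> 1" "int n = m + 1" using n by (auto simp: m_def)
  have k: "k = m * q + s + 1" "0 \<le> s" "s < m"
    using m mult_div_mod_eq[of m "k - 1"] by (auto simp: q_def s_def)
  have p: "p = (m + 1) * u + v" "0 \<le> v" "v < m + 1"
    using m mult_div_mod_eq[of "int n" p] pos_mod_bound[of "int n" p] by (auto simp: u_def v_def)
  have 1: "ins_pos n k = (m + 1) * q + s + 1"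
    unfolding ins_pos_def by (simp add: m_def[symmetric] q_def[symmetric]) (simp add: k algebra_simps)
  have 2: "del_pos n p = m * u + v"
    unfolding del_pos_def by (simp add: u_def[symmetric]) (simp add: p algebra_simps)
  consider "q < u" | "q = u" | "q > u" by linarith
  then show ?thesis
  proof cases
    case 1
    then have "(m + 1) * (q + 1) \<le> (m + 1) * u" "m * (q + 1) \<le> m * u" using m by auto
    then show ?thesis using \<open>ins_pos n k = _\<close> 2 k p by (simp add: algebra_simps)
  next
    case 2
    then show ?thesis using 1 \<open>del_pos n p = _\<close> k p by (simp add: algebra_simps)
  next
    case 3
    then have "(m + 1) * (u + 1) \<le> (m + 1) * q" "m * (u + 1) \<le> m * q" using m by auto
    then show ?thesis using 1 2 k p by (simp add: algebra_simps)
  qed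
qed

lemma ins_pos_shift:
  assumes n: "n \<ge> 2"
  shows "ins_pos n (k + int (n - 1)) = ins_pos n k + int n"
proof -
  have "(k + (int n - 1) - 1) div (int n - 1) = (k - 1) div (int n - 1) + 1"
    using div_add_self2[of "int n - 1" "k - 1"] n by (simp add: algebra_simps)
  then show ?thesis using n by (simp add: ins_pos_def algebra_simps of_nat_diff)
qed

lemma del_pos_shift:
  assumes n: "n \<ge> 2"
  shows "del_pos n (p + int n) = del_pos n p + int (n - 1)"
  using n by (simp add: del_pos_def of_nat_diff)

lemma ins_pos_small: "n \<ge> 2 \<Longrightarrow> 1 \<le> k \<Longrightarrow> k < int n \<Longrightarrow> ins_pos n k = k"
  by (simp add: ins_pos_def)

lemma del_pos_mono: "n \<ge> 2 \<Longrightarrow> p \<le> q \<Longrightarrow> del_pos n p \<le> del_pos n q"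
  using ins_del_galois[of n "del_pos n p" p] ins_del_galois[of n "del_pos n p" q] by auto

lemma del_ins: "n \<ge> 2 \<Longrightarrow> del_pos n (ins_pos n k) = k"
proof -
  assume n: "n \<ge> 2"
  have "k \<le> del_pos n (ins_pos n k)" using ins_del_galois[OF n, of k "ins_pos n k"] by simp
  moreover have "ins_pos n k < ins_pos n (k + 1)"
    using n zdiv_mono1[of "k - 1" k "int n - 1"] by (simp add: ins_pos_def)
  then have "\<not> k + 1 \<le> del_pos n (ins_pos n k)"
    using ins_del_galois[OF n, of "k + 1" "ins_pos n k"] by simp
  ultimately show ?thesis by simp
qed

lemma ins_pos_less: "n \<ge> 2 \<Longrightarrow> i < j \<Longrightarrow> ins_pos n i < ins_pos n j"
  using ins_del_galois[of n j "ins_pos n i"] del_ins[of n i] by fastforce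

lemma ins_pos_not_dvd:
  assumes n: "n \<ge> 2"
  shows "\<not> int n dvd ins_pos n k"
proof
  assume "int n dvd ins_pos n k"
  then obtain q where q: "ins_pos n k = int n * q" by (elim dvdE)
  have "del_pos n (int n * q - 1) = int n * q - q"
  proof -
    have "(int n * q - 1) div int n = q - 1"
    proof -
      have e: "int n * q - 1 = (int n - 1) + int n * (q - 1)" by (simp add: algebra_simps)
      show ?thesis unfolding e using n by (subst div_mult_self2) auto
    qed
    then show ?thesis by (simp add: del_pos_def)
  qed
  moreover have "del_pos n (int n * q) = int n * q - q" using n by (simp add: del_pos_def)
  ultimately have "k \<le> del_pos n (int n * q - 1)" using del_ins[OF n, of k] q by simp
  then show False using ins_del_galois[OF n, of k "int n * q - 1"] q by simp
qed

lemma ins_del: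
  assumes n: "n \<ge> 2" and i: "\<not> int n dvd i"
  shows "ins_pos n (del_pos n i) = i"
proof -
  have "ins_pos n (del_pos n i) \<le> i" using ins_del_galois[OF n, of "del_pos n i" i] by simp
  moreover have "del_pos n (i - 1) = del_pos n i - 1"
  proof -
    have "(i - 1) div int n = i div int n"
    proof -
      have "i mod int n \<noteq> 0" "0 \<le> i mod int n" "i mod int n < int n"
        using i n by (auto simp: dvd_eq_mod_eq_0)
      then have "0 \<le> i mod int n - 1" "i mod int n - 1 < int n" by linarith+
      moreover have e: "i - 1 = (i mod int n - 1) + int n * (i div int n)" by simp
      ultimately show ?thesis using n by (subst e, subst div_mult_self2) (auto simp: div_pos_pos_trivial)
    qed
    then show ?thesis by (simp add: del_pos_def)
  qed
  then have "\<not> ins_pos n (del_pos n i) \<le> i - 1"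
    using ins_del_galois[OF n, of "del_pos n i" "i - 1"] by simp
  ultimately show ?thesis by simp
qed

text \<open>
  For torsion classes this is the passage from \<open>A\<close>-modules to \<open>eAe\<close>-modules, where \<open>e\<close> is the sum of the
  idempotents of all vertices but \<open>0\<close>: a module \<open>N\<close> belongs to the image of \<open>T\<close> if \<open>Ae \<otimes> N\<close> belongs to \<open>T\<close>.
\<close>

definition restr :: "nat \<Rightarrow> (int \<Rightarrow> int) \<Rightarrow> int \<Rightarrow> int" where
  "restr n r k = del_pos n (r (ins_pos n k))"

lemma le_restr_iff: "n \<ge> 2 \<Longrightarrow> k \<le> restr n r i \<longleftrightarrow> ins_pos n k \<le> r (ins_pos n i)"
  by (simp add: restr_def ins_del_galois)

lemma restr_mono: "n \<ge> 2 \<Longrightarrow> r \<le> s \<Longrightarrow> restr n r \<le> restr n s"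
  by (auto simp: le_fun_def restr_def intro: del_pos_mono)

lemma restr_reach:
  assumes n: "n \<ge> 2" and r: "r \<in> reach n"
  shows "restr n r \<in> reach (n - 1)"
proof (rule reachI)
  fix i
  show "i \<le> restr n r i" using reachD(1)[OF r] by (simp add: le_restr_iff[OF n])
  show "restr n r i \<le> i + int (n - 1)"
    using del_pos_mono[OF n reachD(2)[OF r, of "ins_pos n i"]]
    by (simp only: restr_def del_pos_shift[OF n] del_ins[OF n])
  show "restr n r (i + int (n - 1)) = restr n r i + int (n - 1)"
    by (simp only: restr_def ins_pos_shift[OF n] reachD(3)[OF r] del_pos_shift[OF n])
  fix j assume ij: "i < j" "j \<le> restr n r i" "restr n r i < i + int (n - 1)"
  have "r (ins_pos n i) < ins_pos n i + int n"
  proof (rule ccontr)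
    assume "\<not> ?thesis"
    then have "ins_pos n (i + int (n - 1)) \<le> r (ins_pos n i)" by (simp only: ins_pos_shift[OF n])
    then show False using ij(3) le_restr_iff[OF n] by (metis leD)
  qed
  then have "r (ins_pos n j) \<le> r (ins_pos n i)"
    using reachD(4)[OF r ins_pos_less[OF n ij(1)]] ij(2) by (simp add: le_restr_iff[OF n])
  then show "restr n r j \<le> restr n r i" unfolding restr_def by (rule del_pos_mono[OF n])
qed

text \<open>
  The largest reach function \<open>r\<close> with \<open>r 0 = 0\<close> and \<open>restr n r \<le> u\<close>.
\<close>

definition lift :: "nat \<Rightarrow> (int \<Rightarrow> int) \<Rightarrow> int \<Rightarrow> int" where
  "lift n u i = (if int n dvd i then i else min (i + int n) (ins_pos n (u (del_pos n i) + 1) - 1))"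

lemma le_lift_iff:
  assumes n: "n \<ge> 2" and i: "\<not> int n dvd i" "p \<le> i + int n"
  shows "p \<le> lift n u i \<longleftrightarrow> del_pos n p \<le> u (del_pos n i)"
  using ins_del_galois[OF n, of "u (del_pos n i) + 1" p] i by (auto simp: lift_def)

lemma lift_reach:
  assumes n: "n \<ge> 2" and u: "u \<in> reach (n - 1)"
  shows "lift n u \<in> reach n"
proof (rule reachI)
  fix i
  show "i \<le> lift n u i"
    using le_lift_iff[OF n, of i i u] reachD(1)[OF u] by (cases "int n dvd i") (auto simp: lift_def)
  show "lift n u i \<le> i + int n" by (simp add: lift_def)
  show "lift n u (i + int n) = lift n u i + int n"
    using reachD(3)[OF u, of "del_pos n i"] ins_pos_shift[OF n, of "u (del_pos n i) + 1"]
    by (auto simp: lift_def del_pos_shift[OF n] algebra_simps min_def)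
  fix j assume ij: "i < j" "j \<le> lift n u i" "lift n u i < i + int n"
  have i: "\<not> int n dvd i" using ij by (auto simp: lift_def)
  have e: "lift n u i = ins_pos n (u (del_pos n i) + 1) - 1" using ij(3) i by (simp add: lift_def)
  show "lift n u j \<le> lift n u i"
  proof (cases "int n dvd j")
    case True
    then show ?thesis using ij by (simp add: lift_def)
  next
    case False
    define a b where "a = del_pos n i" and "b = del_pos n j"
    have ab: "ins_pos n a = i" "ins_pos n b = j" using ins_del[OF n] i False by (auto simp: a_def b_def)
    then have "a < b" using ij(1) ins_pos_less[OF n, of b a] by (cases a b rule: linorder_cases) auto
    moreover have "b \<le> u a" using le_lift_iff[OF n i, of j u] ij by (simp add: a_def b_def)
    moreover have "u a < a + int (n - 1)"
    proof (rule ccontr)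
      assume "\<not> ?thesis"
      then have "a + int (n - 1) < u a + 1" by simp
      from ins_pos_less[OF n this] show False using ij(3) e ab ins_pos_shift[OF n, of a]
        by (simp add: a_def[symmetric])
    qed
    ultimately have "u b \<le> u a" using reachD(4)[OF u] by blast
    then have "ins_pos n (u b + 1) \<le> ins_pos n (u a + 1)"
      using ins_pos_less[OF n, of "u b + 1" "u a + 1"] by (cases "u a = u b") auto
    then show ?thesis unfolding e using False by (simp add: lift_def a_def b_def)
  qed
qed

lemma restr_lift:
  assumes n: "n \<ge> 2" and u: "u \<in> reach (n - 1)"
  shows "restr n (lift n u) = u"
proof
  fix k
  let ?i = "ins_pos n k"
  have i: "\<not> int n dvd ?i" by (rule ins_pos_not_dvd[OF n])
  have "restr n (lift n u) k \<le> u k"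
    using le_lift_iff[OF n i, of "lift n u ?i" u] reachD(2)[OF lift_reach[OF n u]]
    by (simp add: restr_def del_ins[OF n])
  moreover have "ins_pos n (u k) \<le> ?i + int n"
    using ins_pos_less[OF n, of "u k" "k + int (n - 1)"] reachD(2)[OF u, of k]
      ins_pos_shift[OF n, of k]
    by (cases "u k = k + int (n - 1)") auto
  then have "u k \<le> restr n (lift n u) k"
    using le_lift_iff[OF n i, of "ins_pos n (u k)" u] by (simp add: le_restr_iff[OF n] del_ins[OF n])
  ultimately show "restr n (lift n u) k = u k" by simp
qed

lemma le_lift:
  assumes n: "n \<ge> 2" and r: "r \<in> reach n" "r 0 = 0" and le: "restr n r \<le> u"
  shows "r \<le> lift n u"
proof (rule le_funI)
  fix i
  show "r i \<le> lift n u i"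
  proof (cases "int n dvd i")
    case True
    then obtain q where "i = int n * q" by (elim dvdE)
    then show ?thesis using reach_shift[OF r(1), of 0 q] r(2) by (simp add: lift_def)
  next
    case False
    have "del_pos n (r i) \<le> u (del_pos n i)"
      using le ins_del[OF n False] by (metis le_fun_def restr_def)
    then show ?thesis using le_lift_iff[OF n False, of "r i" u] reachD(2)[OF r(1)] by simp
  qed
qed

text \<open>
  Both maps \<open>restr\<close> and \<open>lift\<close> are compatible with minima. So an element \<open>u\<close> strictly between the images of
  \<open>f\<close> and \<open>g\<close> would give the element \<open>min g (lift u)\<close> strictly between \<open>f\<close> and \<open>g\<close>.
\<close>

lemma restr_covers:
  assumes n: "n \<ge> 2" and c: "covers (reach n) f g" and g0: "g 0 = 0"
  shows "restr n f = restr n g \<or> covers (reach (n - 1)) (restr n f) (restr n g)"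
proof -
  have fg: "f \<in> reach n" "g \<in> reach n" "f \<le> g"
    and mid: "\<And>w. w \<in> reach n \<Longrightarrow> f \<le> w \<Longrightarrow> w \<le> g \<Longrightarrow> w = f \<or> w = g"
    using c by (auto simp: covers_def)
  have f0: "f 0 = 0" using fg(3) g0 reachD(1)[OF fg(1), of 0] by (auto simp: le_fun_def dest: spec[of _ 0])
  have "u = restr n f \<or> u = restr n g"
    if u: "u \<in> reach (n - 1)" "restr n f \<le> u" "u \<le> restr n g" for u
  proof -
    \<comment> \<open>The element of the fibre over \<open>u\<close> that lies in the interval from \<open>f\<close> to \<open>g\<close>.\<close>
    define w where "w = (\<lambda>i. min (g i) (lift n u i))"
    have "w \<in> reach n" unfolding w_def by (rule reach_min[OF fg(2) lift_reach[OF n u(1)]])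
    moreover have "f \<le> w" using fg(3) le_lift[OF n fg(1) f0 u(2)] by (simp add: w_def le_fun_def)
    moreover have "w \<le> g" by (simp add: w_def le_fun_def)
    ultimately have "w = f \<or> w = g" by (rule mid)
    moreover have "restr n w = u"
    proof
      fix k
      have mm: "del_pos n (min a b) = min (del_pos n a) (del_pos n b)" for a b
        using del_pos_mono[OF n, of a b] del_pos_mono[OF n, of b a] by (auto simp: min_def)
      have "restr n w k = min (restr n g k) (restr n (lift n u) k)"
        by (simp add: restr_def w_def mm)
      then show "restr n w k = u k" using u(3) by (simp add: restr_lift[OF n u(1)] le_fun_def)
    qed
    ultimately show ?thesis by auto
  qed
  moreover have "restr n f \<le> restr n g" by (rule restr_mono[OF n fg(3)])
  ultimately show ?thesis
    unfolding covers_def using restr_reach[OF n fg(1)] restr_reach[OF n fg(2)]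
    by (simp add: less_le)
qed

section \<open>Bounds on the length of saturated chains\<close>

text \<open>
  A collapsed step changes the value at some \<open>s\<close> in \<open>{1..n - 1}\<close> from \<open>n - 1\<close> to \<open>n\<close>, since these are the only
  values below \<open>s + n + 1\<close> that deletion identifies. This happens at most once for each \<open>s\<close>, which gives
  the upper bound. The lower bound comes from the step at which the value at \<open>n - 1\<close> stops being minimal,
  that is, at which the simple module at \<open>n - 1\<close> is added: by minimality of the step, the new value is \<open>n\<close>,
  and no other value changes, so this step is collapsed.
\<close>

lemma restr_sat_chain:
  assumes n: "n \<ge> 2"
  shows "sat_chain (reach n) b y k \<Longrightarrow> b = (\<lambda>i. i) \<Longrightarrow> y 0 = 0 \<Longrightarrow>
    \<exists>k'. sat_chain (reach (n - 1)) (\<lambda>i. i) (restr n y) k'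
      \<and> k' + of_bool (y (int n - 1) \<noteq> int n - 1) \<le> k
      \<and> k \<le> k' + card {s \<in> {1..int n - 1}. int n \<le> y s}"
proof (induction rule: sat_chain.induct)
  case (start x)
  have "restr n (\<lambda>i. i) = (\<lambda>i. i)" by (simp add: restr_def del_ins[OF n] fun_eq_iff)
  then show ?case using start sat_chain.start[OF reach_bot] by (intro exI[of _ 0]) auto
next
  case (step b f k g)
  let ?N = "\<lambda>y. {s \<in> {1..int n - 1}. int n \<le> y s}"
  have fg: "f \<in> reach n" "g \<in> reach n" "f \<le> g" "f \<noteq> g"
    and mid: "\<And>w. w \<in> reach n \<Longrightarrow> f \<le> w \<Longrightarrow> w \<le> g \<Longrightarrow> w = f \<or> w = g"
    using step(2) by (auto simp: covers_def)
  have fgi: "f i \<le> g i" for i using fg(3) by (simp add: le_fun_def)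
  have f0: "f 0 = 0" using fgi[of 0] step.prems reachD(1)[OF fg(1), of 0] by simp
  obtain k' where k': "sat_chain (reach (n - 1)) (\<lambda>i. i) (restr n f) k'"
    "k' + of_bool (f (int n - 1) \<noteq> int n - 1) \<le> k" "k \<le> k' + card (?N f)"
    using step.IH step.prems f0 by blast
  have sub: "?N f \<subseteq> ?N g" using fgi by (auto intro: order.trans)
  have finN: "finite (?N g)" by (rule finite_subset[of _ "{1..int n - 1}"]) auto
  show ?case
  proof (cases "restr n f = restr n g")
    case True
    \<comment> \<open>A collapsed step: some value changes from \<open>n - 1\<close> to \<open>n\<close>.\<close>
    have "\<exists>s \<in> ?N g. s \<notin> ?N f"
    proof -
      have "\<not> g \<le> f" using fg by auto
      then obtain s where s: "s \<in> {0..<int n}" "\<not> g s \<le> f s"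
        using reach_ge_iff[OF fg(2,1)] n by (meson order_less_le_trans pos2)
      then have s1: "1 \<le> s" "s \<le> int n - 1" using f0 step.prems(2) by (auto simp: order_le_less)
      have lt: "f s < g s" "f s \<ge> s" "g s \<le> s + int n"
        using s reachD(1)[OF fg(1), of s] reachD(2)[OF fg(2), of s] by auto
      have "restr n f s = restr n g s" using True by simp
      then have eq: "del_pos n (f s) = del_pos n (g s)"
        using ins_pos_small[OF n s1(1)] s1 by (simp add: restr_def)
      have "int n \<le> g s \<and> f s < int n"
      proof (rule ccontr)
        assume no: "\<not> (int n \<le> g s \<and> f s < int n)"
        show False
        proof (cases "g s < int n")
          case True
          then show False using eq lt s1 by (simp add: del_pos_def)
        next
          case False
          then have *: "int n \<le> f s" "f s < 2 * int n" "int n \<le> g s" "g s < 2 * int n"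
            using no lt s1 by auto
          have "x div int n = 1" if "int n \<le> x" "x < 2 * int n" for x
            using that n by (simp add: int_div_pos_eq[of x "int n" 1 "x - int n"])
          then show False using eq lt * by (simp add: del_pos_def)
        qed
      qed
      then show ?thesis using s1 by auto
    qed
    then have "card (?N f) < card (?N g)" using sub finN by (intro psubset_card_mono) auto
    then show ?thesis using k' True by (intro exI[of _ k']) (auto split: if_splits)
  next
    case False
    then have cov: "covers (reach (n - 1)) (restr n f) (restr n g)"
      using restr_covers[OF n step(2) step.prems(2)] by blast
    have "f (int n - 1) \<noteq> int n - 1 \<or> g (int n - 1) = int n - 1"
    proof (rule ccontr)
      let ?a = "int n - 1"
      assume "\<not> ?thesis"
      then have a: "f ?a = ?a" "g ?a > ?a" using reachD(1)[OF fg(2), of ?a] by auto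
      have fa: "f i = i" if "i mod int n = ?a mod int n" for i
        using reach_congr[OF fg(1) that] a by simp
      \<comment> \<open>Resetting \<open>g\<close> at \<open>n - 1\<close> gives something between \<open>f\<close> and \<open>g\<close>, so nothing else was changed.\<close>
      have e: "upd n g ?a ?a = f"
      proof -
        have "upd n g ?a ?a \<in> reach n" "upd n g ?a ?a \<le> g" using reach_reset[OF fg(2)] n by auto
        moreover have "f \<le> upd n g ?a ?a" using fgi fa by (auto simp: le_fun_def upd_def)
        moreover have "upd n g ?a ?a \<noteq> g" using a(2) by (metis upd_same order_less_irrefl)
        ultimately show ?thesis using mid by blast
      qed
      then have fg': "f i = (if i mod int n = ?a mod int n then i else g i)" for i
        using fun_cong[OF e, of i] by (auto simp: upd_def)
      \<comment> \<open>The value \<open>n\<close>, which adds just the simple module, is admissible, hence the step ends there.\<close>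
      have U: "upd n f ?a (int n) \<in> reach n"
      proof (subst upd_reach_iff[OF fg(1)]; (intro conjI allI impI)?)
        fix j assume "?a < j \<and> j \<le> int n \<and> int n < ?a + int n"
        then have "j = int n" by simp
        moreover have "f (int n) = int n" using reachD(3)[OF fg(1), of 0] f0 by simp
        ultimately show "upd n f ?a (int n) j \<le> int n"
          using n by (auto simp: upd_def)
      next
        fix i assume i: "i < ?a \<and> ?a \<le> f i \<and> f i < i + int n"
        have "f i \<noteq> i" using i by auto
        then have "f i = g i" using fg'[of i] by (auto split: if_splits)
        then have "g ?a \<le> f i" using reachD(4)[OF fg(2), of i ?a] i by simp
        then show "int n \<le> f i" using a by simp
      qed (use n in auto)
      moreover have "f \<le> upd n f ?a (int n)" using fa by (auto simp: le_fun_def upd_def)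
      moreover have "upd n f ?a (int n) \<le> g"
      proof (rule le_funI)
        fix i
        show "upd n f ?a (int n) i \<le> g i"
        proof (cases "i mod int n = ?a mod int n")
          case True
          then show ?thesis using reach_congr[OF fg(2) True] a by (simp add: upd_def)
        next
          case False
          then show ?thesis using fgi by (simp add: upd_def)
        qed
      qed
      moreover have "upd n f ?a (int n) \<noteq> f" using a(1) upd_same[of n f ?a "int n"] by force
      ultimately have gu: "g = upd n f ?a (int n)" using mid by blast
      have "restr n f k = restr n g k" for k
      proof (cases "ins_pos n k mod int n = ?a mod int n")
        case True
        let ?i = "ins_pos n k"
        from mod_eq_dvd_iff[THEN iffD1, OF True] obtain q where "?i - ?a = int n * q"
          by (rule dvdE)
        then have i: "?i + 1 = int n * (q + 1)" by (simp add: algebra_simps)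
        have "?i = (int n - 1) + int n * q" using i by (simp add: algebra_simps)
        then have "?i div int n = q" using n div_mult_self2[of "int n" "int n - 1" q] by simp
        moreover have "(?i + 1) div int n = q + 1" using i n by simp
        ultimately have "del_pos n ?i = del_pos n (?i + 1)" by (simp add: del_pos_def)
        moreover have "g ?i = ?i + 1" using True gu by (simp add: upd_def)
        ultimately show ?thesis using fa[OF True] by (simp add: restr_def)
      next
        case False
        then show ?thesis using gu by (simp add: restr_def upd_def)
      qed
      then show False using False by auto
    qed
    then have "of_bool (g (int n - 1) \<noteq> int n - 1) \<le> (of_bool (f (int n - 1) \<noteq> int n - 1) :: nat)"
      by auto
    moreover have "card (?N f) \<le> card (?N g)" by (rule card_mono[OF finN sub])
    ultimately show ?thesis
      using k' sat_chain.step[OF k'(1) cov] by (intro exI[of _ "Suc k'"]) linarith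
  qed
qed

definition rot :: "int \<Rightarrow> (int \<Rightarrow> int) \<Rightarrow> int \<Rightarrow> int" where
  "rot a r i = r (i + a) - a"

lemma rot_reach: "r \<in> reach n \<Longrightarrow> rot a r \<in> reach n"
proof (rule reachI)
  fix i j assume r: "r \<in> reach n" and ij: "i < j" "j \<le> rot a r i" "rot a r i < i + int n"
  show "rot a r j \<le> rot a r i" using reachD(4)[OF r, of "i + a" "j + a"] ij by (simp add: rot_def)
next
  fix i assume r: "r \<in> reach n"
  show "i \<le> rot a r i" "rot a r i \<le> i + int n"
    using reachD(1,2)[OF r, of "i + a"] by (auto simp: rot_def)
  show "rot a r (i + int n) = rot a r i + int n"
    using reachD(3)[OF r, of "i + a"] by (simp add: rot_def algebra_simps)
qed

lemma rot_bij: "bij_betw (rot a) (reach n) (reach n)"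
  by (rule bij_betw_byWitness[where f' = "rot (- a)"]) (auto simp: rot_reach, auto simp: rot_def)

lemma rot_mono: "rot a r \<le> rot a s \<longleftrightarrow> r \<le> s"
proof
  assume *: "rot a r \<le> rot a s"
  show "r \<le> s"
  proof (rule le_funI)
    fix i show "r i \<le> s i" using le_funD[OF *, of "i - a"] by (simp add: rot_def)
  qed
qed (auto simp: le_fun_def rot_def)

lemma choose_two_Suc: "(Suc m + 1) choose 2 = ((m + 1) choose 2) + (m + 1)"
proof -
  have "Suc (Suc m) choose Suc 1 = (Suc m choose 1) + (Suc m choose Suc 1)"
    by (rule binomial_Suc_Suc)
  then have "Suc (Suc m) choose 2 = (Suc m choose 1) + (Suc m choose 2)"
    by (simp only: Suc_1)
  then show ?thesis by simp
qed

text \<open>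
  Any chain ends with a step from a function that fixes some \<open>p\<close>: a function that is not the top has a
  value \<open>r i = p < i + n\<close>, and then \<open>r p = p\<close>. All functions fixing \<open>p\<close> lie below the largest one, so the step
  starts there. After a rotation \<open>p = 0\<close>, and the vertex can be deleted.
\<close>

theorem chain_bounds:
  assumes "n \<ge> 1" "sat_chain (reach n) (\<lambda>i. i) (\<lambda>i. i + int n) k"
  shows "2 * n - 1 \<le> k \<and> k \<le> (n + 1) choose 2"
  using assms
proof (induction n arbitrary: k rule: nat_induct_at_least)
  case base
  show ?case
  proof -
    have two: "r = (\<lambda>i. i) \<or> r = (\<lambda>i. i + 1)" if r: "r \<in> reach 1" for r
    proof -
      have *: "r i = r 0 + i" for i using reach_shift[OF r, of 0 i] by simp
      have "r 0 = 0 \<or> r 0 = 1" using reachD(1,2)[OF r, of 0] by simp linarith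
      then show ?thesis
      proof
        assume "r 0 = 0"
        then have "r i = i" for i using *[of i] by simp
        then show ?thesis by blast
      next
        assume "r 0 = 1"
        then have "r i = i + 1" for i using *[of i] by simp
        then show ?thesis by blast
      qed
    qed
    have ne: "(\<lambda>i::int. i) \<noteq> (\<lambda>i. i + 1)" by (auto simp: fun_eq_iff)
    have "k = 1"
      using base
    proof (cases rule: sat_chain.cases)
      case start
      then show ?thesis using ne by (auto simp: fun_eq_iff)
    next
      case (step y l)
      have y: "y = (\<lambda>i. i)" using two[of y] step(3) by (auto simp: covers_def)
      have "l = 0" using step(2)
      proof (cases rule: sat_chain.cases)
        case (step y' l')
        then have "y' \<in> reach 1" "y' < (\<lambda>i. i)" using y by (auto simp: covers_def)
        then show ?thesis using two[of y'] by (auto simp: less_fun_def le_fun_def)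
      qed simp
      then show ?thesis using step by simp
    qed
    then show ?thesis by (simp add: choose_two)
  qed
next
  case (Suc m)
  define n where "n = Suc m"
  have n: "n \<ge> 2" "n - 1 = m" using Suc by (auto simp: n_def)
  have path: "sat_chain (reach n) (\<lambda>i. i) (\<lambda>i. i + int n) k" using Suc.prems by (simp add: n_def)
  from path show ?case
  proof (cases rule: sat_chain.cases)
    case start
    then show ?thesis using n by (auto simp: fun_eq_iff)
  next
    case (step y l)
    have y: "y \<in> reach n" "y < (\<lambda>i. i + int n)"
      and mid: "\<And>w. w \<in> reach n \<Longrightarrow> y \<le> w \<Longrightarrow> w \<le> (\<lambda>i. i + int n) \<Longrightarrow> w = y \<or> w = (\<lambda>i. i + int n)"
      using step(3) by (auto simp: covers_def)
    have "\<exists>i. y i \<noteq> i + int n"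
    proof (rule ccontr)
      assume "\<not> ?thesis"
      then have "y = (\<lambda>i. i + int n)" by blast
      with y(2) show False by simp
    qed
    then obtain i where "y i \<noteq> i + int n" by blast
    then have i: "y i < i + int n" using reachD(2)[OF y(1), of i] by simp
    define p where "p = y i"
    have yp: "y p = p"
      using reachD(4)[OF y(1), of i p] reachD(1)[OF y(1), of i] reachD(1)[OF y(1), of p] i
      by (cases "p = i") (auto simp: p_def)
    have ypi: "y j = j" if "j mod int n = p mod int n" for j
      using reach_congr[OF y(1) that] yp by simp
    let ?h = "upd n (\<lambda>i. i + int n) p p"
    have "?h = y"
    proof -
      have "?h \<in> reach n" "?h \<le> (\<lambda>i. i + int n)" using reach_reset[OF reach_top, of n p] n by auto
      moreover have "y \<le> ?h" using ypi reachD(2)[OF y(1)] by (auto simp: le_fun_def upd_def)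
      moreover have "?h \<noteq> (\<lambda>i. i + int n)" using n by (auto simp: fun_eq_iff upd_def intro!: exI[of _ p])
      ultimately show ?thesis using mid by blast
    qed
    define z where "z = rot p y"
    have z: "z i = (if i mod int n = 0 then i else i + int n)" for i
    proof -
      have "(i + p) mod int n = p mod int n \<longleftrightarrow> i mod int n = 0"
        by (metis mod_eq_dvd_iff add_diff_cancel_right' dvd_eq_mod_eq_0)
      then show ?thesis unfolding z_def rot_def \<open>?h = y\<close>[symmetric] by (auto simp: upd_def)
    qed
    have "sat_chain (reach n) (rot p (\<lambda>i. i)) z l"
      unfolding z_def by (rule sat_chain_iso[OF rot_bij _ step(2)]) (rule rot_mono)
    moreover have "rot p (\<lambda>i. i) = (\<lambda>i. i)" by (simp add: rot_def fun_eq_iff)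
    ultimately have path': "sat_chain (reach n) (\<lambda>i. i) z l" by simp
    have z0: "z 0 = 0" by (simp add: z)
    from restr_sat_chain[OF n(1) path' refl z0] obtain k'
      where k': "sat_chain (reach (n - 1)) (\<lambda>i. i) (restr n z) k'"
      "k' + of_bool (z (int n - 1) \<noteq> int n - 1) \<le> l"
      "l \<le> k' + card {s \<in> {1..int n - 1}. int n \<le> z s}"
      by (elim exE conjE) (rule that)
    have "restr n z = (\<lambda>i. i + int m)"
    proof
      fix i
      have "ins_pos n i mod int n \<noteq> 0" using ins_pos_not_dvd[OF n(1), of i] by (simp add: dvd_eq_mod_eq_0)
      then show "restr n z i = i + int m"
        using del_pos_shift[OF n(1), of "ins_pos n i"] n by (simp add: restr_def z del_ins[OF n(1)])
    qed
    then have IH: "2 * m - 1 \<le> k' \<and> k' \<le> (m + 1) choose 2" using Suc.IH[of k'] k'(1) n by simp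
    have "(int n - 1) mod int n = int n - 1" using n by (intro mod_pos_pos_trivial) auto
    then have zn: "z (int n - 1) \<noteq> int n - 1" using n by (simp only: z) simp
    have "card {s \<in> {1..int n - 1}. int n \<le> z s} \<le> card {1..int n - 1}"
      by (rule card_mono) auto
    then have "card {s \<in> {1..int n - 1}. int n \<le> z s} \<le> m" using n by (simp add: n_def)
    moreover note choose_two_Suc[of m]
    moreover have "2 * m \<le> Suc k'" using IH by linarith
    ultimately show ?thesis using IH k' zn step(1) by simp
  qed
qed

section \<open>Saturated chains of every length\<close>

text \<open>
  For \<open>X \<subseteq> {1..n - 1}\<close>, the tops in \<open>X\<close> reach up to the next multiple of \<open>n\<close>, the other ones nowhere. For
  \<open>X = {1..n - 1}\<close> this is the class of all modules that are not supported at the vertex \<open>0\<close>.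
\<close>

definition lin :: "nat \<Rightarrow> int set \<Rightarrow> int \<Rightarrow> int" where
  "lin n X i = (if i mod int n \<in> X then i + (int n - i mod int n) else i)"

lemma lin_reach:
  assumes n: "n > 0" and X: "X \<subseteq> {1..int n - 1}"
  shows "lin n X \<in> reach n"
proof (rule reachI)
  fix i
  have m: "0 \<le> i mod int n" "i mod int n < int n" using n by auto
  show "i \<le> lin n X i" "lin n X i \<le> i + int n" using m by (auto simp: lin_def)
  show "lin n X (i + int n) = lin n X i + int n" by (simp add: lin_def)
  fix j assume ij: "i < j" "j \<le> lin n X i" "lin n X i < i + int n"
  have ix: "i mod int n \<in> X" using ij by (auto simp: lin_def split: if_splits)
  define d where "d = j - i"
  have d: "0 < d" "d \<le> int n - i mod int n" using ij ix by (auto simp: d_def lin_def)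
  have e: "j = i mod int n + d + int n * (i div int n)" by (simp add: d_def)
  show "lin n X j \<le> lin n X i"
  proof (cases "d = int n - i mod int n")
    case True
    then have "j = int n * (i div int n + 1)" using e by (simp add: algebra_simps)
    then have "j mod int n = 0" by simp
    then have "j mod int n \<notin> X" using X by auto
    then show ?thesis using ij by (simp add: lin_def)
  next
    case False
    then have "0 \<le> i mod int n + d" "i mod int n + d < int n" using d m by auto
    then have "j mod int n = i mod int n + d"
      by (subst e, subst mod_mult_self2) (rule mod_pos_pos_trivial)
    then show ?thesis using ij ix d by (auto simp: lin_def d_def)
  qed
qed

lemma lin_insert:
  assumes a: "1 \<le> a" "a < int n"
  shows "upd n (lin n X) a (int n) = lin n (insert a X)"
proof
  fix i
  have "a mod int n = a" using a by simp
  then show "upd n (lin n X) a (int n) i = lin n (insert a X) i" by (auto simp: upd_def lin_def)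
qed

lemma lin_simps:
  assumes "0 \<le> i" "i < int n"
  shows "lin n X i = (if i \<in> X then int n else i)"
  using assms by (simp add: lin_def)

lemma lin_at_n: "0 \<notin> X \<Longrightarrow> lin n X (int n) = int n"
  by (simp add: lin_def)

text \<open>
  If \<open>a + 1\<close> already reaches up to \<open>n\<close>, then \<open>a\<close> can only reach up to \<open>n\<close> or nowhere.
\<close>

lemma step_last:
  assumes a: "1 \<le> a" "a < int n" and X: "X \<subseteq> {1..a - 1}"
  shows "covers (reach n) (lin n (X \<union> {a + 1..int n - 1})) (lin n (X \<union> {a..int n - 1}))"
proof -
  let ?X = "X \<union> {a + 1..int n - 1}"
  have R: "lin n ?X \<in> reach n" by (rule lin_reach) (use a X in auto)
  have e: "insert a ?X = X \<union> {a..int n - 1}" using a by auto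
  have aX: "a \<notin> ?X" using X by auto
  have "covers (reach n) (lin n ?X) (upd n (lin n ?X) a (int n))"
  proof (rule upd_covers[OF R])
    show "upd n (lin n ?X) a (int n) \<in> reach n"
      unfolding lin_insert[OF a] by (rule lin_reach) (use a X in auto)
    show "lin n ?X a < int n" using a aX by (simp add: lin_simps)
    fix c assume c: "lin n ?X a < c" "c < int n"
    then have c1: "a < c" using a aX by (simp add: lin_simps)
    have "upd n (lin n ?X) a c (a + 1) = int n"
      using a c c1 by (subst upd_other) (auto simp: lin_simps)
    then show "upd n (lin n ?X) a c \<notin> reach n"
      using reachD(4)[of "upd n (lin n ?X) a c" n a "a + 1"] a c c1 by auto
  qed (use a in auto)
  then show ?thesis unfolding lin_insert[OF a] e .
qed

text \<open>
  As long as nothing to the right of \<open>a\<close> reaches anywhere, the value at \<open>a\<close> can grow in steps of one.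
\<close>

lemma steps_first:
  assumes a: "1 \<le> a" "a < int n" and X: "X \<subseteq> {1..a - 1}" and d: "a + int d \<le> int n"
  shows "sat_chain (reach n) (lin n X) (upd n (lin n X) a (a + int d)) d"
proof -
  have R: "lin n X \<in> reach n" by (rule lin_reach) (use a X in auto)
  have am: "a mod int n = a" using a by simp
  have aX: "a \<notin> X" using X by auto
  have la: "lin n X a = a" using a aX by (simp add: lin_simps)
  have 0: "upd n (lin n X) a a = lin n X"
    using aX am by (auto simp: fun_eq_iff upd_def lin_def)
  have V: "upd n (lin n X) a v \<in> reach n" if v: "a \<le> v" "v \<le> int n" for v
  proof (subst upd_reach_iff[OF R]; (intro conjI allI impI)?)
    fix j assume j: "a < j \<and> j \<le> v \<and> v < a + int n"
    show "upd n (lin n X) a v j \<le> v"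
    proof (cases "j = int n")
      case True
      have "0 \<notin> X" using X by auto
      then show ?thesis using True lin_at_n[of X n] a am j by (auto simp: upd_def)
    next
      case False
      then have "j \<notin> X" "0 \<le> j" "j < int n" using X j v a by auto
      then show ?thesis using j a by (subst upd_other) (auto simp: lin_simps)
    qed
  next
    fix i assume i: "i < a \<and> a \<le> lin n X i \<and> lin n X i < i + int n"
    then have ix: "i mod int n \<in> X" by (auto simp: lin_def split: if_splits)
    have "i = i mod int n + int n * (i div int n)" by simp
    moreover have "lin n X i = int n * (i div int n + 1)"
      using ix by (simp add: lin_def algebra_simps minus_mod_eq_mult_div[symmetric])
    ultimately have "0 < int n * (i div int n + 1)" using i a by auto
    then have "0 < i div int n + 1" using a by (simp add: zero_less_mult_iff)
    then have "int n * 1 \<le> int n * (i div int n + 1)" by (intro mult_left_mono) auto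
    then show "v \<le> lin n X i" using \<open>lin n X i = _\<close> v by simp
  qed (use v a in auto)
  show ?thesis using d
  proof (induction d)
    case 0
    then show ?case using \<open>upd n (lin n X) a a = _\<close> R by (auto intro: sat_chain.start)
  next
    case (Suc d)
    let ?r = "upd n (lin n X) a (a + int d)"
    have "covers (reach n) ?r (upd n ?r a (a + int (Suc d)))"
    proof (rule upd_covers)
      have "upd n ?r a (a + int (Suc d)) = upd n (lin n X) a (a + int (Suc d))"
        by (auto simp: fun_eq_iff upd_def)
      then show "upd n ?r a (a + int (Suc d)) \<in> reach n" using V Suc.prems by simp
    qed (use V Suc.prems a in auto)
    moreover have "upd n ?r a (a + int (Suc d)) = upd n (lin n X) a (a + int (Suc d))"
      by (auto simp: fun_eq_iff upd_def)
    ultimately show ?case using Suc by (auto intro: sat_chain.step)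
  qed
qed

text \<open>
  By induction on the number \<open>m\<close> of the positions \<open>n - m, \<dots>, n - 1\<close> that still have to be filled. If the first
  of them is filled last, this takes one step, and if it is filled first, it takes \<open>m\<close> steps. The two
  resulting ranges of lengths overlap or are adjacent, because \<open>(m - 2) * (m - 3) \<ge> 0\<close> for all integers \<open>m\<close>.
\<close>

lemma linear_chains:
  assumes m: "m < n" and l: "m \<le> l" "l \<le> (m + 1) choose 2" and X: "X \<subseteq> {1..int (n - m) - 1}"
  shows "sat_chain (reach n) (lin n X) (lin n (X \<union> {int (n - m)..int n - 1})) l"
  using assms
proof (induction m arbitrary: l X)
  case 0
  have "l = 0" "X \<union> {int (n - 0)..int n - 1} = X" using 0 by (auto simp: choose_two)
  moreover have "lin n X \<in> reach n" by (rule lin_reach) (use 0 in auto)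
  ultimately show ?case by (auto intro: sat_chain.start)
next
  case (Suc m)
  define a where "a = int (n - Suc m)"
  have a: "1 \<le> a" "a < int n" "int (n - m) = a + 1" "a = int n - int m - 1"
    using Suc.prems by (auto simp: a_def)
  have X: "X \<subseteq> {1..a - 1}" using Suc.prems by (simp add: a_def)
  note ch = choose_two_Suc[of m]
  have "l \<le> ((m + 1) choose 2) + 1 \<or> 2 * m + 1 \<le> l"
  proof -
    have "2 * m + 1 \<le> ((m + 1) choose 2) + 2"
    proof -
      have c: "(m + 1) choose 2 = (m + 1) * m div 2" by (simp add: choose_two)
      have "0 \<le> (int m - 1) * (int m - 2)" by (cases "m \<le> 1") (auto simp: zero_le_mult_iff)
      then have "0 \<le> int m * int m - 3 * int m + 2" by (simp add: algebra_simps)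
      then have "int (4 * m) \<le> int ((m + 1) * m + 2)" by (simp add: algebra_simps)
      then have "4 * m \<le> (m + 1) * m + 2" by (simp only: of_nat_le_iff)
      then show ?thesis unfolding c by linarith
    qed
    then show ?thesis by linarith
  qed
  then show ?case
  proof
    assume l1: "l \<le> ((m + 1) choose 2) + 1"
    have "sat_chain (reach n) (lin n X) (lin n (X \<union> {a + 1..int n - 1})) (l - 1)"
      unfolding a(3)[symmetric] by (rule Suc.IH) (use Suc.prems l1 X a in auto)
    moreover have "covers (reach n) (lin n (X \<union> {a + 1..int n - 1})) (lin n (X \<union> {a..int n - 1}))"
      by (rule step_last[OF a(1,2) X])
    ultimately have "sat_chain (reach n) (lin n X) (lin n (X \<union> {a..int n - 1})) (Suc (l - 1))"
      by (rule sat_chain.step)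
    then show ?thesis using Suc.prems by (simp add: a_def)
  next
    assume l2: "2 * m + 1 \<le> l"
    have "sat_chain (reach n) (lin n X) (upd n (lin n X) a (a + int (Suc m))) (Suc m)"
      by (rule steps_first[OF a(1,2) X]) (use a in auto)
    moreover have "a + int (Suc m) = int n" using a by simp
    ultimately have 1: "sat_chain (reach n) (lin n X) (lin n (insert a X)) (Suc m)"
      using lin_insert[OF a(1,2)] by simp
    have "sat_chain (reach n) (lin n (insert a X)) (lin n (insert a X \<union> {a + 1..int n - 1})) (l - Suc m)"
      unfolding a(3)[symmetric] by (rule Suc.IH) (use Suc.prems l2 X a ch in auto)
    moreover have "insert a X \<union> {a + 1..int n - 1} = X \<union> {a..int n - 1}" using a by auto
    ultimately have "sat_chain (reach n) (lin n X) (lin n (X \<union> {a..int n - 1})) (Suc m + (l - Suc m))"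
      using sat_chain_trans[OF 1] by simp
    then show ?thesis using l2 by (simp add: a_def)
  qed
qed

text \<open>
  The intermediate stages on the way from \<open>lin n {1..n - 1}\<close> to the largest function that fixes \<open>0\<close>: the
  tops \<open>1, \<dots>, j - 1\<close> already reach as far as possible.
\<close>

definition full_upto :: "nat \<Rightarrow> nat \<Rightarrow> int \<Rightarrow> int" where
  "full_upto n j i = (let s = i mod int n in
     if s = 0 then i else if s < int j then i + int n else i + (int n - s))"

text \<open>
  Once \<open>j\<close> reaches beyond the multiple \<open>n\<close>, it reaches \<open>n + 1\<close>, and thus everything that \<open>n + 1\<close> reaches.
\<close>

lemma full_upto_step:
  assumes j: "1 \<le> j" "j < n" and R: "full_upto n j \<in> reach n"
  shows "covers (reach n) (full_upto n j) (full_upto n (Suc j))"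
proof -
  have jm: "int j mod int n = int j" using j by simp
  have e: "full_upto n (Suc j) = upd n (full_upto n j) (int j) (int j + int n)"
    using j jm by (auto simp: fun_eq_iff upd_def full_upto_def Let_def)
  have fj: "full_upto n j (int j) = int n" using j jm by (simp add: full_upto_def)
  show ?thesis
    unfolding e
  proof (rule upd_covers[OF R])
    show "upd n (full_upto n j) (int j) (int j + int n) \<in> reach n"
    proof (subst upd_reach_iff[OF R]; (intro conjI allI impI)?)
      fix i assume i: "i < int j \<and> int j \<le> full_upto n j i \<and> full_upto n j i < i + int n"
      show "int j + int n \<le> full_upto n j i"
      proof (rule ccontr)
        assume "\<not> ?thesis"
        define s where "s = i mod int n"
        have "0 \<le> s" "s < int n" using j by (auto simp: s_def)
        have s: "s \<noteq> 0" "\<not> s < int j" "full_upto n j i = i + (int n - s)"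
          using i by (auto simp: full_upto_def s_def Let_def split: if_splits)
        have i': "i = s + int n * (i div int n)" by (simp add: s_def)
        then have "full_upto n j i = int n * (i div int n + 1)" using s(3) by (simp add: algebra_simps)
        then have "0 < int n * (i div int n + 1)" using i j by linarith
        then have "0 \<le> i div int n" using j by (simp add: zero_less_mult_iff)
        then have "s \<le> i" using i' by (metis add_increasing2 order_refl mult_nonneg_nonneg of_nat_0_le_iff)
        then show False using s i by simp
      qed
    qed auto
    show "full_upto n j (int j) < int j + int n" using fj j by simp
    fix c assume c: "full_upto n j (int j) < c" "c < int j + int n"
    then have j2: "1 < j" using fj by simp
    have n1: "(int n + 1) mod int n = 1" using j j2 by simp
    have "upd n (full_upto n j) (int j) c (int n + 1) = full_upto n j (int n + 1)"
      using n1 jm j2 by (simp only: upd_def) simp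
    also have "\<dots> = int n + 1 + int n" using n1 j2 by (simp only: full_upto_def Let_def) simp
    finally have v: "upd n (full_upto n j) (int j) c (int n + 1) = int n + 1 + int n" .
    show "upd n (full_upto n j) (int j) c \<notin> reach n"
    proof
      assume "upd n (full_upto n j) (int j) c \<in> reach n"
      from reachD(4)[OF this, of "int j" "int n + 1"] show False using v c fj j by simp
    qed
  qed (use j in auto)
qed

theorem chain_exists:
  assumes n: "n \<ge> 1" and k: "2 * n - 1 \<le> k" "k \<le> (n + 1) choose 2"
  shows "sat_chain (reach n) (\<lambda>i. i) (\<lambda>i. i + int n) k"
proof -
  have ch: "(n + 1) choose 2 = ((n - 1 + 1) choose 2) + n"
    using n choose_two_Suc[of "n - 1"] by simp
  have "sat_chain (reach n) (lin n {}) (lin n ({} \<union> {int (n - (n - 1))..int n - 1})) (k - n)"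
    by (rule linear_chains) (use n k ch in auto)
  moreover have "lin n {} = (\<lambda>i. i)" by (simp add: fun_eq_iff lin_def)
  moreover have "lin n ({} \<union> {int (n - (n - 1))..int n - 1}) = full_upto n 1"
  proof
    fix i
    have "0 \<le> i mod int n" "i mod int n < int n" using n by auto
    then have "i mod int n = 0 \<or> 1 \<le> i mod int n" by linarith
    then show "lin n ({} \<union> {int (n - (n - 1))..int n - 1}) i = full_upto n 1 i"
      using n by (auto simp: lin_def full_upto_def Let_def)
  qed
  ultimately have 1: "sat_chain (reach n) (\<lambda>i. i) (full_upto n 1) (k - n)" by simp
  have 2: "sat_chain (reach n) (full_upto n 1) (full_upto n (Suc d)) d" if "d < n" for d
    using that
  proof (induction d)
    case 0
    then show ?case using sat_chain_in[OF 1] by (auto intro: sat_chain.start)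
  next
    case (Suc d)
    then have p: "sat_chain (reach n) (full_upto n 1) (full_upto n (Suc d)) d" by simp
    show ?case by (rule sat_chain.step[OF p full_upto_step]) (use Suc.prems sat_chain_in[OF p] in auto)
  qed
  have "Suc (n - 1) = n" using n by simp
  then have 3: "sat_chain (reach n) (full_upto n 1) (full_upto n n) (n - 1)" using 2[of "n - 1"] n by simp
  have F: "full_upto n n \<in> reach n" using sat_chain_in[OF 3] by simp
  have f: "full_upto n n i = (if i mod int n = 0 then i else i + int n)" for i
    using n by (simp add: full_upto_def Let_def)
  have t: "upd n (full_upto n n) 0 (int n) = (\<lambda>i. i + int n)"
    by (auto simp: fun_eq_iff upd_def f)
  have "covers (reach n) (full_upto n n) (upd n (full_upto n n) 0 (int n))"
  proof (rule upd_covers[OF F])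
    show "upd n (full_upto n n) 0 (int n) \<in> reach n" unfolding t by (rule reach_top)
    show "full_upto n n 0 < int n" using n by (simp add: f)
    fix c assume c: "full_upto n n 0 < c" "c < int n"
    then have c1: "1 \<le> c" by (simp add: f)
    then have "upd n (full_upto n n) 0 c 1 = 1 + int n" using c by (subst upd_other) (auto simp: f)
    then show "upd n (full_upto n n) 0 c \<notin> reach n"
      using reachD(4)[of "upd n (full_upto n n) 0 c" n 0 1] c c1 by auto
  qed (use n in auto)
  then have "sat_chain (reach n) (full_upto n n) (\<lambda>i. i + int n) 1"
    unfolding t by (rule sat_chain_single)
  then have "sat_chain (reach n) (\<lambda>i. i) (\<lambda>i. i + int n) (k - n + (n - 1) + 1)"
    by (rule sat_chain_trans[OF sat_chain_trans[OF 1 3]])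
  then show ?thesis using k n by simp
qed

corollary reach_chain_lengths:
  assumes "n \<ge> 1"
  shows "{k. sat_chain (reach n) (\<lambda>i. i) (\<lambda>i. i + int n) k} = {2 * n - 1..(n + 1) choose 2}"
proof (rule Set.set_eqI)
  fix k
  show "k \<in> {k. sat_chain (reach n) (\<lambda>i. i) (\<lambda>i. i + int n) k} \<longleftrightarrow> k \<in> {2 * n - 1..(n + 1) choose 2}"
    unfolding mem_Collect_eq atLeastAtMost_iff
    using chain_bounds[OF assms, of k] chain_exists[OF assms, of k] by blast
qed

section \<open>Algebras of the oriented cycle in terms of coefficients\<close>

text \<open>
  An algebra whose elements are determined by coefficients: \<open>cf a i k\<close> is the coefficient in \<open>a\<close> of the
  path of length \<open>k\<close> that starts at the vertex \<open>i\<close> modulo \<open>n\<close>. The predicate \<open>ok\<close> holds for the lengths of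
  the nonzero paths, that is, for \<open>k < n\<close> in the cyclic Tamari algebra and for all \<open>k\<close> in the completed
  path algebra. The last assumption provides the elements with finitely many nonzero coefficients; in
  the complete case there are more.
\<close>

locale cyclic_algebra =
  fixes n :: nat and A :: "(complex, 'x) module" and cf :: "'x \<Rightarrow> int \<Rightarrow> nat \<Rightarrow> complex"
    and ok :: "nat \<Rightarrow> bool"
  assumes n_pos: "n \<ge> 1"
    and ok_small: "k < n \<Longrightarrow> ok k"
    and ok_down: "ok k \<Longrightarrow> j \<le> k \<Longrightarrow> ok j"
    and add_closed: "a \<in> carrier A \<Longrightarrow> b \<in> carrier A \<Longrightarrow> a \<oplus>\<^bsub>A\<^esub> b \<in> carrier A"
    and mult_closed: "a \<in> carrier A \<Longrightarrow> b \<in> carrier A \<Longrightarrow> a \<otimes>\<^bsub>A\<^esub> b \<in> carrier A"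
    and smult_closed: "a \<in> carrier A \<Longrightarrow> c \<odot>\<^bsub>A\<^esub> a \<in> carrier A"
    and one_closed: "\<one>\<^bsub>A\<^esub> \<in> carrier A"
    and cf_add: "a \<in> carrier A \<Longrightarrow> b \<in> carrier A \<Longrightarrow> cf (a \<oplus>\<^bsub>A\<^esub> b) i k = cf a i k + cf b i k"
    and cf_smult: "a \<in> carrier A \<Longrightarrow> cf (c \<odot>\<^bsub>A\<^esub> a) i k = c * cf a i k"
    and cf_one: "ok k \<Longrightarrow> cf \<one>\<^bsub>A\<^esub> i k = of_bool (k = 0)"
    and cf_mult: "a \<in> carrier A \<Longrightarrow> b \<in> carrier A \<Longrightarrow> ok k \<Longrightarrow>
      cf (a \<otimes>\<^bsub>A\<^esub> b) i k = (\<Sum>j\<le>k. cf a i j * cf b (i + int j) (k - j))"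
    and cf_period: "a \<in> carrier A \<Longrightarrow> cf a (i + int n) k = cf a i k"
    and cf_not_ok: "a \<in> carrier A \<Longrightarrow> \<not> ok k \<Longrightarrow> cf a i k = 0"
    and cf_ext: "a \<in> carrier A \<Longrightarrow> b \<in> carrier A \<Longrightarrow> (\<And>i k. ok k \<Longrightarrow> cf a i k = cf b i k) \<Longrightarrow> a = b"
    and cf_ex: "(\<And>i k. w (i + int n) k = w i k) \<Longrightarrow> (\<And>i k. N \<le> k \<Longrightarrow> w i k = 0) \<Longrightarrow>
      \<exists>a \<in> carrier A. \<forall>i k. ok k \<longrightarrow> cf a i k = w i k"
begin

lemma cf_shift: "a \<in> carrier A \<Longrightarrow> cf a (i + int n * q) k = cf a i k"
  by (rule periodic_shift[of "\<lambda>i. cf a i k"]) (rule cf_period)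

lemma cf_cong: "a \<in> carrier A \<Longrightarrow> int n dvd i - j \<Longrightarrow> cf a i k = cf a j k"
proof -
  assume a: "a \<in> carrier A" and "int n dvd i - j"
  then obtain q where "i - j = int n * q" by (auto elim: dvdE)
  then have "i = j + int n * q" by simp
  then show ?thesis using cf_shift[OF a, of j q k] by simp
qed

definition of_cf :: "(int \<Rightarrow> nat \<Rightarrow> complex) \<Rightarrow> 'x" where
  "of_cf c = (SOME a. a \<in> carrier A \<and> (\<forall>i k. ok k \<longrightarrow> cf a i k = c i k))"

lemma of_cf:
  assumes "\<And>i k. c (i + int n) k = c i k" "\<And>i k. N \<le> k \<Longrightarrow> c i k = 0"
  shows "of_cf c \<in> carrier A" "ok k \<Longrightarrow> cf (of_cf c) i k = c i k"
proof -
  have "\<exists>a. a \<in> carrier A \<and> (\<forall>i k. ok k \<longrightarrow> cf a i k = c i k)" using cf_ex[of c N] assms by blast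
  from someI_ex[OF this] show "of_cf c \<in> carrier A" "ok k \<Longrightarrow> cf (of_cf c) i k = c i k"
    unfolding of_cf_def by auto
qed

definition path :: "int \<Rightarrow> nat \<Rightarrow> 'x" where
  "path s m = of_cf (\<lambda>i k. of_bool (int n dvd (i - s) \<and> k = m))"

lemma dvd_shift: "int n dvd (i + int n - s) \<longleftrightarrow> int n dvd (i - s)"
proof -
  have "i + int n - s = (i - s) + int n" by simp
  then show ?thesis by (metis dvd_add_triv_right_iff)
qed

lemma path: "path s m \<in> carrier A" "ok k \<Longrightarrow> cf (path s m) i k = of_bool (int n dvd (i - s) \<and> k = m)"
  unfolding path_def using of_cf[of "\<lambda>i k. of_bool (int n dvd (i - s) \<and> k = m)" "Suc m"]
  by (simp_all add: dvd_shift)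

lemma cf_path_mult:
  assumes a: "a \<in> carrier A" and k: "ok k"
  shows "cf (path s m \<otimes>\<^bsub>A\<^esub> a) i k = (if int n dvd (i - s) \<and> m \<le> k then cf a (s + int m) (k - m) else 0)"
proof -
  have "cf (path s m \<otimes>\<^bsub>A\<^esub> a) i k = (\<Sum>j\<le>k. cf (path s m) i j * cf a (i + int j) (k - j))"
    by (rule cf_mult[OF path(1) a k])
  also have "\<dots> = (\<Sum>j\<le>k. if j = m then of_bool (int n dvd (i - s)) * cf a (i + int m) (k - m) else 0)"
    by (rule sum.cong) (auto simp: path(2) ok_down[OF k])
  also have "\<dots> = (if int n dvd (i - s) \<and> m \<le> k then cf a (i + int m) (k - m) else 0)"
    by (simp add: sum.delta)
  also have "\<dots> = (if int n dvd (i - s) \<and> m \<le> k then cf a (s + int m) (k - m) else 0)"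
    using cf_cong[OF a, of "i + int m" "s + int m" "k - m"] by auto
  finally show ?thesis .
qed

lemma cf_scalar_mult:
  assumes a: "a \<in> carrier A" and k: "ok k"
  shows "cf ((c \<odot>\<^bsub>A\<^esub> \<one>\<^bsub>A\<^esub>) \<otimes>\<^bsub>A\<^esub> a) i k = c * cf a i k" "cf (a \<otimes>\<^bsub>A\<^esub> (c \<odot>\<^bsub>A\<^esub> \<one>\<^bsub>A\<^esub>)) i k = c * cf a i k"
proof -
  have s: "c \<odot>\<^bsub>A\<^esub> \<one>\<^bsub>A\<^esub> \<in> carrier A" by (rule smult_closed[OF one_closed])
  have cs: "cf (c \<odot>\<^bsub>A\<^esub> \<one>\<^bsub>A\<^esub>) i j = c * of_bool (j = 0)" if "j \<le> k" for i j
    using ok_down[OF k that] by (simp add: cf_smult[OF one_closed] cf_one)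
  have "cf ((c \<odot>\<^bsub>A\<^esub> \<one>\<^bsub>A\<^esub>) \<otimes>\<^bsub>A\<^esub> a) i k = (\<Sum>j\<le>k. if j = 0 then c * cf a i k else 0)"
    unfolding cf_mult[OF s a k] by (rule sum.cong) (auto simp: cs)
  then show "cf ((c \<odot>\<^bsub>A\<^esub> \<one>\<^bsub>A\<^esub>) \<otimes>\<^bsub>A\<^esub> a) i k = c * cf a i k" by (simp add: sum.delta)
  have "cf (a \<otimes>\<^bsub>A\<^esub> (c \<odot>\<^bsub>A\<^esub> \<one>\<^bsub>A\<^esub>)) i k = (\<Sum>j\<le>k. if j = k then c * cf a i k else 0)"
    unfolding cf_mult[OF a s k] by (rule sum.cong) (auto simp: cs)
  then show "cf (a \<otimes>\<^bsub>A\<^esub> (c \<odot>\<^bsub>A\<^esub> \<one>\<^bsub>A\<^esub>)) i k = c * cf a i k" by (simp add: sum.delta)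
qed

lemma scalar_commute:
  "a \<in> carrier A \<Longrightarrow> a \<otimes>\<^bsub>A\<^esub> (c \<odot>\<^bsub>A\<^esub> \<one>\<^bsub>A\<^esub>) = (c \<odot>\<^bsub>A\<^esub> \<one>\<^bsub>A\<^esub>) \<otimes>\<^bsub>A\<^esub> a"
  by (rule cf_ext) (auto simp: mult_closed smult_closed one_closed cf_scalar_mult)

end

section \<open>Linear algebra in a representation\<close>

lemma finsum_hom:
  assumes M: "abelian_group M" and K: "abelian_group K" and h: "h \<in> carrier M \<rightarrow> carrier K"
    and add: "\<And>x y. x \<in> carrier M \<Longrightarrow> y \<in> carrier M \<Longrightarrow> h (x \<oplus>\<^bsub>M\<^esub> y) = h x \<oplus>\<^bsub>K\<^esub> h y"
    and I: "finite I" and f: "f \<in> I \<rightarrow> carrier M"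
  shows "h (finsum M f I) = finsum K (\<lambda>i. h (f i)) I"
proof -
  interpret M: abelian_group M by fact
  interpret K: abelian_group K by fact
  have h0: "h \<zero>\<^bsub>M\<^esub> = \<zero>\<^bsub>K\<^esub>"
    using add[of "\<zero>\<^bsub>M\<^esub>" "\<zero>\<^bsub>M\<^esub>"] h K.add.l_cancel_one[of "h \<zero>\<^bsub>M\<^esub>" "h \<zero>\<^bsub>M\<^esub>"] by auto
  show ?thesis using I f
  proof (induction I)
    case empty
    then show ?case by (simp add: h0)
  next
    case (insert x F)
    then have "finsum M f F \<in> carrier M" "f \<in> F \<rightarrow> carrier M" "f x \<in> carrier M" by auto
    moreover have "(\<lambda>i. h (f i)) \<in> F \<rightarrow> carrier K" "h (f x) \<in> carrier K" using insert h by auto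
    ultimately show ?case using insert by (simp add: add)
  qed
qed

text \<open>
  A module over such an algebra. Since modules are left modules and paths are multiplied in the order in
  which they are run through, a path acts against its direction, from its end to its start.
\<close>

locale cyclic_rep = cyclic_algebra n A cf ok + M: abelian_group M
  for n and A :: "(complex, 'x) module" and cf ok and M :: "'x rep" +
  assumes lm: "left_module A M"
begin

lemma act_closed: "a \<in> carrier A \<Longrightarrow> x \<in> carrier M \<Longrightarrow> a \<odot>\<^bsub>M\<^esub> x \<in> carrier M"
  and act_add: "a \<in> carrier A \<Longrightarrow> b \<in> carrier A \<Longrightarrow> x \<in> carrier M \<Longrightarrow>
    (a \<oplus>\<^bsub>A\<^esub> b) \<odot>\<^bsub>M\<^esub> x = a \<odot>\<^bsub>M\<^esub> x \<oplus>\<^bsub>M\<^esub> b \<odot>\<^bsub>M\<^esub> x"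
  and act_add_r: "a \<in> carrier A \<Longrightarrow> x \<in> carrier M \<Longrightarrow> y \<in> carrier M \<Longrightarrow>
    a \<odot>\<^bsub>M\<^esub> (x \<oplus>\<^bsub>M\<^esub> y) = a \<odot>\<^bsub>M\<^esub> x \<oplus>\<^bsub>M\<^esub> a \<odot>\<^bsub>M\<^esub> y"
  and act_mult: "a \<in> carrier A \<Longrightarrow> b \<in> carrier A \<Longrightarrow> x \<in> carrier M \<Longrightarrow>
    (a \<otimes>\<^bsub>A\<^esub> b) \<odot>\<^bsub>M\<^esub> x = a \<odot>\<^bsub>M\<^esub> (b \<odot>\<^bsub>M\<^esub> x)"
  and act_one: "x \<in> carrier M \<Longrightarrow> \<one>\<^bsub>A\<^esub> \<odot>\<^bsub>M\<^esub> x = x"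
  using lm unfolding left_module_def by blast+

lemma act_zero: "a \<in> carrier A \<Longrightarrow> a \<odot>\<^bsub>M\<^esub> \<zero>\<^bsub>M\<^esub> = \<zero>\<^bsub>M\<^esub>"
  using act_add_r[of a "\<zero>\<^bsub>M\<^esub>" "\<zero>\<^bsub>M\<^esub>"] act_closed[of a "\<zero>\<^bsub>M\<^esub>"]
    M.add.l_cancel_one[of "a \<odot>\<^bsub>M\<^esub> \<zero>\<^bsub>M\<^esub>" "a \<odot>\<^bsub>M\<^esub> \<zero>\<^bsub>M\<^esub>"] by auto

lemma zero_act:
  assumes z: "z \<in> carrier A" "\<And>i k. ok k \<Longrightarrow> cf z i k = 0" and x: "x \<in> carrier M"
  shows "z \<odot>\<^bsub>M\<^esub> x = \<zero>\<^bsub>M\<^esub>"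
proof -
  have "z \<oplus>\<^bsub>A\<^esub> z = z" by (rule cf_ext) (auto simp: z add_closed cf_add)
  then have "z \<odot>\<^bsub>M\<^esub> x \<oplus>\<^bsub>M\<^esub> z \<odot>\<^bsub>M\<^esub> x = z \<odot>\<^bsub>M\<^esub> x" using act_add[OF z(1) z(1) x] by simp
  then show ?thesis using act_closed[OF z(1) x] M.add.l_cancel_one[of "z \<odot>\<^bsub>M\<^esub> x" "z \<odot>\<^bsub>M\<^esub> x"] by simp
qed

definition scale :: "complex \<Rightarrow> (nat \<Rightarrow> complex) \<Rightarrow> (nat \<Rightarrow> complex)" where
  "scale c x = (c \<odot>\<^bsub>A\<^esub> \<one>\<^bsub>A\<^esub>) \<odot>\<^bsub>M\<^esub> x"

lemma scalar_in: "c \<odot>\<^bsub>A\<^esub> \<one>\<^bsub>A\<^esub> \<in> carrier A" by (rule smult_closed[OF one_closed])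

lemma scale_closed [simp]: "x \<in> carrier M \<Longrightarrow> scale c x \<in> carrier M"
  unfolding scale_def by (rule act_closed[OF scalar_in])

lemma scale_add: "x \<in> carrier M \<Longrightarrow> scale (c + d) x = scale c x \<oplus>\<^bsub>M\<^esub> scale d x"
proof -
  assume x: "x \<in> carrier M"
  have "(c + d) \<odot>\<^bsub>A\<^esub> \<one>\<^bsub>A\<^esub> = (c \<odot>\<^bsub>A\<^esub> \<one>\<^bsub>A\<^esub>) \<oplus>\<^bsub>A\<^esub> (d \<odot>\<^bsub>A\<^esub> \<one>\<^bsub>A\<^esub>)"
    by (rule cf_ext) (auto simp: scalar_in add_closed cf_add cf_smult one_closed algebra_simps)
  then show ?thesis unfolding scale_def using act_add[OF scalar_in scalar_in x] by simp
qed

lemma scale_add_r: "x \<in> carrier M \<Longrightarrow> y \<in> carrier M \<Longrightarrow> scale c (x \<oplus>\<^bsub>M\<^esub> y) = scale c x \<oplus>\<^bsub>M\<^esub> scale c y"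
  unfolding scale_def by (rule act_add_r[OF scalar_in])

lemma scale_mult: "x \<in> carrier M \<Longrightarrow> scale (c * d) x = scale c (scale d x)"
proof -
  assume x: "x \<in> carrier M"
  have "(c * d) \<odot>\<^bsub>A\<^esub> \<one>\<^bsub>A\<^esub> = (c \<odot>\<^bsub>A\<^esub> \<one>\<^bsub>A\<^esub>) \<otimes>\<^bsub>A\<^esub> (d \<odot>\<^bsub>A\<^esub> \<one>\<^bsub>A\<^esub>)"
    by (rule cf_ext) (auto simp: scalar_in mult_closed cf_scalar_mult cf_smult one_closed)
  then show ?thesis unfolding scale_def using act_mult[OF scalar_in scalar_in x] by simp
qed

lemma scale_one: "x \<in> carrier M \<Longrightarrow> scale 1 x = x"
proof -
  assume x: "x \<in> carrier M"
  have "1 \<odot>\<^bsub>A\<^esub> \<one>\<^bsub>A\<^esub> = \<one>\<^bsub>A\<^esub>"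
    by (rule cf_ext) (auto simp: scalar_in cf_smult one_closed)
  then show ?thesis unfolding scale_def using act_one[OF x] by simp
qed

lemma scale_zero: "x \<in> carrier M \<Longrightarrow> scale 0 x = \<zero>\<^bsub>M\<^esub>"
  unfolding scale_def by (rule zero_act) (auto simp: scalar_in cf_smult one_closed)

lemma scale_zero_r: "scale c \<zero>\<^bsub>M\<^esub> = \<zero>\<^bsub>M\<^esub>" unfolding scale_def by (rule act_zero[OF scalar_in])

lemma scale_minus: "x \<in> carrier M \<Longrightarrow> scale (- 1) x = \<ominus>\<^bsub>M\<^esub> x"
  using scale_add[of x "- 1" 1] scale_zero[of x] scale_one[of x] M.minus_equality[of "scale (- 1) x" x] by simp

lemma act_scale: "a \<in> carrier A \<Longrightarrow> x \<in> carrier M \<Longrightarrow> a \<odot>\<^bsub>M\<^esub> scale c x = scale c (a \<odot>\<^bsub>M\<^esub> x)"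
  unfolding scale_def by (simp add: act_mult[symmetric] scalar_in scalar_commute)

lemma smult_act: "a \<in> carrier A \<Longrightarrow> x \<in> carrier M \<Longrightarrow> ((c \<odot>\<^bsub>A\<^esub> \<one>\<^bsub>A\<^esub>) \<otimes>\<^bsub>A\<^esub> a) \<odot>\<^bsub>M\<^esub> x = scale c (a \<odot>\<^bsub>M\<^esub> x)"
  unfolding scale_def by (rule act_mult[OF scalar_in])

text \<open>
  The elements that involve only paths of length at least \<open>N\<close> act by zero. The least such \<open>N\<close> is the Loewy
  length of the module.
\<close>

definition kills :: "nat \<Rightarrow> bool" where
  "kills N \<longleftrightarrow> (\<forall>a \<in> carrier A. (\<forall>i. \<forall>k<N. cf a i k = 0) \<longrightarrow> (\<forall>x \<in> carrier M. a \<odot>\<^bsub>M\<^esub> x = \<zero>\<^bsub>M\<^esub>))"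

lemma act_cong:
  assumes N: "kills N" and a: "a \<in> carrier A" "b \<in> carrier A" and x: "x \<in> carrier M"
    and eq: "\<And>i k. k < N \<Longrightarrow> ok k \<Longrightarrow> cf a i k = cf b i k"
  shows "a \<odot>\<^bsub>M\<^esub> x = b \<odot>\<^bsub>M\<^esub> x"
proof -
  define d where "d = a \<oplus>\<^bsub>A\<^esub> (- 1) \<odot>\<^bsub>A\<^esub> b"
  have d: "d \<in> carrier A" unfolding d_def using a by (intro add_closed smult_closed)
  have cd: "cf d i k = cf a i k - cf b i k" for i k
    unfolding d_def using a by (simp add: cf_add cf_smult smult_closed)
  have "cf d i k = 0" if "k < N" for i k
    using eq[of k i] that cf_not_ok[OF d, of k i] by (cases "ok k") (auto simp: cd)
  then have "d \<odot>\<^bsub>M\<^esub> x = \<zero>\<^bsub>M\<^esub>" using N d x unfolding kills_def by blast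
  moreover have "a = b \<oplus>\<^bsub>A\<^esub> d" by (rule cf_ext) (auto simp: a d add_closed cf_add cd)
  ultimately show ?thesis using act_add[OF a(2) d x] act_closed[OF a(2) x] by simp
qed

text \<open>
  The families are indexed by finite sets of natural numbers instead of being sets of vectors, because
  the images of a spanning family under a homomorphism may coincide.
\<close>

definition lincomb :: "nat set \<Rightarrow> (nat \<Rightarrow> complex) \<Rightarrow> (nat \<Rightarrow> nat \<Rightarrow> complex) \<Rightarrow> (nat \<Rightarrow> complex)" where
  "lincomb I c b = finsum M (\<lambda>i. scale (c i) (b i)) I"

definition spans :: "nat set \<Rightarrow> (nat \<Rightarrow> nat \<Rightarrow> complex) \<Rightarrow> bool" where
  "spans I b \<longleftrightarrow> finite I \<and> b \<in> I \<rightarrow> carrier M \<and> (\<forall>x \<in> carrier M. \<exists>c. x = lincomb I c b)"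

lemma lincomb_closed: "b \<in> I \<rightarrow> carrier M \<Longrightarrow> lincomb I c b \<in> carrier M"
  unfolding lincomb_def by (rule M.finsum_closed) (auto simp: Pi_iff)

lemma lincomb_add:
  assumes b: "b \<in> I \<rightarrow> carrier M"
  shows "lincomb I c b \<oplus>\<^bsub>M\<^esub> lincomb I d b = lincomb I (\<lambda>i. c i + d i) b"
proof -
  have "lincomb I (\<lambda>i. c i + d i) b = finsum M (\<lambda>i. scale (c i) (b i) \<oplus>\<^bsub>M\<^esub> scale (d i) (b i)) I"
    unfolding lincomb_def by (rule M.finsum_cong') (use b in \<open>auto simp: scale_add Pi_iff\<close>)
  also have "\<dots> = lincomb I c b \<oplus>\<^bsub>M\<^esub> lincomb I d b"
    unfolding lincomb_def by (rule M.finsum_addf) (use b in \<open>auto simp: Pi_iff\<close>)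
  finally show ?thesis by simp
qed

lemma scale_lincomb:
  assumes b: "b \<in> I \<rightarrow> carrier M" "finite I"
  shows "scale e (lincomb I c b) = lincomb I (\<lambda>i. e * c i) b"
proof -
  have "scale e (lincomb I c b) = finsum M (\<lambda>i. scale e (scale (c i) (b i))) I"
    unfolding lincomb_def
    by (rule finsum_hom[OF M.abelian_group_axioms M.abelian_group_axioms])
      (use b in \<open>auto simp: scale_add_r Pi_iff\<close>)
  also have "\<dots> = lincomb I (\<lambda>i. e * c i) b"
    unfolding lincomb_def by (rule M.finsum_cong') (use b in \<open>auto simp: scale_mult Pi_iff\<close>)
  finally show ?thesis .
qed

lemma lincomb_zero:
  assumes "b \<in> I \<rightarrow> carrier M" "\<And>i. i \<in> I \<Longrightarrow> c i = 0"
  shows "lincomb I c b = \<zero>\<^bsub>M\<^esub>"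
proof -
  have "lincomb I c b = finsum M (\<lambda>i. \<zero>\<^bsub>M\<^esub>) I"
    unfolding lincomb_def by (rule M.finsum_cong') (use assms in \<open>auto simp: scale_zero Pi_iff\<close>)
  then show ?thesis by simp
qed

lemma lincomb_remove:
  assumes b: "b \<in> I \<rightarrow> carrier M" "finite I" "j \<in> I"
  shows "lincomb I c b = scale (c j) (b j) \<oplus>\<^bsub>M\<^esub> lincomb (I - {j}) c b"
proof -
  have "lincomb (insert j (I - {j})) c b = scale (c j) (b j) \<oplus>\<^bsub>M\<^esub> lincomb (I - {j}) c b"
    unfolding lincomb_def by (rule M.finsum_insert) (use b in \<open>auto simp: Pi_iff\<close>)
  then show ?thesis using b(3) by (simp add: insert_absorb)
qed

text \<open>
  The exchange argument: a member with a nonzero coefficient in a linear relation is redundant.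
\<close>

lemma spans_remove:
  assumes s: "spans I b" and j: "j \<in> I" and rel: "lincomb I c b = \<zero>\<^bsub>M\<^esub>" and cj: "c j \<noteq> 0"
  shows "spans (I - {j}) b"
proof -
  have b: "b \<in> I \<rightarrow> carrier M" "finite I" "\<And>x. x \<in> carrier M \<Longrightarrow> \<exists>d. x = lincomb I d b"
    using s unfolding spans_def by auto
  have b': "b \<in> I - {j} \<rightarrow> carrier M" using b by auto
  have "\<exists>d. x = lincomb (I - {j}) d b" if x: "x \<in> carrier M" for x
  proof -
    obtain d where d: "x = lincomb I d b" using b(3)[OF x] by blast
    define e where "e = (\<lambda>i. d i + (- (d j / c j)) * c i)"
    have "x = lincomb I d b \<oplus>\<^bsub>M\<^esub> scale (- (d j / c j)) (lincomb I c b)" using d x rel by (simp add: scale_zero_r)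
    also have "\<dots> = lincomb I e b" unfolding scale_lincomb[OF b(1,2)] lincomb_add[OF b(1)] e_def ..
    also have "\<dots> = scale (e j) (b j) \<oplus>\<^bsub>M\<^esub> lincomb (I - {j}) e b" by (rule lincomb_remove[OF b(1,2) j])
    also have "e j = 0" using cj by (simp add: e_def)
    also have "scale 0 (b j) \<oplus>\<^bsub>M\<^esub> lincomb (I - {j}) e b = lincomb (I - {j}) e b"
      using b j lincomb_closed[OF b'] by (simp add: scale_zero funcset_mem[OF b(1) j])
    finally show ?thesis by blast
  qed
  then show ?thesis unfolding spans_def using b b' by auto
qed

lemma independent_spanning:
  assumes "spans I b"
  obtains J where "spans J b" "J \<subseteq> I" "\<And>c. lincomb J c b = \<zero>\<^bsub>M\<^esub> \<Longrightarrow> \<forall>i \<in> J. c i = 0"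
proof -
  have "spans I b \<and> I \<subseteq> I" using assms by blast
  from ex_has_least_nat[of "\<lambda>J. spans J b \<and> J \<subseteq> I" I card, OF this]
  obtain J where J: "spans J b" "J \<subseteq> I" and min: "\<And>K. spans K b \<and> K \<subseteq> I \<Longrightarrow> card J \<le> card K" by blast
  have "\<forall>i \<in> J. c i = 0" if "lincomb J c b = \<zero>\<^bsub>M\<^esub>" for c
  proof (rule ballI, rule ccontr)
    fix i assume i: "i \<in> J" "c i \<noteq> 0"
    have "spans (J - {i}) b" by (rule spans_remove[OF J(1) i(1) that i(2)])
    moreover have "card (J - {i}) < card J"
      using J i unfolding spans_def by (intro psubset_card_mono) auto
    ultimately show False using min[of "J - {i}"] J(2) by auto
  qed
  then show ?thesis using that J by blast
qed

lemma fin_dim_spans: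
  assumes "fin_dim A M"
  obtains I b where "spans I b"
proof -
  obtain B where B: "finite B" "B \<subseteq> carrier M"
    "\<And>x. x \<in> carrier M \<Longrightarrow> \<exists>c. x = (\<Oplus>\<^bsub>M\<^esub> b \<in> B. (c b \<odot>\<^bsub>A\<^esub> \<one>\<^bsub>A\<^esub>) \<odot>\<^bsub>M\<^esub> b)"
    using assms unfolding fin_dim_def by auto
  obtain h where h: "bij_betw h {0..<card B} B" using ex_bij_betw_nat_finite[OF B(1)] by blast
  have hB: "h ` {0..<card B} = B" "inj_on h {0..<card B}" using h by (auto simp: bij_betw_def)
  have "spans {0..<card B} h"
    unfolding spans_def
  proof (intro conjI ballI)
    show "h \<in> {0..<card B} \<rightarrow> carrier M" using hB B by auto
    fix x assume "x \<in> carrier M"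
    then obtain c where c: "x = (\<Oplus>\<^bsub>M\<^esub> b \<in> B. (c b \<odot>\<^bsub>A\<^esub> \<one>\<^bsub>A\<^esub>) \<odot>\<^bsub>M\<^esub> b)" using B(3) by blast
    have "finsum M (\<lambda>b. (c b \<odot>\<^bsub>A\<^esub> \<one>\<^bsub>A\<^esub>) \<odot>\<^bsub>M\<^esub> b) (h ` {0..<card B})
      = finsum M (\<lambda>i. (c (h i) \<odot>\<^bsub>A\<^esub> \<one>\<^bsub>A\<^esub>) \<odot>\<^bsub>M\<^esub> h i) {0..<card B}"
    proof (rule M.finsum_reindex)
      show "(\<lambda>b. (c b \<odot>\<^bsub>A\<^esub> \<one>\<^bsub>A\<^esub>) \<odot>\<^bsub>M\<^esub> b) \<in> h ` {0..<card B} \<rightarrow> carrier M"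
        unfolding hB(1) using B(2) by (auto intro!: act_closed scalar_in)
    qed (rule hB(2))
    then have "x = lincomb {0..<card B} (\<lambda>i. c (h i)) h" unfolding hB(1) c lincomb_def scale_def .
    then show "\<exists>c. x = lincomb {0..<card B} c h" by blast
  qed simp
  then show ?thesis using that by blast
qed

lemma lincomb_single:
  assumes b: "b \<in> I \<rightarrow> carrier M" "finite I" "j \<in> I"
  shows "lincomb I (\<lambda>i. if i = j then e else 0) b = scale e (b j)"
proof -
  have "b \<in> I - {j} \<rightarrow> carrier M" using b by auto
  then have "lincomb (I - {j}) (\<lambda>i. if i = j then e else 0) b = \<zero>\<^bsub>M\<^esub>" by (rule lincomb_zero) auto
  then show ?thesis using lincomb_remove[OF b, of "\<lambda>i. if i = j then e else 0"] funcset_mem[OF b(1,3)]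
    by simp
qed

lemma spans_fin_dim:
  assumes "spans I b"
  shows "fin_dim A M"
proof -
  obtain J where J: "spans J b" "J \<subseteq> I" and ind: "\<And>c. lincomb J c b = \<zero>\<^bsub>M\<^esub> \<Longrightarrow> \<forall>i \<in> J. c i = 0"
    by (rule independent_spanning[OF assms]) blast
  have b: "b \<in> J \<rightarrow> carrier M" "finite J" "\<And>x. x \<in> carrier M \<Longrightarrow> \<exists>d. x = lincomb J d b"
    using J(1) unfolding spans_def by auto
  have inj: "inj_on b J"
  proof (rule inj_onI, rule ccontr)
    fix i j assume ij: "i \<in> J" "j \<in> J" "b i = b j" "i \<noteq> j"
    have bi: "b i \<in> carrier M" using b ij by auto
    have "lincomb J (\<lambda>k. (if k = i then 1 else 0) + (if k = j then - 1 else 0)) b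
        = scale 1 (b i) \<oplus>\<^bsub>M\<^esub> scale (- 1) (b j)"
      unfolding lincomb_add[OF b(1), symmetric] lincomb_single[OF b(1,2) ij(1)] lincomb_single[OF b(1,2) ij(2)] ..
    also have "\<dots> = \<zero>\<^bsub>M\<^esub>" using bi ij scale_add[of "b i" 1 "- 1"] by (simp add: scale_zero)
    finally have "\<forall>k \<in> J. (if k = i then 1 else 0) + (if k = j then - 1 else 0) = (0 :: complex)"
      by (rule ind)
    from bspec[OF this ij(1)] show False using ij(4) by simp
  qed
  show ?thesis
    unfolding fin_dim_def
  proof (intro exI[of _ "b ` J"] conjI ballI)
    show "finite (b ` J)" "b ` J \<subseteq> carrier M" using b by auto
    fix x assume "x \<in> carrier M"
    then obtain c where c: "x = lincomb J c b" using b(3) by blast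
    let ?c = "\<lambda>y. c (inv_into J b y)"
    have "(\<Oplus>\<^bsub>M\<^esub> y \<in> b ` J. (?c y \<odot>\<^bsub>A\<^esub> \<one>\<^bsub>A\<^esub>) \<odot>\<^bsub>M\<^esub> y) = finsum M (\<lambda>i. (?c (b i) \<odot>\<^bsub>A\<^esub> \<one>\<^bsub>A\<^esub>) \<odot>\<^bsub>M\<^esub> b i) J"
    proof (rule M.finsum_reindex)
      show "(\<lambda>y. (?c y \<odot>\<^bsub>A\<^esub> \<one>\<^bsub>A\<^esub>) \<odot>\<^bsub>M\<^esub> y) \<in> b ` J \<rightarrow> carrier M"
        using b by (auto intro!: act_closed scalar_in)
    qed (rule inj)
    also have "\<dots> = x"
      unfolding c lincomb_def scale_def
    proof (rule M.finsum_cong')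
      show "(\<lambda>i. (c i \<odot>\<^bsub>A\<^esub> \<one>\<^bsub>A\<^esub>) \<odot>\<^bsub>M\<^esub> b i) \<in> J \<rightarrow> carrier M"
        using b by (auto intro!: act_closed scalar_in)
      show "(?c (b i) \<odot>\<^bsub>A\<^esub> \<one>\<^bsub>A\<^esub>) \<odot>\<^bsub>M\<^esub> b i = (c i \<odot>\<^bsub>A\<^esub> \<one>\<^bsub>A\<^esub>) \<odot>\<^bsub>M\<^esub> b i" if "i \<in> J" for i
        using that inj by (simp add: inv_into_f_f)
    qed simp
    finally show "\<exists>c. x = (\<Oplus>\<^bsub>M\<^esub> y \<in> b ` J. (c y \<odot>\<^bsub>A\<^esub> \<one>\<^bsub>A\<^esub>) \<odot>\<^bsub>M\<^esub> y)"
      by (intro exI[of _ ?c]) (rule sym)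
  qed
qed

text \<open>
  A coordinate with respect to a minimal spanning family, divided by its value at \<open>w\<close>.
\<close>

lemma functional:
  assumes fd: "fin_dim A M" and w: "w \<in> carrier M" "w \<noteq> \<zero>\<^bsub>M\<^esub>"
  obtains \<phi> :: "(nat \<Rightarrow> complex) \<Rightarrow> complex" where
    "\<And>x y. x \<in> carrier M \<Longrightarrow> y \<in> carrier M \<Longrightarrow> \<phi> (x \<oplus>\<^bsub>M\<^esub> y) = \<phi> x + \<phi> y"
    "\<And>x c. x \<in> carrier M \<Longrightarrow> \<phi> (scale c x) = c * \<phi> x" "\<phi> w = 1"
proof -
  obtain I b where Ib: "spans I b" using fin_dim_spans[OF fd] .
  obtain J where J: "spans J b" "J \<subseteq> I" and ind: "\<And>c. lincomb J c b = \<zero>\<^bsub>M\<^esub> \<Longrightarrow> \<forall>i \<in> J. c i = 0"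
    by (rule independent_spanning[OF Ib]) blast
  have b: "b \<in> J \<rightarrow> carrier M" "finite J" "\<And>x. x \<in> carrier M \<Longrightarrow> \<exists>d. x = lincomb J d b"
    using J(1) unfolding spans_def by auto
  define co where "co = (\<lambda>x. SOME c. x = lincomb J c b)"
  have co: "x = lincomb J (co x) b" if "x \<in> carrier M" for x
    unfolding co_def by (rule someI_ex[OF b(3)[OF that]])
  have uniq: "c i = d i" if "lincomb J c b = lincomb J d b" "i \<in> J" for c d i
  proof -
    have cl: "lincomb J d b \<in> carrier M" by (rule lincomb_closed[OF b(1)])
    have "lincomb J (\<lambda>i. c i + (- 1) * d i) b = lincomb J c b \<oplus>\<^bsub>M\<^esub> scale (- 1) (lincomb J d b)"
      unfolding scale_lincomb[OF b(1,2)] lincomb_add[OF b(1)] ..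
    also have "\<dots> = \<zero>\<^bsub>M\<^esub>" unfolding that(1) scale_minus[OF cl] by (rule M.r_neg[OF cl])
    finally have "\<forall>k \<in> J. c k + (- 1) * d k = 0" by (rule ind)
    from bspec[OF this that(2)] show ?thesis by simp
  qed
  obtain j where j: "j \<in> J" "co w j \<noteq> 0" using co[OF w(1)] w(2) lincomb_zero[OF b(1)] by metis
  have coI: "co x i = c i" if "x = lincomb J c b" "x \<in> carrier M" "i \<in> J" for x c i
    by (rule uniq[OF _ that(3)]) (use co[OF that(2)] that(1) in simp)
  show ?thesis
  proof (rule that[of "\<lambda>x. co x j / co w j"])
    fix x y assume xy: "x \<in> carrier M" "y \<in> carrier M"
    have "x \<oplus>\<^bsub>M\<^esub> y = lincomb J (\<lambda>i. co x i + co y i) b"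
      unfolding lincomb_add[OF b(1), symmetric] using co xy by simp
    from coI[OF this _ j(1)] show "co (x \<oplus>\<^bsub>M\<^esub> y) j / co w j = co x j / co w j + co y j / co w j"
      using xy by (simp add: add_divide_distrib)
  next
    fix x c assume x: "x \<in> carrier M"
    have "scale c x = lincomb J (\<lambda>i. c * co x i) b"
      unfolding scale_lincomb[OF b(1,2), symmetric] using co x by simp
    from coI[OF this _ j(1)] show "co (scale c x) j / co w j = c * (co x j / co w j)" using x by simp
  qed (use j in simp)
qed

end

lemma rep_homD:
  assumes "f \<in> rep_hom A M N"
  shows "x \<in> carrier M \<Longrightarrow> f x \<in> carrier N"
    "x \<in> carrier M \<Longrightarrow> y \<in> carrier M \<Longrightarrow> f (x \<oplus>\<^bsub>M\<^esub> y) = f x \<oplus>\<^bsub>N\<^esub> f y"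
    "a \<in> carrier A \<Longrightarrow> x \<in> carrier M \<Longrightarrow> f (a \<odot>\<^bsub>M\<^esub> x) = a \<odot>\<^bsub>N\<^esub> f x"
  using assms unfolding rep_hom_def by (blast, blast, blast)

lemma rep_homI:
  assumes "\<And>x. x \<in> carrier M \<Longrightarrow> f x \<in> carrier N"
    "\<And>x y. x \<in> carrier M \<Longrightarrow> y \<in> carrier M \<Longrightarrow> f (x \<oplus>\<^bsub>M\<^esub> y) = f x \<oplus>\<^bsub>N\<^esub> f y"
    "\<And>a x. a \<in> carrier A \<Longrightarrow> x \<in> carrier M \<Longrightarrow> f (a \<odot>\<^bsub>M\<^esub> x) = a \<odot>\<^bsub>N\<^esub> f x"
  shows "f \<in> rep_hom A M N"
  using assms unfolding rep_hom_def by blast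

lemma rep_hom_comp: "f \<in> rep_hom A L M \<Longrightarrow> g \<in> rep_hom A M N \<Longrightarrow> g \<circ> f \<in> rep_hom A L N"
  by (rule rep_homI) (simp_all add: rep_homD)

lemma is_quotient_trans:
  assumes "is_quotient A L M" "is_quotient A M N"
  shows "is_quotient A L N"
proof -
  obtain f g where f: "f \<in> rep_hom A L M" "f ` carrier L = carrier M"
    and g: "g \<in> rep_hom A M N" "g ` carrier M = carrier N"
    using assms unfolding is_quotient_def by blast
  have "(g \<circ> f) ` carrier L = g ` (f ` carrier L)" by (rule image_comp[symmetric])
  then have "(g \<circ> f) ` carrier L = carrier N" unfolding f(2) g(2) .
  then show ?thesis unfolding is_quotient_def using rep_hom_comp[OF f(1) g(1)] by blast
qed

lemma rep_iso_quotient: "rep_iso A M N \<Longrightarrow> is_quotient A M N"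
  unfolding rep_iso_def is_quotient_def bij_betw_def by blast

lemma rep_hom_zero:
  assumes "abelian_group M" "abelian_group N" "f \<in> rep_hom A M N"
  shows "f \<zero>\<^bsub>M\<^esub> = \<zero>\<^bsub>N\<^esub>"
proof -
  interpret M: abelian_group M by fact
  interpret N: abelian_group N by fact
  show ?thesis
    using rep_homD(2)[OF assms(3), of "\<zero>\<^bsub>M\<^esub>" "\<zero>\<^bsub>M\<^esub>"] rep_homD(1)[OF assms(3), of "\<zero>\<^bsub>M\<^esub>"]
      N.add.l_cancel_one[of "f \<zero>\<^bsub>M\<^esub>" "f \<zero>\<^bsub>M\<^esub>"] by simp
qed

definition sub_rep :: "'x rep \<Rightarrow> (nat \<Rightarrow> complex) set \<Rightarrow> 'x rep" where
  "sub_rep M W = M\<lparr>carrier := W\<rparr>"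

lemma sub_rep_simps [simp]:
  "carrier (sub_rep M W) = W" "add (sub_rep M W) = add M" "zero (sub_rep M W) = zero M"
  "smult (sub_rep M W) = smult M"
  by (simp_all add: sub_rep_def)

context cyclic_rep
begin

lemma cyclic_rep_sub:
  assumes W: "W \<subseteq> carrier M" "\<zero>\<^bsub>M\<^esub> \<in> W" "\<And>x y. x \<in> W \<Longrightarrow> y \<in> W \<Longrightarrow> x \<oplus>\<^bsub>M\<^esub> y \<in> W"
    "\<And>a x. a \<in> carrier A \<Longrightarrow> x \<in> W \<Longrightarrow> a \<odot>\<^bsub>M\<^esub> x \<in> W"
  shows "cyclic_rep n A cf ok (sub_rep M W)"
proof -
  have "abelian_group (sub_rep M W)"
  proof (rule abelian_groupI)
    fix x assume x: "x \<in> carrier (sub_rep M W)"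
    then have xM: "x \<in> carrier M" using W(1) by auto
    have "scale (- 1) x \<in> W" unfolding scale_def by (rule W(4)[OF scalar_in]) (use x in simp)
    moreover have "scale (- 1) x \<oplus>\<^bsub>M\<^esub> x = \<zero>\<^bsub>M\<^esub>"
      using xM by (simp add: scale_minus M.l_neg)
    ultimately show "\<exists>y\<in>carrier (sub_rep M W). y \<oplus>\<^bsub>sub_rep M W\<^esub> x = \<zero>\<^bsub>sub_rep M W\<^esub>" by auto
  qed (use W in \<open>auto simp: subset_iff M.a_ac\<close>)
  moreover have "left_module A (sub_rep M W)"
    unfolding left_module_def using calculation W
    by (auto simp: subset_iff act_add act_add_r act_mult act_one)
  ultimately show ?thesis
    by (intro cyclic_rep.intro cyclic_rep_axioms.intro cyclic_algebra_axioms)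
qed

lemma rep_hom_scale:
  assumes K: "cyclic_rep n A cf ok K" and q: "q \<in> rep_hom A M K" and x: "x \<in> carrier M"
  shows "q (scale c x) = cyclic_rep.scale A K c (q x)"
  using rep_homD(3)[OF q scalar_in x] by (simp add: scale_def cyclic_rep.scale_def[OF K])

lemma rep_hom_lincomb:
  assumes K: "cyclic_rep n A cf ok K" and q: "q \<in> rep_hom A M K"
    and b: "b \<in> I \<rightarrow> carrier M" "finite I"
  shows "q (lincomb I c b) = cyclic_rep.lincomb A K I c (q \<circ> b)"
proof -
  interpret K: cyclic_rep n A cf ok K by fact
  have "q (lincomb I c b) = finsum K (\<lambda>i. q (scale (c i) (b i))) I"
    unfolding lincomb_def
    by (rule finsum_hom[OF M.abelian_group_axioms K.M.abelian_group_axioms])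
      (use b rep_homD[OF q] in \<open>auto simp: Pi_iff\<close>)
  also have "\<dots> = K.lincomb I c (q \<circ> b)"
    unfolding K.lincomb_def by (rule K.M.finsum_cong')
      (use b rep_homD[OF q] in \<open>auto simp: Pi_iff rep_hom_scale[OF K q]\<close>)
  finally show ?thesis .
qed

lemma spans_image:
  assumes K: "cyclic_rep n A cf ok K" and q: "q \<in> rep_hom A M K" "q ` carrier M = carrier K"
    and s: "spans I b"
  shows "cyclic_rep.spans A K I (q \<circ> b)"
proof -
  interpret K: cyclic_rep n A cf ok K by fact
  have b: "b \<in> I \<rightarrow> carrier M" "finite I" using s unfolding spans_def by auto
  show ?thesis
    unfolding K.spans_def
  proof (intro conjI ballI)
    show "q \<circ> b \<in> I \<rightarrow> carrier K" using b rep_homD(1)[OF q(1)] by (auto simp: Pi_iff)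
    fix y assume "y \<in> carrier K"
    then obtain x where x: "x \<in> carrier M" "y = q x" using q(2) by auto
    then obtain c where "x = lincomb I c b" using s unfolding spans_def by blast
    then show "\<exists>c. y = K.lincomb I c (q \<circ> b)" using x rep_hom_lincomb[OF K q(1) b] by blast
  qed (rule b)
qed

text \<open>
  This is the only form in which dimensions are compared: the image of a nonzero vector of the kernel is
  a linear relation between the images of the spanning family.
\<close>

lemma spans_proper_quotient:
  assumes K: "cyclic_rep n A cf ok K" and q: "q \<in> rep_hom A M K" "q ` carrier M = carrier K"
    and s: "spans I b" and v: "v \<in> carrier M" "v \<noteq> \<zero>\<^bsub>M\<^esub>" "q v = \<zero>\<^bsub>K\<^esub>"
  obtains j where "j \<in> I" "cyclic_rep.spans A K (I - {j}) (q \<circ> b)"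
proof -
  interpret K: cyclic_rep n A cf ok K by fact
  have b: "b \<in> I \<rightarrow> carrier M" "finite I" using s unfolding spans_def by auto
  obtain c where c: "v = lincomb I c b" using s v(1) unfolding spans_def by blast
  obtain j where j: "j \<in> I" "c j \<noteq> 0" using lincomb_zero[OF b(1), of c] c v(2) by auto
  have "K.lincomb I c (q \<circ> b) = \<zero>\<^bsub>K\<^esub>" using rep_hom_lincomb[OF K q(1) b, of c] c v(3) by simp
  then have "K.spans (I - {j}) (q \<circ> b)"
    by (rule K.spans_remove[where c = c, OF spans_image[OF K q s] j(1) _ j(2)])
  then show ?thesis using that j(1) by blast
qed

end

section \<open>Uniserial modules\<close>

text \<open>
  The uniserial module with socle at the vertex \<open>s\<close> and length \<open>l\<close>. Its basis vector number \<open>t\<close> sits at the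
  vertex \<open>s + t\<close>, and a path of length \<open>k\<close> ending there moves it to the basis vector number \<open>t - k\<close>. Vectors
  are represented by their coordinates, so \<open>mult\<close> and \<open>one\<close> have arbitrary values.
\<close>

definition uni :: "('x \<Rightarrow> int \<Rightarrow> nat \<Rightarrow> complex) \<Rightarrow> int \<Rightarrow> nat \<Rightarrow> 'x rep" where
  "uni cf s l = \<lparr>carrier = {x. \<forall>t\<ge>l. x t = 0}, mult = (\<lambda>x y. x), one = (\<lambda>_. 0),
     zero = (\<lambda>_. 0), add = (\<lambda>x y t. x t + y t),
     smult = (\<lambda>a x t. \<Sum>k<l - t. cf a (s + int t) k * x (t + k))\<rparr>"

lemma uni_simps [simp]:
  "carrier (uni cf s l) = {x. \<forall>t\<ge>l. x t = 0}" "zero (uni cf s l) = (\<lambda>_. 0)"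
  "add (uni cf s l) = (\<lambda>x y t. x t + y t)"
  "smult (uni cf s l) = (\<lambda>a x t. \<Sum>k<l - t. cf a (s + int t) k * x (t + k))"
  by (simp_all add: uni_def)

lemma abelian_group_uni: "abelian_group (uni cf s l)"
proof (rule abelian_groupI)
  fix x assume "x \<in> carrier (uni cf s l)"
  then show "\<exists>y\<in>carrier (uni cf s l). y \<oplus>\<^bsub>uni cf s l\<^esub> x = \<zero>\<^bsub>uni cf s l\<^esub>"
    by (intro bexI[of _ "\<lambda>t. - x t"]) auto
qed (auto simp: algebra_simps)

context cyclic_algebra
begin

abbreviation U :: "int \<Rightarrow> nat \<Rightarrow> 'x rep" where "U \<equiv> uni cf"

definition okl :: "nat \<Rightarrow> bool" where "okl l \<longleftrightarrow> (\<forall>k<l. ok k)"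

lemma okl_down: "okl l \<Longrightarrow> m \<le> l \<Longrightarrow> okl m" by (simp add: okl_def)

lemma okl_small: "l \<le> n \<Longrightarrow> okl l" using ok_small by (simp add: okl_def)

lemma left_module_uni:
  assumes l: "okl l"
  shows "left_module A (U s l)"
  unfolding left_module_def
proof (intro conjI ballI)
  show "abelian_group (U s l)" by (rule abelian_group_uni)
next
  fix a x assume "a \<in> carrier A" "x \<in> carrier (U s l)"
  then show "a \<odot>\<^bsub>U s l\<^esub> x \<in> carrier (U s l)" by simp
next
  fix a b x assume "a \<in> carrier A" "b \<in> carrier A" "x \<in> carrier (U s l)"
  then show "(a \<oplus>\<^bsub>A\<^esub> b) \<odot>\<^bsub>U s l\<^esub> x = a \<odot>\<^bsub>U s l\<^esub> x \<oplus>\<^bsub>U s l\<^esub> b \<odot>\<^bsub>U s l\<^esub> x"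
    by (simp add: cf_add distrib_right sum.distrib)
next
  fix a x y assume "a \<in> carrier A" "x \<in> carrier (U s l)" "y \<in> carrier (U s l)"
  then show "a \<odot>\<^bsub>U s l\<^esub> (x \<oplus>\<^bsub>U s l\<^esub> y) = a \<odot>\<^bsub>U s l\<^esub> x \<oplus>\<^bsub>U s l\<^esub> a \<odot>\<^bsub>U s l\<^esub> y"
    by (simp add: distrib_left sum.distrib)
next
  fix a b x assume ab: "a \<in> carrier A" "b \<in> carrier A" and x: "x \<in> carrier (U s l)"
  show "(a \<otimes>\<^bsub>A\<^esub> b) \<odot>\<^bsub>U s l\<^esub> x = a \<odot>\<^bsub>U s l\<^esub> (b \<odot>\<^bsub>U s l\<^esub> x)"
  proof
    fix t
    have "((a \<otimes>\<^bsub>A\<^esub> b) \<odot>\<^bsub>U s l\<^esub> x) t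
        = (\<Sum>k<l - t. \<Sum>j\<le>k. cf a (s + int t) j * cf b (s + int t + int j) (k - j) * x (t + k))"
      using l by (auto simp: cf_mult[OF ab] okl_def sum_distrib_right intro!: sum.cong)
    also have "\<dots> = (\<Sum>k<l - t. \<Sum>j\<le>k. cf a (s + int t) j
        * (cf b (s + int (t + j)) (k - j) * x (t + j + (k - j))))"
      by (intro sum.cong refl) (auto simp: algebra_simps)
    also have "\<dots> = (\<Sum>(j, m)\<in>{(j, m). j + m < l - t}. cf a (s + int t) j
        * (cf b (s + int (t + j)) m * x (t + j + m)))"
      by (rule sum.triangle_reindex[symmetric])
    also have "{(j, m). j + m < l - t} = Sigma {..<l - t} (\<lambda>j. {..<l - (t + j)})" by auto
    also have "(\<Sum>(j, m)\<in>Sigma {..<l - t} (\<lambda>j. {..<l - (t + j)}). cf a (s + int t) j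
        * (cf b (s + int (t + j)) m * x (t + j + m)))
      = (\<Sum>j<l - t. \<Sum>m<l - (t + j). cf a (s + int t) j * (cf b (s + int (t + j)) m * x (t + j + m)))"
      by (rule sum.Sigma[symmetric]) auto
    also have "\<dots> = (a \<odot>\<^bsub>U s l\<^esub> (b \<odot>\<^bsub>U s l\<^esub> x)) t" by (simp add: sum_distrib_left)
    finally show "((a \<otimes>\<^bsub>A\<^esub> b) \<odot>\<^bsub>U s l\<^esub> x) t = (a \<odot>\<^bsub>U s l\<^esub> (b \<odot>\<^bsub>U s l\<^esub> x)) t" .
  qed
next
  fix x assume x: "x \<in> carrier (U s l)"
  show "\<one>\<^bsub>A\<^esub> \<odot>\<^bsub>U s l\<^esub> x = x"
  proof
    fix t
    have "(\<one>\<^bsub>A\<^esub> \<odot>\<^bsub>U s l\<^esub> x) t = (\<Sum>k<l - t. if k = 0 then x t else 0)"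
      using l by (auto simp: cf_one okl_def intro!: sum.cong)
    also have "\<dots> = x t" using x by (cases "t < l") (auto simp: sum.delta)
    finally show "(\<one>\<^bsub>A\<^esub> \<odot>\<^bsub>U s l\<^esub> x) t = x t" .
  qed
qed

lemma cyclic_rep_uni: "okl l \<Longrightarrow> cyclic_rep n A cf ok (U s l)"
  by (intro cyclic_rep.intro cyclic_rep_axioms.intro cyclic_algebra_axioms abelian_group_uni
      left_module_uni)

lemma finsum_uni:
  assumes "finite I" "f \<in> I \<rightarrow> carrier (U s l)"
  shows "finsum (U s l) f I = (\<lambda>t. \<Sum>i\<in>I. f i t)"
  using assms
proof (induction I)
  interpret abelian_group "U s l" by (rule abelian_group_uni)
  case empty
  then show ?case by simp
next
  interpret abelian_group "U s l" by (rule abelian_group_uni)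
  case (insert x F)
  then have "finsum (U s l) f (insert x F) = f x \<oplus>\<^bsub>U s l\<^esub> finsum (U s l) f F"
    by (intro finsum_insert) auto
  then show ?case using insert by auto
qed

lemma scale_uni:
  assumes l: "okl l" and x: "x \<in> carrier (U s l)"
  shows "cyclic_rep.scale A (U s l) c x = (\<lambda>t. c * x t)"
proof
  interpret u: cyclic_rep n A cf ok "U s l" by (rule cyclic_rep_uni[OF l])
  fix t
  have "u.scale c x t = (\<Sum>k<l - t. if k = 0 then c * x t else 0)"
    unfolding u.scale_def uni_simps
    by (rule sum.cong) (use l in \<open>auto simp: cf_smult one_closed cf_one okl_def\<close>)
  also have "\<dots> = c * x t" using x by (cases "t < l") (auto simp: sum.delta)
  finally show "u.scale c x t = c * x t" .
qed

lemma uni_rep: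
  assumes l: "okl l"
  shows "U s l \<in> reps A"
proof -
  interpret u: cyclic_rep n A cf ok "U s l" by (rule cyclic_rep_uni[OF l])
  have "u.spans {..<l} (\<lambda>i t. of_bool (t = i))"
    unfolding u.spans_def
  proof (intro conjI ballI)
    show e: "(\<lambda>i t. of_bool (t = i)) \<in> {..<l} \<rightarrow> carrier (U s l)" by auto
    fix x assume x: "x \<in> carrier (U s l)"
    have "u.lincomb {..<l} x (\<lambda>i t. of_bool (t = i)) = (\<lambda>t. \<Sum>i<l. u.scale (x i) (\<lambda>t. of_bool (t = i)) t)"
      unfolding u.lincomb_def by (rule finsum_uni) (use e in \<open>auto simp del: uni_simps intro!: u.scale_closed\<close>)
    also have "\<dots> = (\<lambda>t. \<Sum>i<l. if i = t then x t else 0)"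
      by (intro ext sum.cong refl) (use e in \<open>auto simp: scale_uni[OF l]\<close>)
    also have "\<dots> = x" using x by (auto simp: sum.delta)
    finally show "\<exists>c. x = u.lincomb {..<l} c (\<lambda>i t. of_bool (t = i))" by metis
  qed simp
  then show ?thesis unfolding reps_def using u.spans_fin_dim left_module_uni[OF l] by blast
qed


lemma uni_incl:
  assumes "d \<le> l"
  shows "(\<lambda>x. x) \<in> rep_hom A (U s d) (U s l)"
proof (rule rep_homI)
  fix a x assume "a \<in> carrier A" and x: "x \<in> carrier (U s d)"
  show "a \<odot>\<^bsub>U s d\<^esub> x = a \<odot>\<^bsub>U s l\<^esub> x"
  proof
    fix t
    show "(a \<odot>\<^bsub>U s d\<^esub> x) t = (a \<odot>\<^bsub>U s l\<^esub> x) t"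
      unfolding uni_simps by (rule sum.mono_neutral_left) (use x assms in auto)
  qed
qed (use assms in auto)

definition shift :: "nat \<Rightarrow> (nat \<Rightarrow> complex) \<Rightarrow> nat \<Rightarrow> complex" where
  "shift d x t = x (t + d)"

lemma uni_shift:
  assumes "d \<le> l"
  shows "shift d \<in> rep_hom A (U s l) (U (s + int d) (l - d))"
  by (rule rep_homI) (use assms in \<open>auto simp: shift_def algebra_simps intro!: sum.cong\<close>)

lemma shift_surj:
  assumes "d \<le> l"
  shows "shift d ` carrier (U s l) = carrier (U (s + int d) (l - d))"
proof
  show "carrier (U (s + int d) (l - d)) \<subseteq> shift d ` carrier (U s l)"
  proof
    fix y assume y: "y \<in> carrier (U (s + int d) (l - d))"
    have "y = shift d (\<lambda>t. if t < d then 0 else y (t - d))" by (auto simp: shift_def)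
    moreover have "(\<lambda>t. if t < d then 0 else y (t - d)) \<in> carrier (U s l)" using y assms by auto
    ultimately show "y \<in> shift d ` carrier (U s l)" by blast
  qed
qed (use rep_homD(1)[OF uni_shift[OF assms]] in blast)

lemma uni_quotient: "d \<le> l \<Longrightarrow> is_quotient A (U s l) (U (s + int d) (l - d))"
  unfolding is_quotient_def using uni_shift shift_surj by blast

lemma uni_extension:
  assumes "d \<le> l"
  shows "is_extension A (U s d) (U s l) (U (s + int d) (l - d))"
  unfolding is_extension_def
proof (intro bexI conjI)
  show "(\<lambda>x. x) \<in> rep_hom A (U s d) (U s l)" by (rule uni_incl[OF assms])
  show "shift d \<in> rep_hom A (U s l) (U (s + int d) (l - d))" by (rule uni_shift[OF assms])
  show "shift d ` carrier (U s l) = carrier (U (s + int d) (l - d))" by (rule shift_surj[OF assms])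
  show "(\<lambda>x. x) ` carrier (U s d) = {x \<in> carrier (U s l). shift d x = \<zero>\<^bsub>U (s + int d) (l - d)\<^esub>}"
  proof -
    have *: "shift d x = (\<lambda>_. 0) \<longleftrightarrow> (\<forall>t\<ge>d. x t = 0)" for x :: "nat \<Rightarrow> complex"
      unfolding fun_eq_iff shift_def by (metis le_add2 le_add_diff_inverse2)
    show ?thesis unfolding uni_simps image_ident * using assms by auto
  qed
qed simp

lemma path_act:
  assumes l: "okl l" and x: "x \<in> carrier (U s l)" and m: "ok m"
  shows "(path r m \<odot>\<^bsub>U s l\<^esub> x) t = (if int n dvd (s + int t - r) then x (t + m) else 0)"
proof -
  have "(path r m \<odot>\<^bsub>U s l\<^esub> x) t
      = (\<Sum>k<l - t. if k = m then (if int n dvd (s + int t - r) then x (t + m) else 0) else 0)"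
    using l by (auto simp: path(2) okl_def intro!: sum.cong)
  also have "\<dots> = (if int n dvd (s + int t - r) then x (t + m) else 0)"
    using x by (cases "m < l - t") (auto simp: sum.delta)
  finally show ?thesis .
qed

text \<open>
  A vector with top coordinate number \<open>e\<close> is moved by paths of suitable lengths to vectors with top
  coordinates \<open>0, \<dots>, e\<close>; together, these span everything supported on \<open>{0..e}\<close>.
\<close>

lemma uni_submodule:
  assumes l: "okl l" and W: "W \<subseteq> carrier (U s l)" "(\<lambda>_. 0) \<in> W"
    "\<And>x y. x \<in> W \<Longrightarrow> y \<in> W \<Longrightarrow> x \<oplus>\<^bsub>U s l\<^esub> y \<in> W"
    "\<And>a x. a \<in> carrier A \<Longrightarrow> x \<in> W \<Longrightarrow> a \<odot>\<^bsub>U s l\<^esub> x \<in> W"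
  obtains d where "d \<le> l" "W = carrier (U s d)"
proof -
  interpret u: cyclic_rep n A cf ok "U s l" by (rule cyclic_rep_uni[OF l])
  have ex: "\<exists>d. \<forall>x\<in>W. \<forall>t\<ge>d. x t = 0" using W(1) by (intro exI[of _ l]) auto
  define d where "d = (LEAST d. \<forall>x\<in>W. \<forall>t\<ge>d. x t = 0)"
  have d: "\<forall>x\<in>W. \<forall>t\<ge>d. x t = 0" unfolding d_def by (rule LeastI_ex[OF ex])
  have dl: "d \<le> l" unfolding d_def by (rule Least_le) (use W(1) in auto)
  have scW: "(\<lambda>t. c * x t) \<in> W" if "x \<in> W" for c x
    using W(4)[OF u.scalar_in[of c] that] scale_uni[OF l, of x s c] W(1) that
    unfolding u.scale_def by auto
  have "carrier (U s d) \<subseteq> W"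
  proof (cases d)
    case 0
    then show ?thesis using W(2) by (auto simp: fun_eq_iff[symmetric])
  next
    case (Suc e)
    have "\<not> (\<forall>x\<in>W. \<forall>t\<ge>e. x t = 0)"
    proof
      assume "\<forall>x\<in>W. \<forall>t\<ge>e. x t = 0"
      then have "d \<le> e" unfolding d_def by (rule Least_le)
      then show False using Suc by simp
    qed
    then obtain x t where xt: "x \<in> W" "t \<ge> e" "x t \<noteq> 0" by blast
    then have xe: "x e \<noteq> 0" using d Suc by (metis le_antisym not_less_eq_eq)
    have "(\<forall>t\<ge>m. y t = 0) \<longrightarrow> y \<in> W" if "m \<le> d" for m y
      using that
    proof (induction m arbitrary: y)
      case 0
      have "y \<in> W" if "\<forall>t\<ge>0. y t = 0"
      proof -
        have "y = (\<lambda>_. 0)" using that by auto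
        then show ?thesis using W(2) by simp
      qed
      then show ?case by blast
    next
      case (Suc m)
      show ?case
      proof
        assume y: "\<forall>t\<ge>Suc m. y t = 0"
        have me: "m \<le> e" using Suc \<open>d = Suc e\<close> by simp
        have oe: "ok (e - m)" using l dl \<open>d = Suc e\<close> by (simp add: okl_def)
        define x' where "x' = path (s + int m) (e - m) \<odot>\<^bsub>U s l\<^esub> x"
        have xU: "x \<in> carrier (U s l)" using xt(1) W(1) by blast
        have x': "x' t = (if int n dvd (s + int t - (s + int m)) then x (t + (e - m)) else 0)" for t
          unfolding x'_def by (rule path_act[OF l xU oe])
        have x'm: "x' m = x e" "\<And>t. t \<ge> Suc m \<Longrightarrow> x' t = 0"
          using x' me d xt(1) \<open>d = Suc e\<close> by auto
        have x'W: "x' \<in> W" unfolding x'_def by (rule W(4)[OF path(1) xt(1)])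
        define z where "z = (\<lambda>t. y t + (- (y m / x e)) * x' t)"
        have "\<forall>t\<ge>m. z t = 0"
        proof (intro allI impI)
          fix t assume "m \<le> t"
          then show "z t = 0" using xe x'm y by (cases "t = m") (auto simp: z_def)
        qed
        then have "z \<in> W" using Suc.IH[of z] Suc.prems by auto
        then have "z \<oplus>\<^bsub>U s l\<^esub> (\<lambda>t. (y m / x e) * x' t) \<in> W" by (rule W(3)[OF _ scW[OF x'W]])
        moreover have "z \<oplus>\<^bsub>U s l\<^esub> (\<lambda>t. (y m / x e) * x' t) = y" by (auto simp: z_def)
        ultimately show "y \<in> W" by simp
      qed
    qed
    from this[of d] show ?thesis by auto
  qed
  then have "W = carrier (U s d)" using d by auto
  then show ?thesis using that dl by blast
qed

lemma uni_image:
  assumes l: "okl l" and L: "cyclic_rep n A cf ok L" and f: "f \<in> rep_hom A L (U s l)"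
  obtains d where "d \<le> l" "f ` carrier L = carrier (U s d)"
proof (rule uni_submodule[OF l])
  interpret L: cyclic_rep n A cf ok L by (rule L)
  show "f ` carrier L \<subseteq> carrier (U s l)" using rep_homD(1)[OF f] by blast
  have "f \<zero>\<^bsub>L\<^esub> = (\<lambda>_. 0)"
    using rep_hom_zero[OF L.M.abelian_group_axioms abelian_group_uni f] by simp
  then show "(\<lambda>_. 0) \<in> f ` carrier L" using L.M.zero_closed by (metis imageI)
  show "y \<oplus>\<^bsub>U s l\<^esub> z \<in> f ` carrier L" if yz: "y \<in> f ` carrier L" "z \<in> f ` carrier L" for y z
  proof -
    obtain y' z' where "y' \<in> carrier L" "y = f y'" "z' \<in> carrier L" "z = f z'" using yz by blast
    then show ?thesis using rep_homD(2)[OF f, of y' z'] L.M.add.m_closed by (metis imageI)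
  qed
  show "b \<odot>\<^bsub>U s l\<^esub> y \<in> f ` carrier L" if b: "b \<in> carrier A" and y: "y \<in> f ` carrier L" for b y
  proof -
    obtain y' where "y' \<in> carrier L" "y = f y'" using y by blast
    then show ?thesis using rep_homD(3)[OF f b, of y'] L.act_closed[OF b, of y'] by (metis imageI)
  qed
qed

end

section \<open>Splitting off a uniserial summand\<close>

context cyclic_rep
begin

text \<open>
  Elements of the algebra may be infinite sums of paths, but below the Loewy length they act like the
  corresponding finite sums. Comparing with the truncations of \<open>b\<close> avoids sums in the algebra.
\<close>

lemma functional_row:
  assumes \<phi>: "\<And>x y. x \<in> carrier M \<Longrightarrow> y \<in> carrier M \<Longrightarrow> \<phi> (x \<oplus>\<^bsub>M\<^esub> y) = \<phi> x + \<phi> y"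
    "\<And>x c. x \<in> carrier M \<Longrightarrow> \<phi> (scale c x) = (c :: complex) * \<phi> x"
    and L: "kills L" "okl L" and b: "b \<in> carrier A" "\<And>i k. \<not> int n dvd i - s \<Longrightarrow> ok k \<Longrightarrow> cf b i k = 0"
    and y: "y \<in> carrier M"
  shows "\<phi> (b \<odot>\<^bsub>M\<^esub> y) = (\<Sum>k<L. cf b s k * \<phi> (path s k \<odot>\<^bsub>M\<^esub> y))"
proof -
  define T where "T = (\<lambda>m. of_cf (\<lambda>i k. if k < m then cf b i k else 0))"
  have T: "T m \<in> carrier A" "ok k \<Longrightarrow> cf (T m) i k = (if k < m then cf b i k else 0)" for m i k
    unfolding T_def using of_cf[of "\<lambda>i k. if k < m then cf b i k else 0" m] cf_period[OF b(1)]
    by simp_all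
  have "\<phi> (T m \<odot>\<^bsub>M\<^esub> y) = (\<Sum>k<m. cf b s k * \<phi> (path s k \<odot>\<^bsub>M\<^esub> y))" if "m \<le> L" for m
    using that
  proof (induction m)
    case 0
    have "T 0 \<odot>\<^bsub>M\<^esub> y = \<zero>\<^bsub>M\<^esub>" by (rule zero_act) (simp_all add: T y)
    moreover have "\<phi> \<zero>\<^bsub>M\<^esub> = 0" using \<phi>(2)[of "\<zero>\<^bsub>M\<^esub>" 0] by (simp add: scale_zero_r)
    ultimately show ?case by simp
  next
    case (Suc m)
    let ?e = "(cf b s m \<odot>\<^bsub>A\<^esub> \<one>\<^bsub>A\<^esub>) \<otimes>\<^bsub>A\<^esub> path s m"
    have eA: "?e \<in> carrier A" by (rule mult_closed[OF scalar_in path(1)])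
    have "T (Suc m) = T m \<oplus>\<^bsub>A\<^esub> ?e"
    proof (rule cf_ext)
      fix i k assume k: "ok k"
      show "cf (T (Suc m)) i k = cf (T m \<oplus>\<^bsub>A\<^esub> ?e) i k"
        using cf_cong[OF b(1), of i s m] b(2)[of i k] k
        by (auto simp: cf_add T eA cf_scalar_mult path less_Suc_eq)
    qed (auto intro: T add_closed eA)
    then have "T (Suc m) \<odot>\<^bsub>M\<^esub> y = T m \<odot>\<^bsub>M\<^esub> y \<oplus>\<^bsub>M\<^esub> scale (cf b s m) (path s m \<odot>\<^bsub>M\<^esub> y)"
      using act_add[OF T(1) eA y, of m] smult_act[OF path(1) y] by simp
    then show ?case using Suc \<phi> act_closed[OF T(1) y] act_closed[OF path(1) y] by simp
  qed
  from this[of L] have "\<phi> (T L \<odot>\<^bsub>M\<^esub> y) = (\<Sum>k<L. cf b s k * \<phi> (path s k \<odot>\<^bsub>M\<^esub> y))" by simp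
  moreover have "T L \<odot>\<^bsub>M\<^esub> y = b \<odot>\<^bsub>M\<^esub> y"
    by (rule act_cong[OF L(1) T(1) b(1) y]) (simp add: T)
  ultimately show ?thesis by simp
qed

text \<open>
  Let \<open>l\<close> be the Loewy length and let \<open>p\<close> be a path of length \<open>l - 1\<close> that does not kill a vector \<open>x\<close>. A linear
  form \<open>\<phi>\<close> with \<open>\<phi> (p x) = 1\<close> gives a homomorphism \<open>f\<close> to the uniserial module of length \<open>l\<close> with socle at the
  start of \<open>p\<close>: the coordinates of \<open>f y\<close> are the values of \<open>\<phi>\<close> on the images of \<open>y\<close> under the paths with this start.
  The image contains a vector with nonzero top coordinate, so \<open>f\<close> is surjective. A vector \<open>v\<close> at the end of \<open>p\<close>
  that is mapped to the top basis vector is killed by everything that kills the latter, since paths of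
  length \<open>l\<close> act by zero; sending the top basis vector to \<open>v\<close> therefore defines a section \<open>g\<close>.
\<close>

lemma split_uniserial:
  assumes fd: "fin_dim A M" and kN: "kills N" and nz: "x0 \<in> carrier M" "x0 \<noteq> \<zero>\<^bsub>M\<^esub>"
  obtains s l f g where "1 \<le> l" "okl l" "f \<in> rep_hom A M (U s l)" "g \<in> rep_hom A (U s l) M"
    "\<forall>y \<in> carrier (U s l). f (g y) = y"
proof -
  define L where "L = (LEAST N. kills N)"
  have kL: "kills L" unfolding L_def by (rule LeastI[of kills N, OF kN])
  have "L \<noteq> 0"
  proof
    assume "L = 0"
    then have "\<one>\<^bsub>A\<^esub> \<odot>\<^bsub>M\<^esub> x0 = \<zero>\<^bsub>M\<^esub>" using kL one_closed nz(1) unfolding kills_def by simp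
    then show False using nz act_one by simp
  qed
  then obtain k0 where k0: "L = Suc k0" by (cases L) auto
  have "\<not> kills k0" using not_less_Least[of k0 kills] k0 unfolding L_def by simp
  then obtain a x where a: "a \<in> carrier A" "\<And>i k. k < k0 \<Longrightarrow> cf a i k = 0"
    and x: "x \<in> carrier M" "a \<odot>\<^bsub>M\<^esub> x \<noteq> \<zero>\<^bsub>M\<^esub>"
    unfolding kills_def by blast
  have okk0: "ok k0"
  proof (rule ccontr)
    assume "\<not> ok k0"
    then have "\<forall>i. \<forall>k<L. cf a i k = 0"
      using a(2) cf_not_ok[OF a(1)] unfolding k0 by (metis less_Suc_eq)
    then show False using kL a(1) x unfolding kills_def by blast
  qed
  have okL: "okl L" unfolding okl_def k0 using ok_down[OF okk0] by simp
  \<comment> \<open>Otherwise all paths of length \<open>k0\<close> kill \<open>x\<close>, and then so does \<open>a\<close>, because it acts on \<open>x\<close> like the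
    combination of these paths with its own coefficients, built up below one vertex at a time.\<close>
  have "\<exists>s. path s k0 \<odot>\<^bsub>M\<^esub> x \<noteq> \<zero>\<^bsub>M\<^esub>"
  proof (rule ccontr)
    assume no: "\<not> ?thesis"
    define R where "R = (\<lambda>r. of_cf (\<lambda>i k. if k = k0 \<and> i mod int n < int r then cf a i k else 0))"
    have R: "R r \<in> carrier A"
      "ok k \<Longrightarrow> cf (R r) i k = (if k = k0 \<and> i mod int n < int r then cf a i k else 0)" for r i k
      unfolding R_def
      using of_cf[of "\<lambda>i k. if k = k0 \<and> i mod int n < int r then cf a i k else 0" L] cf_period[OF a(1)]
      by (simp_all add: k0)
    have "r \<le> n \<longrightarrow> R r \<odot>\<^bsub>M\<^esub> x = \<zero>\<^bsub>M\<^esub>" for r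
    proof (induction r)
      case 0
      have "\<not> i mod int n < 0" for i using n_pos pos_mod_sign[of "int n" i] by linarith
      then have "R 0 \<odot>\<^bsub>M\<^esub> x = \<zero>\<^bsub>M\<^esub>"
        by (intro zero_act) (simp_all add: R x)
      then show ?case ..
    next
      case (Suc r)
      show ?case
      proof
        assume rn: "Suc r \<le> n"
        let ?e = "(cf a (int r) k0 \<odot>\<^bsub>A\<^esub> \<one>\<^bsub>A\<^esub>) \<otimes>\<^bsub>A\<^esub> path (int r) k0"
        have eA: "?e \<in> carrier A" by (rule mult_closed[OF scalar_in path(1)])
        have "R (Suc r) = R r \<oplus>\<^bsub>A\<^esub> ?e"
        proof (rule cf_ext)
          fix i k assume k: "ok k"
          have "int n dvd i - int r \<longleftrightarrow> i mod int n = int r"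
            using rn mod_eq_dvd_iff[of i "int n" "int r"] by simp
          then show "cf (R (Suc r)) i k = cf (R r \<oplus>\<^bsub>A\<^esub> ?e) i k"
            using cf_cong[OF a(1), of i "int r" k0] k
            by (auto simp: cf_add R eA cf_scalar_mult path)
        qed (auto intro: R add_closed eA)
        then have "R (Suc r) \<odot>\<^bsub>M\<^esub> x = R r \<odot>\<^bsub>M\<^esub> x \<oplus>\<^bsub>M\<^esub> scale (cf a (int r) k0) (path (int r) k0 \<odot>\<^bsub>M\<^esub> x)"
          using act_add[OF R(1) eA x(1), of r] smult_act[OF path(1) x(1)] by simp
        then show "R (Suc r) \<odot>\<^bsub>M\<^esub> x = \<zero>\<^bsub>M\<^esub>" using Suc rn no by (simp add: scale_zero_r)
      qed
    qed
    then have "R n \<odot>\<^bsub>M\<^esub> x = \<zero>\<^bsub>M\<^esub>" by blast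
    moreover have "R n \<odot>\<^bsub>M\<^esub> x = a \<odot>\<^bsub>M\<^esub> x"
    proof (rule act_cong[OF kL R(1) a(1) x(1)])
      fix i k assume "k < L" "ok k"
      then show "cf (R n) i k = cf a i k" using a(2)[of k i] n_pos by (auto simp: R k0 less_Suc_eq)
    qed
    ultimately show False using x by simp
  qed
  then obtain s where w: "path s k0 \<odot>\<^bsub>M\<^esub> x \<noteq> \<zero>\<^bsub>M\<^esub>" by blast
  obtain \<phi> :: "(nat \<Rightarrow> complex) \<Rightarrow> complex" where
    \<phi>: "\<And>x y. x \<in> carrier M \<Longrightarrow> y \<in> carrier M \<Longrightarrow> \<phi> (x \<oplus>\<^bsub>M\<^esub> y) = \<phi> x + \<phi> y"
    "\<And>x c. x \<in> carrier M \<Longrightarrow> \<phi> (scale c x) = c * \<phi> x" and \<phi>w: "\<phi> (path s k0 \<odot>\<^bsub>M\<^esub> x) = 1"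
    by (rule functional[OF fd act_closed[OF path(1) x(1)] w]) blast
  interpret u: cyclic_rep n A cf ok "U s L" by (rule cyclic_rep_uni[OF okL])
  define f where "f = (\<lambda>y t. if t < L then \<phi> (path s t \<odot>\<^bsub>M\<^esub> y) else 0)"
  have f: "f \<in> rep_hom A M (U s L)"
  proof (rule rep_homI)
    fix y assume "y \<in> carrier M"
    then show "f y \<in> carrier (U s L)" by (simp add: f_def)
  next
    fix y z assume "y \<in> carrier M" "z \<in> carrier M"
    then show "f (y \<oplus>\<^bsub>M\<^esub> z) = f y \<oplus>\<^bsub>U s L\<^esub> f z"
      by (auto simp: f_def act_add_r path(1) \<phi> act_closed)
  next
    fix b y assume b: "b \<in> carrier A" and y: "y \<in> carrier M"
    show "f (b \<odot>\<^bsub>M\<^esub> y) = b \<odot>\<^bsub>U s L\<^esub> f y"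
    proof
      fix t
      show "f (b \<odot>\<^bsub>M\<^esub> y) t = (b \<odot>\<^bsub>U s L\<^esub> f y) t"
      proof (cases "t < L")
        case True
        have eb: "path s t \<otimes>\<^bsub>A\<^esub> b \<in> carrier A" by (rule mult_closed[OF path(1) b])
        have "f (b \<odot>\<^bsub>M\<^esub> y) t = \<phi> ((path s t \<otimes>\<^bsub>A\<^esub> b) \<odot>\<^bsub>M\<^esub> y)"
          using True by (simp add: f_def act_mult[OF path(1) b y])
        also have "\<dots> = (\<Sum>k<L. cf (path s t \<otimes>\<^bsub>A\<^esub> b) s k * \<phi> (path s k \<odot>\<^bsub>M\<^esub> y))"
          by (rule functional_row[OF \<phi> kL okL eb _ y]) (auto simp: cf_path_mult[OF b])
        also have "\<dots> = (\<Sum>k<L. if t \<le> k then cf b (s + int t) (k - t) * \<phi> (path s k \<odot>\<^bsub>M\<^esub> y) else 0)"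
          using okL by (auto simp: okl_def cf_path_mult[OF b] intro!: sum.cong)
        also have "\<dots> = (\<Sum>k\<in>{t..<L}. cf b (s + int t) (k - t) * \<phi> (path s k \<odot>\<^bsub>M\<^esub> y))"
          by (simp add: sum.If_cases Int_def atLeastLessThan_def atLeast_def lessThan_def conj_commute)
        also have "\<dots> = (\<Sum>k<L - t. cf b (s + int t) k * \<phi> (path s (t + k) \<odot>\<^bsub>M\<^esub> y))"
          by (rule sum.reindex_bij_witness[of _ "\<lambda>k. t + k" "\<lambda>k. k - t"]) (use True in auto)
        also have "\<dots> = (b \<odot>\<^bsub>U s L\<^esub> f y) t" by (auto simp: f_def intro!: sum.cong)
        finally show ?thesis .
      qed (simp add: f_def)
    qed
  qed
  define \<delta> :: "nat \<Rightarrow> complex" where "\<delta> = (\<lambda>t. of_bool (t = k0))"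
  have \<delta>U: "\<delta> \<in> carrier (U s L)" by (simp add: \<delta>_def k0)
  have "\<exists>v \<in> carrier M. f v = \<delta>"
  proof -
    obtain d where d: "d \<le> L" "f ` carrier M = carrier (U s d)"
      by (rule uni_image[OF okL cyclic_rep_axioms f])
    have "f x k0 = 1" using \<phi>w by (simp add: f_def k0)
    moreover have "f x \<in> carrier (U s d)" using x d(2) by blast
    ultimately have "k0 < d" by (auto simp: not_le[symmetric])
    then have "\<delta> \<in> f ` carrier M" unfolding d(2) by (auto simp: \<delta>_def)
    then show ?thesis by blast
  qed
  then obtain v' where v': "v' \<in> carrier M" "f v' = \<delta>" by blast
  define e where "e = path (s + int k0) 0"
  define v where "v = e \<odot>\<^bsub>M\<^esub> v'"
  have eA: "e \<in> carrier A" unfolding e_def by (rule path(1))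
  have v: "v \<in> carrier M" unfolding v_def by (rule act_closed[OF eA v'(1)])
  have ok0: "ok 0" using ok_down[OF okk0] by simp
  have "f v = e \<odot>\<^bsub>U s L\<^esub> \<delta>" unfolding v_def using rep_homD(3)[OF f eA v'(1)] v'(2) by simp
  also have "\<dots> = \<delta>"
    unfolding e_def by (rule ext) (subst path_act[OF okL \<delta>U ok0], auto simp: \<delta>_def)
  finally have fv: "f v = \<delta>" .
  have a\<delta>: "(b \<odot>\<^bsub>U s L\<^esub> \<delta>) t = (if t \<le> k0 then cf b (s + int t) (k0 - t) else 0)" for b t
  proof -
    have "(b \<odot>\<^bsub>U s L\<^esub> \<delta>) t = (\<Sum>k<L - t. if k = k0 - t \<and> t \<le> k0 then cf b (s + int t) (k0 - t) else 0)"
      unfolding uni_simps by (rule sum.cong) (auto simp: \<delta>_def)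
    also have "\<dots> = (if t \<le> k0 then cf b (s + int t) (k0 - t) else 0)"
      by (cases "t \<le> k0") (auto simp: sum.delta k0)
    finally show ?thesis .
  qed
  have ev: "e \<odot>\<^bsub>M\<^esub> v = v"
  proof -
    have "e \<otimes>\<^bsub>A\<^esub> e = e"
    proof (rule cf_ext)
      fix i k assume "ok k"
      then show "cf (e \<otimes>\<^bsub>A\<^esub> e) i k = cf e i k"
        unfolding e_def by (simp add: cf_path_mult[OF path(1)] path(2))
    qed (auto intro: mult_closed eA)
    then show ?thesis unfolding v_def using act_mult[OF eA eA v'(1)] by simp
  qed
  \<comment> \<open>The section is well defined on multiples of the top basis vector.\<close>
  have wd: "b \<odot>\<^bsub>M\<^esub> v = c \<odot>\<^bsub>M\<^esub> v"
    if bc: "b \<in> carrier A" "c \<in> carrier A" and eq: "b \<odot>\<^bsub>U s L\<^esub> \<delta> = c \<odot>\<^bsub>U s L\<^esub> \<delta>" for b c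
  proof -
    have be: "cf (b \<otimes>\<^bsub>A\<^esub> e) i k = (if int n dvd i + int k - (s + int k0) then cf b i k else 0)"
      if b: "b \<in> carrier A" and k: "ok k" for b i k
    proof -
      have "cf (b \<otimes>\<^bsub>A\<^esub> e) i k
          = (\<Sum>j\<le>k. if j = k then (if int n dvd i + int k - (s + int k0) then cf b i k else 0) else 0)"
        unfolding cf_mult[OF b eA k] unfolding e_def
        by (rule sum.cong) (auto simp: path(2) ok_down[OF k])
      then show ?thesis by (simp add: sum.delta)
    qed
    have "(b \<otimes>\<^bsub>A\<^esub> e) \<odot>\<^bsub>M\<^esub> v = (c \<otimes>\<^bsub>A\<^esub> e) \<odot>\<^bsub>M\<^esub> v"
    proof (rule act_cong[OF kL _ _ v])
      fix i k assume k: "k < L" "ok k"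
      show "cf (b \<otimes>\<^bsub>A\<^esub> e) i k = cf (c \<otimes>\<^bsub>A\<^esub> e) i k"
      proof (cases "int n dvd i + int k - (s + int k0)")
        case True
        define t where "t = k0 - k"
        have t: "t \<le> k0" "k0 - t = k" "int t = int k0 - int k" using k by (auto simp: t_def k0)
        have "i + int k - (s + int k0) = i - (s + int t)" using t by simp
        then have "int n dvd i - (s + int t)" using True by (simp only:)
        then have "cf b i k = cf b (s + int t) k" "cf c i k = cf c (s + int t) k"
          using cf_cong bc by blast+
        moreover have "cf b (s + int t) k = cf c (s + int t) k"
          using fun_cong[OF eq, of t] t unfolding a\<delta> by simp
        ultimately show ?thesis by (simp add: be bc k)
      qed (simp add: be bc k)
    qed (intro mult_closed bc eA)+
    then show ?thesis using act_mult[OF bc(1) eA v] act_mult[OF bc(2) eA v] ev by simp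
  qed
  define \<tau> where "\<tau> = (\<lambda>y. of_cf (\<lambda>i k. if k \<le> k0 \<and> int n dvd i - (s + int (k0 - k)) then y (k0 - k) else 0))"
  have \<tau>: "\<tau> y \<in> carrier A"
    "ok k \<Longrightarrow> cf (\<tau> y) i k = (if k \<le> k0 \<and> int n dvd i - (s + int (k0 - k)) then y (k0 - k) else 0)"
    for y :: "nat \<Rightarrow> complex" and i k
    unfolding \<tau>_def
    using of_cf[of "\<lambda>i k. if k \<le> k0 \<and> int n dvd i - (s + int (k0 - k)) then y (k0 - k) else 0" L]
    by (simp_all add: k0 dvd_shift)
  have \<tau>\<delta>: "\<tau> y \<odot>\<^bsub>U s L\<^esub> \<delta> = y" if "y \<in> carrier (U s L)" for y
  proof
    fix t
    show "(\<tau> y \<odot>\<^bsub>U s L\<^esub> \<delta>) t = y t"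
      unfolding a\<delta> using that ok_down[OF okk0, of "k0 - t"] by (auto simp: \<tau>(2) k0)
  qed
  define g where "g = (\<lambda>y. \<tau> y \<odot>\<^bsub>M\<^esub> v)"
  have g: "g \<in> rep_hom A (U s L) M"
  proof (rule rep_homI)
    fix y assume "y \<in> carrier (U s L)"
    show "g y \<in> carrier M" unfolding g_def by (rule act_closed[OF \<tau>(1) v])
  next
    fix y z assume yz: "y \<in> carrier (U s L)" "z \<in> carrier (U s L)"
    have "g (y \<oplus>\<^bsub>U s L\<^esub> z) = (\<tau> y \<oplus>\<^bsub>A\<^esub> \<tau> z) \<odot>\<^bsub>M\<^esub> v"
      unfolding g_def
    proof (rule wd[OF \<tau>(1) add_closed[OF \<tau>(1) \<tau>(1)]])
      have "y \<oplus>\<^bsub>U s L\<^esub> z \<in> carrier (U s L)" using yz by (rule u.M.add.m_closed)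
      then show "\<tau> (y \<oplus>\<^bsub>U s L\<^esub> z) \<odot>\<^bsub>U s L\<^esub> \<delta> = (\<tau> y \<oplus>\<^bsub>A\<^esub> \<tau> z) \<odot>\<^bsub>U s L\<^esub> \<delta>"
        by (simp only: u.act_add[OF \<tau>(1) \<tau>(1) \<delta>U] \<tau>\<delta>[OF yz(1)] \<tau>\<delta>[OF yz(2)] \<tau>\<delta>)
    qed
    then show "g (y \<oplus>\<^bsub>U s L\<^esub> z) = g y \<oplus>\<^bsub>M\<^esub> g z" unfolding g_def using act_add[OF \<tau>(1) \<tau>(1) v] by simp
  next
    fix b y assume b: "b \<in> carrier A" and y: "y \<in> carrier (U s L)"
    have "g (b \<odot>\<^bsub>U s L\<^esub> y) = (b \<otimes>\<^bsub>A\<^esub> \<tau> y) \<odot>\<^bsub>M\<^esub> v"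
      unfolding g_def
    proof (rule wd[OF \<tau>(1) mult_closed[OF b \<tau>(1)]])
      have "b \<odot>\<^bsub>U s L\<^esub> y \<in> carrier (U s L)" by (rule u.act_closed[OF b y])
      then show "\<tau> (b \<odot>\<^bsub>U s L\<^esub> y) \<odot>\<^bsub>U s L\<^esub> \<delta> = (b \<otimes>\<^bsub>A\<^esub> \<tau> y) \<odot>\<^bsub>U s L\<^esub> \<delta>"
        by (simp only: u.act_mult[OF b \<tau>(1) \<delta>U] \<tau>\<delta>[OF y] \<tau>\<delta>)
    qed
    then show "g (b \<odot>\<^bsub>U s L\<^esub> y) = b \<odot>\<^bsub>M\<^esub> g y" unfolding g_def using act_mult[OF b \<tau>(1) v] by simp
  qed
  have fg: "f (g y) = y" if "y \<in> carrier (U s L)" for y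
    unfolding g_def using rep_homD(3)[OF f \<tau>(1) v] fv \<tau>\<delta>[OF that] by simp
  show ?thesis by (rule that[OF _ okL f g]) (use fg in \<open>auto simp: k0\<close>)
qed

text \<open>
  The complement is realised inside \<open>M\<close>, as the kernel of \<open>f\<close>; it is a quotient by \<open>x \<mapsto> x - g (f x)\<close>.
\<close>

lemma split_kernel:
  assumes N: "cyclic_rep n A cf ok N" and f: "f \<in> rep_hom A M N" and g: "g \<in> rep_hom A N M"
    and fg: "\<forall>y \<in> carrier N. f (g y) = y"
    and K_def: "K = sub_rep M {x \<in> carrier M. f x = \<zero>\<^bsub>N\<^esub>}"
  shows "\<exists>q. cyclic_rep n A cf ok K \<and> q \<in> rep_hom A M K \<and> q ` carrier M = carrier K
    \<and> (\<forall>y \<in> carrier N. q (g y) = \<zero>\<^bsub>K\<^esub>) \<and> is_extension A K M N"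
proof -
  interpret N: cyclic_rep n A cf ok N by fact
  have f0: "f \<zero>\<^bsub>M\<^esub> = \<zero>\<^bsub>N\<^esub>" by (rule rep_hom_zero[OF M.abelian_group_axioms N.M.abelian_group_axioms f])
  have K: "cyclic_rep n A cf ok K"
    unfolding K_def
    by (rule cyclic_rep_sub) (auto simp: f0 rep_homD[OF f] act_closed N.act_zero)
  define q where "q = (\<lambda>x. x \<oplus>\<^bsub>M\<^esub> scale (- 1) (g (f x)))"
  have gf: "g (f x) \<in> carrier M" if "x \<in> carrier M" for x using rep_homD(1)[OF g] rep_homD(1)[OF f] that by blast
  have Kc: "carrier K = {x \<in> carrier M. f x = \<zero>\<^bsub>N\<^esub>}" by (simp add: K_def)
  have qK: "q x \<in> carrier K" if x: "x \<in> carrier M" for x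
  proof -
    have "f (q x) = f x \<oplus>\<^bsub>N\<^esub> N.scale (- 1) (f x)"
      unfolding q_def using x gf[OF x] rep_homD(1)[OF f x]
      by (simp add: rep_homD(2)[OF f] rep_hom_scale[OF N f] fg)
    also have "\<dots> = \<zero>\<^bsub>N\<^esub>" using rep_homD(1)[OF f x] by (simp add: N.scale_minus N.M.r_neg)
    finally show ?thesis using x gf[OF x] by (simp add: Kc q_def)
  qed
  have q: "q \<in> rep_hom A M K"
  proof (rule rep_homI)
    fix x y assume xy: "x \<in> carrier M" "y \<in> carrier M"
    show "q (x \<oplus>\<^bsub>M\<^esub> y) = q x \<oplus>\<^bsub>K\<^esub> q y"
      using xy gf[OF xy(1)] gf[OF xy(2)] rep_homD(1)[OF f] 
      by (simp add: q_def K_def rep_homD(2)[OF f] rep_homD(2)[OF g] scale_add_r M.a_ac)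
  next
    fix a x assume ax: "a \<in> carrier A" "x \<in> carrier M"
    show "q (a \<odot>\<^bsub>M\<^esub> x) = a \<odot>\<^bsub>K\<^esub> q x"
      using ax gf[OF ax(2)] rep_homD(1)[OF f]
      by (simp add: q_def K_def rep_homD(3)[OF f] rep_homD(3)[OF g] act_add_r act_scale)
  qed (rule qK)
  have qid: "q x = x" if "x \<in> carrier K" for x
  proof -
    have "g \<zero>\<^bsub>N\<^esub> = \<zero>\<^bsub>M\<^esub>" by (rule rep_hom_zero[OF N.M.abelian_group_axioms M.abelian_group_axioms g])
    then show ?thesis using that by (simp add: Kc q_def scale_zero_r)
  qed
  have qs: "q ` carrier M = carrier K"
  proof
    show "carrier K \<subseteq> q ` carrier M"
    proof
      fix x assume x: "x \<in> carrier K"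
      then have "q x = x" "x \<in> carrier M" by (auto simp: qid Kc)
      then show "x \<in> q ` carrier M" by (metis imageI)
    qed
  qed (use qK in blast)
  have qg: "q (g y) = \<zero>\<^bsub>K\<^esub>" if y: "y \<in> carrier N" for y
    using rep_homD(1)[OF g y] by (simp add: q_def bspec[OF fg y] scale_minus M.r_neg K_def)
  have "is_extension A K M N"
    unfolding is_extension_def
  proof (intro bexI conjI)
    show "(\<lambda>x. x) \<in> rep_hom A K M" by (rule rep_homI) (auto simp: K_def)
    show "f \<in> rep_hom A M N" by (rule f)
    show "(\<lambda>x. x) ` carrier K = {x \<in> carrier M. f x = \<zero>\<^bsub>N\<^esub>}" by (simp add: Kc)
    show "f ` carrier M = carrier N"
    proof
      show "carrier N \<subseteq> f ` carrier M" using fg rep_homD(1)[OF g] by (metis imageI subsetI)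
    qed (use rep_homD(1)[OF f] in blast)
  qed simp
  then show ?thesis using K q qs qg by blast
qed

end

context cyclic_algebra
begin

text \<open>
  A surjection maps the generator to a vector with nonzero top coordinate. The idempotent at the top fixes
  both vectors, and the path of length \<open>l\<close> ending at the top kills the generator of the source.
\<close>

lemma uni_quotient_only:
  assumes l: "okl l" "okl l'" and q: "is_quotient A (U s l) (U s' l')" and pos: "1 \<le> l'"
  shows "l' \<le> l" "int n dvd (s' + int l') - (s + int l)"
proof -
  obtain g where g: "g \<in> rep_hom A (U s l) (U s' l')" "g ` carrier (U s l) = carrier (U s' l')"
    using q unfolding is_quotient_def by blast
  have ok0: "ok 0" using l(2) pos by (simp add: okl_def)
  have l0: "l \<noteq> 0"
  proof
    assume "l = 0"
    then have "carrier (U s l) = {\<lambda>_. 0}" by (auto simp: fun_eq_iff)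
    then have c: "carrier (U s' l') = {\<lambda>_. 0}"
      using g(2) rep_hom_zero[OF abelian_group_uni abelian_group_uni g(1)] by simp
    have "(\<lambda>t. of_bool (t = 0)) \<in> carrier (U s' l')" using pos by simp
    then show False unfolding c by (auto simp: fun_eq_iff)
  qed
  define \<delta> :: "nat \<Rightarrow> complex" where "\<delta> = (\<lambda>t. of_bool (t = l - 1))"
  have \<delta>: "\<delta> \<in> carrier (U s l)" using l0 by (auto simp: \<delta>_def)
  define z where "z = g \<delta>"
  have z: "z \<in> carrier (U s' l')" unfolding z_def by (rule rep_homD(1)[OF g(1) \<delta>])
  have ztop: "z (l' - 1) \<noteq> 0"
  proof
    assume z0: "z (l' - 1) = 0"
    have "(\<lambda>t. of_bool (t = l' - 1)) \<in> carrier (U s' l')" using pos by auto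
    then have "(\<lambda>t. of_bool (t = l' - 1)) \<in> g ` carrier (U s l)" by (simp only: g(2))
    then obtain y where y: "y \<in> carrier (U s l)" "g y = (\<lambda>t. of_bool (t = l' - 1))"
      by (elim imageE) (simp only: )
    define a where "a = of_cf (\<lambda>i k. if k < l \<and> int n dvd i - (s + int (l - 1 - k)) then y (l - 1 - k) else 0)"
    have a: "a \<in> carrier A"
      "ok k \<Longrightarrow> cf a i k = (if k < l \<and> int n dvd i - (s + int (l - 1 - k)) then y (l - 1 - k) else 0)" for i k
      unfolding a_def
      using of_cf[of "\<lambda>i k. if k < l \<and> int n dvd i - (s + int (l - 1 - k)) then y (l - 1 - k) else 0" l]
      by (simp_all add: dvd_shift)
    have "a \<odot>\<^bsub>U s l\<^esub> \<delta> = y"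
    proof
      fix t
      have "(a \<odot>\<^bsub>U s l\<^esub> \<delta>) t = (\<Sum>k<l - t. if k = l - 1 - t then y t else 0)"
        unfolding uni_simps
      proof (rule sum.cong)
        fix k assume k: "k \<in> {..<l - t}"
        then have "ok k" using l(1) by (simp add: okl_def)
        moreover have "k = l - 1 - t \<Longrightarrow> l - 1 - k = t" using k by auto
        ultimately show "cf a (s + int t) k * \<delta> (t + k) = (if k = l - 1 - t then y t else 0)"
          using k by (auto simp: a(2) \<delta>_def)
      qed simp
      also have "\<dots> = y t" using y(1) by (cases "t < l") (auto simp: sum.delta)
      finally show "(a \<odot>\<^bsub>U s l\<^esub> \<delta>) t = y t" .
    qed
    then have "g y = a \<odot>\<^bsub>U s' l'\<^esub> z" unfolding z_def using rep_homD(3)[OF g(1) a(1) \<delta>] by simp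
    then have "g y (l' - 1) = cf a (s' + int (l' - 1)) 0 * z (l' - 1)" using pos by simp
    then show False using z0 y(2) by simp
  qed
  define e where "e = path (s + int (l - 1)) 0"
  have "e \<odot>\<^bsub>U s l\<^esub> \<delta> = \<delta>"
    unfolding e_def by (rule ext) (subst path_act[OF l(1) \<delta> ok0], use l0 in \<open>auto simp: \<delta>_def\<close>)
  then have "e \<odot>\<^bsub>U s' l'\<^esub> z = z" unfolding z_def e_def using rep_homD(3)[OF g(1) path(1) \<delta>] by metis
  then have "(e \<odot>\<^bsub>U s' l'\<^esub> z) (l' - 1) \<noteq> 0" using ztop by simp
  then have "int n dvd s' + int (l' - 1) - (s + int (l - 1))"
    unfolding e_def path_act[OF l(2) z ok0] by (auto split: if_splits)
  then show d: "int n dvd (s' + int l') - (s + int l)" using pos l0 by (simp add: of_nat_diff algebra_simps)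
  show "l' \<le> l"
  proof (rule ccontr)
    assume "\<not> l' \<le> l"
    then have lt: "l < l'" by simp
    then have okm: "ok l" using l(2) by (simp add: okl_def)
    define p where "p = path (s' + int (l' - 1) - int l) l"
    have "p \<odot>\<^bsub>U s l\<^esub> \<delta> = (\<lambda>_. 0)"
      unfolding p_def by (rule ext) (subst path_act[OF l(1) \<delta> okm], use l0 in \<open>auto simp: \<delta>_def\<close>)
    moreover have "p \<odot>\<^bsub>U s' l'\<^esub> z = g (p \<odot>\<^bsub>U s l\<^esub> \<delta>)"
      unfolding z_def p_def by (rule rep_homD(3)[OF g(1) path(1) \<delta>, symmetric])
    moreover have "g (\<lambda>_. 0) = (\<lambda>_. 0)"
      using rep_hom_zero[OF abelian_group_uni abelian_group_uni g(1)] by simp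
    ultimately have "p \<odot>\<^bsub>U s' l'\<^esub> z = (\<lambda>_. 0)" by (simp only:)
    moreover have "(p \<odot>\<^bsub>U s' l'\<^esub> z) (l' - 1 - l) = z (l' - 1)"
      unfolding p_def path_act[OF l(2) z okm] using lt by simp
    ultimately show False using ztop by simp
  qed
qed

end

section \<open>Torsion classes and reach functions\<close>

text \<open>
  The extra assumption says that finite-dimensional modules have finite Loewy length. It is the only
  place where the two algebras need different arguments.
\<close>

locale cyclic_algebra_nil = cyclic_algebra n A cf ok
  for n and A :: "(complex, 'x) module" and cf ok +
  assumes nil: "M \<in> reps A \<Longrightarrow> \<exists>N. \<forall>a \<in> carrier A. (\<forall>i. \<forall>k<N. cf a i k = 0) \<longrightarrow>
    (\<forall>x \<in> carrier M. a \<odot>\<^bsub>M\<^esub> x = \<zero>\<^bsub>M\<^esub>)"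
begin

text \<open>
  The module of the interval \<open>[i, p)\<close>. Positions are the negatives of vertices, because paths act against
  their direction: the top is at the vertex \<open>- i\<close> and the socle at the vertex \<open>1 - p\<close>. For \<open>p = i\<close> the module
  is zero; this makes \<open>reach_of\<close> a maximum over a nonempty set.
\<close>

definition brick :: "int \<Rightarrow> int \<Rightarrow> 'x rep" where
  "brick i p = U (1 - p) (nat (p - i))"

lemma okl_brick: "p \<le> i + int n \<Longrightarrow> okl (nat (p - i))"
  by (rule okl_small) simp

lemma rep_brick: "p \<le> i + int n \<Longrightarrow> brick i p \<in> reps A"
  unfolding brick_def by (rule uni_rep[OF okl_brick])

lemma cyclic_rep_reps:
  assumes "M \<in> reps A"
  shows "cyclic_rep n A cf ok M"
proof (intro cyclic_rep.intro cyclic_rep_axioms.intro cyclic_algebra_axioms)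
  show "left_module A M" using assms by (simp add: reps_def)
  then show "abelian_group M" by (simp add: left_module_def)
qed

lemma brick_quotient:
  assumes "i \<le> q" "q \<le> p"
  shows "is_quotient A (brick i p) (brick i q)"
proof -
  have "1 - p + int (nat (p - q)) = 1 - q" "nat (p - i) - nat (p - q) = nat (q - i)"
    using assms by auto
  then show ?thesis using uni_quotient[of "nat (p - q)" "nat (p - i)" "1 - p"] assms
    unfolding brick_def by simp
qed

lemma brick_extension:
  assumes "i \<le> j" "j \<le> p"
  shows "is_extension A (brick j p) (brick i p) (brick i j)"
proof -
  have "1 - p + int (nat (p - j)) = 1 - j" "nat (p - i) - nat (p - j) = nat (j - i)"
    using assms by auto
  then show ?thesis using uni_extension[of "nat (p - j)" "nat (p - i)" "1 - p"] assms
    unfolding brick_def by simp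
qed

text \<open>
  Up to translation by \<open>n\<close>, the quotients of a brick that are bricks are its initial segments.
\<close>

lemma brick_quotient_only:
  assumes "is_quotient A (brick i p) (brick j q)" "j < q" "q \<le> j + int n" "i < p" "p \<le> i + int n"
  shows "int n dvd j - i" "q - j \<le> p - i"
proof -
  have pos: "1 \<le> nat (q - j)" using assms by simp
  note * = uni_quotient_only[OF okl_brick[OF assms(5)] okl_brick[OF assms(3)] assms(1)[unfolded brick_def] pos]
  show "q - j \<le> p - i" using *(1) assms by simp
  have "int n dvd i - j" using *(2) assms by simp
  then show "int n dvd j - i" by (simp add: dvd_diff_commute)
qed

lemma torsion_class_closed:
  assumes "torsion_class A T"
  shows "M \<in> T \<Longrightarrow> M \<in> reps A"
    "M \<in> T \<Longrightarrow> N \<in> reps A \<Longrightarrow> is_quotient A M N \<Longrightarrow> N \<in> T"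
    "L \<in> T \<Longrightarrow> N \<in> T \<Longrightarrow> M \<in> reps A \<Longrightarrow> is_extension A L M N \<Longrightarrow> M \<in> T"
  using assms unfolding torsion_class_def by (blast, blast, blast)

lemma zero_in_torsion_class:
  assumes T: "torsion_class A T" and N: "N \<in> reps A" "carrier N = {\<zero>\<^bsub>N\<^esub>}"
  shows "N \<in> T"
proof -
  obtain M where M: "M \<in> T" using T unfolding torsion_class_def by blast
  interpret M: cyclic_rep n A cf ok M
    by (rule cyclic_rep_reps[OF torsion_class_closed(1)[OF T M]])
  interpret N: cyclic_rep n A cf ok N by (rule cyclic_rep_reps[OF N(1)])
  have "(\<lambda>_. \<zero>\<^bsub>N\<^esub>) \<in> rep_hom A M N" by (rule rep_homI) (simp_all add: N.act_zero)
  moreover have "(\<lambda>_. \<zero>\<^bsub>N\<^esub>) ` carrier M = carrier N" using N(2) M.M.zero_closed by auto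
  ultimately have "is_quotient A M N" unfolding is_quotient_def by blast
  then show ?thesis by (rule torsion_class_closed(2)[OF T M N(1)])
qed

lemma brick_refl_in:
  assumes "torsion_class A T"
  shows "brick i i \<in> T"
proof (rule zero_in_torsion_class[OF assms])
  show "brick i i \<in> reps A" by (rule rep_brick) simp
  show "carrier (brick i i) = {\<zero>\<^bsub>brick i i\<^esub>}" by (auto simp: brick_def fun_eq_iff)
qed

definition reach_of :: "'x rep set \<Rightarrow> int \<Rightarrow> int" where
  "reach_of T i = Max {p \<in> {i..i + int n}. brick i p \<in> T}"

lemma finite_reach_set: "finite {p \<in> {i..i + int n}. brick i p \<in> T}"
  by (rule finite_subset[of _ "{i..i + int n}"]) auto

lemma reach_of:
  assumes T: "torsion_class A T"
  shows "i \<le> reach_of T i" "reach_of T i \<le> i + int n" "brick i (reach_of T i) \<in> T"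
proof -
  have "reach_of T i \<in> {p \<in> {i..i + int n}. brick i p \<in> T}"
    unfolding reach_of_def
  proof (rule Max_in[OF finite_reach_set])
    have "i \<in> {p \<in> {i..i + int n}. brick i p \<in> T}" using brick_refl_in[OF T, of i] by simp
    then show "{p \<in> {i..i + int n}. brick i p \<in> T} \<noteq> {}" by blast
  qed
  then show "i \<le> reach_of T i" "reach_of T i \<le> i + int n" "brick i (reach_of T i) \<in> T" by auto
qed

lemma brick_in_iff:
  assumes T: "torsion_class A T" and p: "i \<le> p" "p \<le> i + int n"
  shows "brick i p \<in> T \<longleftrightarrow> p \<le> reach_of T i"
proof
  assume "brick i p \<in> T"
  then show "p \<le> reach_of T i" unfolding reach_of_def by (intro Max_ge finite_reach_set) (use p in auto)
next
  assume "p \<le> reach_of T i"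
  then have "is_quotient A (brick i (reach_of T i)) (brick i p)" by (intro brick_quotient p)
  then show "brick i p \<in> T"
    by (rule torsion_class_closed(2)[OF T reach_of(3)[OF T] rep_brick[OF p(2)]])
qed

lemma brick_shift:
  "is_quotient A (brick i p) (brick (i + int n) (p + int n))"
  "is_quotient A (brick (i + int n) (p + int n)) (brick i p)"
proof -
  have sm: "a \<odot>\<^bsub>brick i p\<^esub> x = a \<odot>\<^bsub>brick (i + int n) (p + int n)\<^esub> x" if "a \<in> carrier A" for a x
    unfolding brick_def uni_simps
    using cf_cong[OF that, of "1 - p + int t" "1 - (p + int n) + int t" for t] by simp
  have c: "carrier (brick i p) = carrier (brick (i + int n) (p + int n))" by (simp add: brick_def)
  have "(\<lambda>x. x) \<in> rep_hom A (brick i p) (brick (i + int n) (p + int n))"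
    by (rule rep_homI) (simp_all only: sm, simp_all add: brick_def)
  then show "is_quotient A (brick i p) (brick (i + int n) (p + int n))"
    unfolding is_quotient_def using c by (intro bexI[of _ "\<lambda>x. x"]) simp_all
  have "(\<lambda>x. x) \<in> rep_hom A (brick (i + int n) (p + int n)) (brick i p)"
    by (rule rep_homI) (simp_all only: sm[symmetric], simp_all add: brick_def)
  then show "is_quotient A (brick (i + int n) (p + int n)) (brick i p)"
    unfolding is_quotient_def using c by (intro bexI[of _ "\<lambda>x. x"]) simp_all
qed

text \<open>
  The extension of the bricks \<open>[i, j)\<close> and \<open>[j, r j)\<close> is the uniserial module of the interval \<open>[i, r j)\<close>, which
  is truncated at \<open>i + n\<close> to stay among the bricks.
\<close>

lemma reach_of_reach:
  assumes T: "torsion_class A T"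
  shows "reach_of T \<in> reach n"
proof (rule reachI)
  fix i
  show "i \<le> reach_of T i" "reach_of T i \<le> i + int n" by (rule reach_of[OF T])+
  have sh: "brick (i + int n) (p + int n) \<in> T \<longleftrightarrow> brick i p \<in> T" if "p \<le> i + int n" for p
    using brick_shift torsion_class_closed(2)[OF T]
      rep_brick[OF that] rep_brick[of "p + int n" "i + int n"] that by auto
  show "reach_of T (i + int n) = reach_of T i + int n"
  proof (rule antisym)
    have 1: "reach_of T (i + int n) - int n \<le> i + int n" "i \<le> reach_of T (i + int n) - int n"
      using reach_of(1,2)[OF T, of "i + int n"] by auto
    have "brick i (reach_of T (i + int n) - int n) \<in> T"
      using sh[OF 1(1)] reach_of(3)[OF T, of "i + int n"] by simp
    then show "reach_of T (i + int n) \<le> reach_of T i + int n"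
      using brick_in_iff[OF T 1(2,1)] by simp
    have "brick (i + int n) (reach_of T i + int n) \<in> T"
      using sh[OF reach_of(2)[OF T]] reach_of(3)[OF T] by simp
    then show "reach_of T i + int n \<le> reach_of T (i + int n)"
      using brick_in_iff[OF T, of "i + int n" "reach_of T i + int n"] reach_of(1,2)[OF T, of i] by simp
  qed
next
  fix i j assume ij: "i < j" "j \<le> reach_of T i" "reach_of T i < i + int n"
  define p where "p = min (reach_of T j) (i + int n)"
  have jp: "j \<le> p" using reach_of(1)[OF T, of j] ij by (simp add: p_def)
  have 1: "brick j p \<in> T"
    using brick_in_iff[OF T jp] ij by (simp add: p_def)
  have 2: "brick i j \<in> T" using brick_in_iff[OF T, of i j] ij by simp
  have 3: "brick i p \<in> reps A" by (rule rep_brick) (simp add: p_def)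
  have "is_extension A (brick j p) (brick i p) (brick i j)" by (rule brick_extension) (use ij jp in auto)
  then have "brick i p \<in> T" by (rule torsion_class_closed(3)[OF T 1 2 3])
  then have "p \<le> reach_of T i" using brick_in_iff[OF T, of i p] ij jp by (simp add: p_def)
  then show "reach_of T j \<le> reach_of T i" using ij(3) by (simp add: p_def min_def split: if_splits)
qed

definition tors_of :: "(int \<Rightarrow> int) \<Rightarrow> 'x rep set" where
  "tors_of r = {M \<in> reps A. \<forall>i p. i < p \<and> p \<le> i + int n \<and> is_quotient A M (brick i p) \<longrightarrow> p \<le> r i}"

text \<open>
  The point is closure under extensions. If \<open>M\<close> is an extension of \<open>N\<close> by \<open>L\<close> and \<open>h\<close> maps \<open>M\<close> onto the brick
  \<open>[i, p)\<close>, then the image of \<open>L\<close> is a final segment \<open>[j, p)\<close>, and \<open>[i, j)\<close> is a quotient of \<open>N\<close>. So \<open>p \<le> r j\<close>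
  and \<open>j \<le> r i\<close>, and the defining property of reach functions yields \<open>p \<le> r i\<close>.
\<close>

lemma torsion_class_tors_of:
  assumes r: "r \<in> reach n"
  shows "torsion_class A (tors_of r)"
proof -
  have quot: "N \<in> tors_of r" if "M \<in> tors_of r" "N \<in> reps A" "is_quotient A M N" for M N
    using that is_quotient_trans[OF that(3)] unfolding tors_of_def by blast
  have "brick 0 0 \<in> reps A" by (rule rep_brick) simp
  moreover have "\<not> is_quotient A (brick 0 0) (brick i p)" if ip: "i < p" "p \<le> i + int n" for i p
  proof
    assume "is_quotient A (brick 0 0) (brick i p)"
    then have q: "is_quotient A (U (1 - 0) (nat (0 - 0))) (U (1 - p) (nat (p - i)))"
      by (simp only: brick_def)
    have "1 \<le> nat (p - i)" using ip by simp
    from uni_quotient_only(1)[OF okl_brick okl_brick[OF ip(2)] q this] this show False by simp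
  qed
  ultimately have ne: "brick 0 0 \<in> tors_of r" unfolding tors_of_def by blast
  have ext: "M \<in> tors_of r"
    if L: "L \<in> tors_of r" and N: "N \<in> tors_of r" and M: "M \<in> reps A" and e: "is_extension A L M N" for L M N
  proof -
    obtain f g where f: "f \<in> rep_hom A L M" "f ` carrier L = {x \<in> carrier M. g x = \<zero>\<^bsub>N\<^esub>}"
      and g: "g \<in> rep_hom A M N" "g ` carrier M = carrier N"
      using e unfolding is_extension_def by blast
    interpret M: cyclic_rep n A cf ok M by (rule cyclic_rep_reps[OF M])
    interpret N: cyclic_rep n A cf ok N
      by (rule cyclic_rep_reps) (use N in \<open>simp add: tors_of_def\<close>)
    interpret L: cyclic_rep n A cf ok L
      by (rule cyclic_rep_reps) (use L in \<open>simp add: tors_of_def\<close>)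
    have "p \<le> r i" if ip: "i < p" "p \<le> i + int n" and q: "is_quotient A M (brick i p)" for i p
    proof -
      define s l where "s = 1 - p" and "l = nat (p - i)"
      have l: "okl l" unfolding l_def by (rule okl_brick[OF ip(2)])
      obtain h where h: "h \<in> rep_hom A M (U s l)" "h ` carrier M = carrier (U s l)"
        using q unfolding is_quotient_def brick_def s_def l_def by blast
      have hf: "h \<circ> f \<in> rep_hom A L (U s l)" by (rule rep_hom_comp[OF f(1) h(1)])
      let ?W = "(h \<circ> f) ` carrier L"
      obtain d where d: "d \<le> l" "?W = carrier (U s d)"
        by (rule uni_image[OF l L.cyclic_rep_axioms hf])
      define j where "j = p - int d"
      have j: "i \<le> j" "j \<le> p" using d(1) ip by (auto simp: j_def l_def)
      have "is_quotient A L (brick j p)"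
      proof -
        have Sj: "brick j p = U s d" by (simp add: brick_def j_def s_def)
        have hom: "h \<circ> f \<in> rep_hom A L (U s d)"
        proof (rule rep_homI)
          fix x assume "x \<in> carrier L"
          then show "(h \<circ> f) x \<in> carrier (U s d)" using d(2) by blast
        next
          fix x y assume "x \<in> carrier L" "y \<in> carrier L"
          then show "(h \<circ> f) (x \<oplus>\<^bsub>L\<^esub> y) = (h \<circ> f) x \<oplus>\<^bsub>U s d\<^esub> (h \<circ> f) y" using rep_homD(2)[OF hf] by simp
        next
          fix a x assume ax: "a \<in> carrier A" "x \<in> carrier L"
          then have "(h \<circ> f) x \<in> carrier (U s d)" using d(2) by blast
          then show "(h \<circ> f) (a \<odot>\<^bsub>L\<^esub> x) = a \<odot>\<^bsub>U s d\<^esub> (h \<circ> f) x"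
            using rep_homD(3)[OF hf ax] rep_homD(3)[OF uni_incl[OF d(1), of s] ax(1)] by simp
        qed
        show ?thesis unfolding is_quotient_def Sj by (rule bexI[of _ "h \<circ> f", OF _ hom]) (rule d(2))
      qed
      then have pj: "p \<le> r j" if "j < p" using L that j ip unfolding tors_of_def by auto
      have "is_quotient A N (brick i j)"
      proof -
        have "brick i j = U (s + int d) (l - d)"
        proof -
          have "1 - j = s + int d" "nat (j - i) = l - d"
            using ip d(1) by (auto simp: j_def s_def l_def)
          then show ?thesis by (simp add: brick_def)
        qed
        moreover
        let ?k = "\<lambda>x. shift d (h x)"
        have k: "?k \<in> rep_hom A M (U (s + int d) (l - d))"
          using rep_hom_comp[OF h(1) uni_shift[OF d(1)]] by (simp add: comp_def)
        have ksurj: "?k ` carrier M = carrier (U (s + int d) (l - d))"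
          using shift_surj[OF d(1)] h(2) by (metis image_image)
        have k0: "?k x = (\<lambda>_. 0)" if x: "x \<in> carrier M" "g x = \<zero>\<^bsub>N\<^esub>" for x
        proof -
          have "x \<in> f ` carrier L" using f(2) x by blast
          then have "h x \<in> ?W" by auto
          then have "h x \<in> carrier (U s d)" unfolding d(2) .
          then show ?thesis by (auto simp: shift_def)
        qed
        \<comment> \<open>The composition of \<open>h\<close> with the projection to \<open>[i, j)\<close> kills \<open>L\<close>, so it factors through \<open>N\<close>.\<close>
        have kg: "?k x = ?k y" if x: "x \<in> carrier M" and y: "y \<in> carrier M" and xy: "g x = g y" for x y
        proof -
          let ?m = "M.scale (- 1) y"
          have m: "?m \<in> carrier M" using y by simp
          have "g (x \<oplus>\<^bsub>M\<^esub> ?m) = g y \<oplus>\<^bsub>N\<^esub> N.scale (- 1) (g y)"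
            using x m y xy by (simp add: rep_homD(2)[OF g(1)] M.rep_hom_scale[OF N.cyclic_rep_axioms g(1)])
          also have "\<dots> = \<zero>\<^bsub>N\<^esub>" using rep_homD(1)[OF g(1) y] by (simp add: N.scale_minus N.M.r_neg)
          finally have *: "?k (x \<oplus>\<^bsub>M\<^esub> ?m) = (\<lambda>_. 0)" by (intro k0) (use x m in simp_all)
          have **: "y \<oplus>\<^bsub>M\<^esub> ?m = \<zero>\<^bsub>M\<^esub>" using y by (simp add: M.scale_minus M.M.r_neg)
          have "?k \<zero>\<^bsub>M\<^esub> = (\<lambda>_. 0)"
            using rep_hom_zero[OF M.M.abelian_group_axioms abelian_group_uni k] by simp
          then have "?k x t + ?k ?m t = 0 \<and> ?k y t + ?k ?m t = 0" for t
            using fun_cong[OF *, of t] fun_cong[OF rep_homD(2)[OF k x m], of t]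
              fun_cong[OF rep_homD(2)[OF k y m], of t] unfolding ** by simp
          then have "?k x t = ?k y t" for t by (metis add_right_imp_eq)
          then show ?thesis by blast
        qed
        define u where "u = (\<lambda>b. ?k (SOME x. x \<in> carrier M \<and> g x = b))"
        have ug: "u (g x) = ?k x" if x: "x \<in> carrier M" for x
        proof -
          have "\<exists>y. y \<in> carrier M \<and> g y = g x" using x by blast
          from someI_ex[OF this] show ?thesis unfolding u_def using kg x by blast
        qed
        have "u \<in> rep_hom A N (U (s + int d) (l - d))"
        proof (rule rep_homI)
          fix b assume "b \<in> carrier N"
          then obtain x where "x \<in> carrier M" "b = g x" using g(2) by blast
          then show "u b \<in> carrier (U (s + int d) (l - d))" using ug rep_homD(1)[OF k] by simp
        next
          fix b c assume "b \<in> carrier N" "c \<in> carrier N"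
          then obtain x y where xy: "x \<in> carrier M" "b = g x" "y \<in> carrier M" "c = g y" using g(2) by blast
          then have "u (b \<oplus>\<^bsub>N\<^esub> c) = ?k (x \<oplus>\<^bsub>M\<^esub> y)"
            using ug[of "x \<oplus>\<^bsub>M\<^esub> y"] rep_homD(2)[OF g(1) xy(1,3)] by simp
          then show "u (b \<oplus>\<^bsub>N\<^esub> c) = u b \<oplus>\<^bsub>U (s + int d) (l - d)\<^esub> u c"
            using rep_homD(2)[OF k xy(1,3)] ug xy by simp
        next
          fix a b assume a: "a \<in> carrier A" and "b \<in> carrier N"
          then obtain x where x: "x \<in> carrier M" "b = g x" using g(2) by blast
          then have "u (a \<odot>\<^bsub>N\<^esub> b) = ?k (a \<odot>\<^bsub>M\<^esub> x)"
            using ug[OF M.act_closed[OF a x(1)]] rep_homD(3)[OF g(1) a x(1)] by simp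
          then show "u (a \<odot>\<^bsub>N\<^esub> b) = a \<odot>\<^bsub>U (s + int d) (l - d)\<^esub> u b"
            using rep_homD(3)[OF k a x(1)] ug x by simp
        qed
        moreover have "u ` carrier N = carrier (U (s + int d) (l - d))"
          unfolding g(2)[symmetric] image_image ksurj[symmetric] by (rule image_cong) (auto simp: ug)
        ultimately show ?thesis unfolding is_quotient_def by auto
      qed
      then have jr: "j \<le> r i" if "i < j" using N that j ip unfolding tors_of_def by auto
      show "p \<le> r i"
      proof (cases "i = j \<or> j = p")
        case True
        then show ?thesis using pj jr ip by auto
      next
        case False
        then have "p \<le> r j" "j \<le> r i" "i < j" using pj jr j by auto
        then show ?thesis using reachD(4)[OF r, of i j] ip reachD(2)[OF r, of i] by force
      qed
    qed
    then show ?thesis unfolding tors_of_def using M by blast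
  qed
  show ?thesis
    unfolding torsion_class_def
  proof (intro conjI ballI impI)
    show "tors_of r \<subseteq> reps A" unfolding tors_of_def by blast
    show "tors_of r \<noteq> {}" using ne by blast
  qed (use quot rep_iso_quotient ext in blast)+
qed

lemma brick_in_tors_of_iff:
  assumes r: "r \<in> reach n" and ip: "i \<le> p" "p \<le> i + int n"
  shows "brick i p \<in> tors_of r \<longleftrightarrow> p \<le> r i"
proof (cases "i = p")
  case True
  then show ?thesis using brick_refl_in[OF torsion_class_tors_of[OF r], of i] reachD(1)[OF r, of i] by simp
next
  case False
  then have lt: "i < p" using ip by simp
  have idq: "is_quotient A (brick i p) (brick i p)" by (rule brick_quotient) (use ip in auto)
  show ?thesis
  proof
    assume "brick i p \<in> tors_of r"
    then show "p \<le> r i" using lt ip idq unfolding tors_of_def by blast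
  next
    assume le: "p \<le> r i"
    have "q \<le> r j" if jq: "j < q" "q \<le> j + int n" "is_quotient A (brick i p) (brick j q)" for j q
    proof -
      have "int n dvd j - i" "q - j \<le> p - i" by (rule brick_quotient_only[OF jq(3,1,2) lt ip(2)])+
      then have "j mod int n = i mod int n" by (simp add: mod_eq_dvd_iff)
      then have "r j = r i + (j - i)" by (rule reach_congr[OF r])
      then show ?thesis using \<open>q - j \<le> p - i\<close> le by simp
    qed
    then show "brick i p \<in> tors_of r" unfolding tors_of_def using rep_brick[OF ip(2)] by blast
  qed
qed

lemma reach_of_tors_of:
  assumes r: "r \<in> reach n"
  shows "reach_of (tors_of r) = r"
proof
  fix i
  note T = torsion_class_tors_of[OF r]
  have "brick i p \<in> tors_of r \<longleftrightarrow> p \<le> reach_of (tors_of r) i" if "i \<le> p" "p \<le> i + int n" for p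
    using brick_in_iff[OF T that] .
  then have *: "p \<le> r i \<longleftrightarrow> p \<le> reach_of (tors_of r) i" if "i \<le> p" "p \<le> i + int n" for p
    using brick_in_tors_of_iff[OF r that] that by simp
  show "reach_of (tors_of r) i = r i"
    using *[of "r i"] *[of "reach_of (tors_of r) i"] reachD(1,2)[OF r, of i] reach_of(1,2)[OF T, of i]
    by simp
qed

text \<open>
  A uniserial module longer than \<open>n\<close> is an extension of its quotient of length \<open>n\<close>, a brick, by a submodule
  of length \<open>l - n\<close>. By periodicity this submodule is isomorphic to a quotient of the module itself, so
  induction on the length applies to it.
\<close>

lemma uni_in_torsion_class:
  assumes T: "torsion_class A T" and l: "okl l"
    and br: "\<And>i p. i < p \<Longrightarrow> p \<le> i + int n \<Longrightarrow> is_quotient A (U s l) (brick i p) \<Longrightarrow> brick i p \<in> T"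
  shows "U s l \<in> T"
  using l br
proof (induction l arbitrary: s rule: less_induct)
  case (less l)
  have SU: "U s l = brick (1 - s - int l) (1 - s)" by (simp add: brick_def)
  show ?case
  proof (cases "l \<le> n")
    case True
    show ?thesis
    proof (cases "l = 0")
      case True
      then show ?thesis using brick_refl_in[OF T, of "1 - s"] SU by simp
    next
      case False
      have "is_quotient A (U s l) (U s l)" using uni_quotient[of 0 l s] by simp
      then show ?thesis unfolding SU
        by (intro less.prems(2)) (use False \<open>l \<le> n\<close> SU in auto)
    qed
  next
    case False
    define d where "d = l - n"
    have d: "d \<le> l" "l - d = n" "d < l" using False n_pos by (auto simp: d_def)
    have top: "U (s + int d) (l - d) \<in> T"
    proof -
      have e: "U (s + int d) (l - d) = brick (1 - s - int l) (1 - s - int d)"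
        unfolding brick_def using d by (simp add: nat_diff_distrib)
      show ?thesis
        unfolding e
        by (rule less.prems(2)) (use d n_pos uni_quotient[OF d(1), of s] in \<open>auto simp: e[symmetric] of_nat_diff\<close>)
    qed
    have bot: "U s d \<in> T"
    proof (rule less.IH[OF d(3)])
      show "okl d" by (rule okl_down[OF less.prems(1) d(1)])
      have "is_quotient A (U s l) (U (s + int n) (l - n))" by (rule uni_quotient) (use False in simp)
      moreover have "is_quotient A (U (s + int n) (l - n)) (U s d)"
      proof -
        have "brick (1 - s - int d) (1 - s) = U s d" "brick (1 - s - int d - int n) (1 - s - int n) = U (s + int n) d"
          by (simp_all add: brick_def)
        then show ?thesis
          using brick_shift(1)[of "1 - s - int d - int n" "1 - s - int n"] d_def by simp
      qed
      ultimately have q: "is_quotient A (U s l) (U s d)" by (rule is_quotient_trans)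
      fix i p assume "i < p" "p \<le> i + int n" "is_quotient A (U s d) (brick i p)"
      then show "brick i p \<in> T" using less.prems(2) is_quotient_trans[OF q] by blast
    qed
    show ?thesis
      by (rule torsion_class_closed(3)[OF T bot top uni_rep[OF less.prems(1)] uni_extension[OF d(1)]])
  qed
qed

text \<open>
  Split off a uniserial summand of maximal length and continue with the complement. Both summands are
  quotients of \<open>M\<close>, so they satisfy the same hypothesis, and the complement is spanned by fewer vectors.
\<close>

lemma in_torsion_class:
  assumes T: "torsion_class A T" and M: "M \<in> reps A"
    and br: "\<And>i p. i < p \<Longrightarrow> p \<le> i + int n \<Longrightarrow> is_quotient A M (brick i p) \<Longrightarrow> brick i p \<in> T"
  shows "M \<in> T"
proof -
  have "\<forall>M b. M \<in> reps A \<longrightarrow> cyclic_rep.spans A M I b \<longrightarrow>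
    (\<forall>i p. i < p \<longrightarrow> p \<le> i + int n \<longrightarrow> is_quotient A M (brick i p) \<longrightarrow> brick i p \<in> T) \<longrightarrow> M \<in> T"
    if "finite I" for I :: "nat set"
    using that
  proof (induction "card I" arbitrary: I rule: less_induct)
    case less
    show ?case
    proof (intro allI impI)
      fix M b assume M: "M \<in> reps A" and sp: "cyclic_rep.spans A M I b"
        and br: "\<forall>i p. i < p \<longrightarrow> p \<le> i + int n \<longrightarrow> is_quotient A M (brick i p) \<longrightarrow> brick i p \<in> T"
      interpret M: cyclic_rep n A cf ok M by (rule cyclic_rep_reps[OF M])
      show "M \<in> T"
      proof (cases "carrier M = {\<zero>\<^bsub>M\<^esub>}")
        case True
        then show ?thesis by (rule zero_in_torsion_class[OF T M])
      next
        case False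
        then obtain x0 where x0: "x0 \<in> carrier M" "x0 \<noteq> \<zero>\<^bsub>M\<^esub>" using M.M.zero_closed by blast
        have fd: "fin_dim A M" using M by (simp add: reps_def)
        obtain N where kN: "M.kills N" using nil[OF M] unfolding M.kills_def by blast
        obtain s l f g where l: "1 \<le> l" "okl l" and f: "f \<in> rep_hom A M (U s l)"
          and g: "g \<in> rep_hom A (U s l) M" and fg: "\<forall>y \<in> carrier (U s l). f (g y) = y"
          by (rule M.split_uniserial[OF fd kN x0]) blast
        interpret u: cyclic_rep n A cf ok "U s l" by (rule cyclic_rep_uni[OF l(2)])
        define K where "K = sub_rep M {x \<in> carrier M. f x = \<zero>\<^bsub>U s l\<^esub>}"
        from M.split_kernel[OF u.cyclic_rep_axioms f g fg K_def]
        obtain q where K: "cyclic_rep n A cf ok K" and q: "q \<in> rep_hom A M K" "q ` carrier M = carrier K"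
          and qg: "\<forall>y \<in> carrier (U s l). q (g y) = \<zero>\<^bsub>K\<^esub>"
          and ext: "is_extension A K M (U s l)"
          by blast
        interpret K: cyclic_rep n A cf ok K by (rule K)
        have surj: "f ` carrier M = carrier (U s l)"
          using ext unfolding is_extension_def
        proof -
          show ?thesis
          proof
            show "carrier (U s l) \<subseteq> f ` carrier M"
            proof
              fix y assume "y \<in> carrier (U s l)"
              then show "y \<in> f ` carrier M" using bspec[OF fg, of y] rep_homD(1)[OF g, of y] by (metis imageI)
            qed
          qed (use rep_homD(1)[OF f] in blast)
        qed
        have UT: "U s l \<in> T"
        proof (rule uni_in_torsion_class[OF T l(2)])
          have qU: "is_quotient A M (U s l)" using f surj unfolding is_quotient_def by blast
          fix i p assume "i < p" "p \<le> i + int n" "is_quotient A (U s l) (brick i p)"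
          then show "brick i p \<in> T" using br is_quotient_trans[OF qU] by blast
        qed
        define w :: "nat \<Rightarrow> complex" where "w = (\<lambda>t. of_bool (t = 0))"
        have w: "w \<in> carrier (U s l)" "w \<noteq> (\<lambda>_. 0)" using l by (auto simp: w_def fun_eq_iff)
        have gw: "g w \<noteq> \<zero>\<^bsub>M\<^esub>"
        proof
          assume "g w = \<zero>\<^bsub>M\<^esub>"
          then have "w = f \<zero>\<^bsub>M\<^esub>" using bspec[OF fg w(1)] by simp
          then show False
            using w(2) rep_hom_zero[OF M.M.abelian_group_axioms abelian_group_uni f] by simp
        qed
        obtain j where j: "j \<in> I" "K.spans (I - {j}) (q \<circ> b)"
          by (rule M.spans_proper_quotient[OF K q sp rep_homD(1)[OF g w(1)] gw bspec[OF qg w(1)]]) blast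
        have qK: "is_quotient A M K" using q unfolding is_quotient_def by blast
        have KA: "K \<in> reps A" unfolding reps_def using K.spans_fin_dim[OF j(2)] K.lm by blast
        have "card (I - {j}) < card I" using less.prems j(1) by (intro psubset_card_mono) auto
        moreover have "finite (I - {j})" using less.prems by simp
        moreover have "\<forall>i p. i < p \<longrightarrow> p \<le> i + int n \<longrightarrow> is_quotient A K (brick i p) \<longrightarrow> brick i p \<in> T"
          using br is_quotient_trans[OF qK] by blast
        ultimately have "K \<in> T" using less.hyps KA j(2) by blast
        then show ?thesis by (rule torsion_class_closed(3)[OF T _ UT M ext])
      qed
    qed
  qed
  moreover interpret M: cyclic_rep n A cf ok M by (rule cyclic_rep_reps[OF M])
  obtain I b where "M.spans I b" using M.fin_dim_spans M by (auto simp: reps_def)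
  moreover have "finite I" using \<open>M.spans I b\<close> by (simp add: M.spans_def)
  ultimately show ?thesis using M br by blast
qed

lemma tors_of_reach_of:
  assumes T: "torsion_class A T"
  shows "tors_of (reach_of T) = T"
proof
  show "tors_of (reach_of T) \<subseteq> T"
  proof
    fix M assume M: "M \<in> tors_of (reach_of T)"
    then have MA: "M \<in> reps A" by (simp add: tors_of_def)
    show "M \<in> T"
    proof (rule in_torsion_class[OF T MA])
      fix i p assume ip: "i < p" "p \<le> i + int n" "is_quotient A M (brick i p)"
      then have "p \<le> reach_of T i" using M unfolding tors_of_def by blast
      then show "brick i p \<in> T" using brick_in_iff[OF T, of i p] ip by simp
    qed
  qed
  show "T \<subseteq> tors_of (reach_of T)"
  proof
    fix M assume M: "M \<in> T"
    have MA: "M \<in> reps A" by (rule torsion_class_closed(1)[OF T M])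
    have "p \<le> reach_of T i" if ip: "i < p" "p \<le> i + int n" "is_quotient A M (brick i p)" for i p
    proof -
      have "brick i p \<in> T" by (rule torsion_class_closed(2)[OF T M rep_brick[OF ip(2)] ip(3)])
      then show ?thesis using brick_in_iff[OF T, of i p] ip by simp
    qed
    then show "M \<in> tors_of (reach_of T)" unfolding tors_of_def using MA by blast
  qed
qed

lemma tors_of_mono: "r \<le> r' \<Longrightarrow> tors_of r \<subseteq> tors_of r'"
  unfolding tors_of_def le_fun_def by (blast intro: order.trans)

lemma reach_of_mono:
  assumes T: "torsion_class A T" "torsion_class A T'" and sub: "T \<subseteq> T'"
  shows "reach_of T \<le> reach_of T'"
proof (rule le_funI)
  fix i
  have "brick i (reach_of T i) \<in> T'" using reach_of(3)[OF T(1)] sub by blast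
  then show "reach_of T i \<le> reach_of T' i" using brick_in_iff[OF T(2) reach_of(1,2)[OF T(1)]] by blast
qed

text \<open>
  The lattice of torsion classes is isomorphic to the lattice of reach functions.
\<close>

theorem mgs_lengths_reach: "mgs_lengths A = {k. sat_chain (reach n) (\<lambda>i. i) (\<lambda>i. i + int n) k}"
proof -
  have bij: "bij_betw tors_of (reach n) (Tors A)"
    by (rule bij_betw_byWitness[where f' = reach_of])
      (auto simp: Tors_def reach_of_tors_of tors_of_reach_of torsion_class_tors_of reach_of_reach)
  have mono: "tors_of r \<le> tors_of r' \<longleftrightarrow> r \<le> r'" if "r \<in> reach n" "r' \<in> reach n" for r r'
    using tors_of_mono reach_of_mono[OF torsion_class_tors_of torsion_class_tors_of, OF that]
      reach_of_tors_of that by metis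
  let ?b = "tors_of (\<lambda>i. i)" and ?t = "tors_of (\<lambda>i. i + int n)"
  have im: "Tors A = tors_of ` reach n" using bij by (simp add: bij_betw_def)
  have "mgs_lengths A = {card C - 1 | C. finite C \<and> subset.maxchain (Tors A) C}"
    unfolding mgs_lengths_def maximal_green_sequence_def ..
  also have "\<dots> = {k. sat_chain (Tors A) ?b ?t k}"
  proof (rule maxchain_lengths)
    show "?b \<in> Tors A" "?t \<in> Tors A" unfolding im using reach_bot reach_top by blast+
    fix X assume "X \<in> Tors A"
    then obtain r where r: "r \<in> reach n" "X = tors_of r" unfolding im by blast
    show "?b \<subseteq> X" unfolding r(2) by (rule tors_of_mono) (use reachD(1)[OF r(1)] in \<open>simp add: le_fun_def\<close>)
    show "X \<subseteq> ?t" unfolding r(2) by (rule tors_of_mono) (use reachD(2)[OF r(1)] in \<open>simp add: le_fun_def\<close>)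
  qed
  also have "\<dots> = {k. sat_chain (reach n) (\<lambda>i. i) (\<lambda>i. i + int n) k}"
    using sat_chain_iso_iff[OF bij mono reach_bot reach_top] by simp
  finally show ?thesis .
qed

end

section \<open>Nilpotency over complete algebras\<close>

text \<open>
  More vectors than coordinates, by Gaussian elimination.
\<close>

lemma linear_dependence:
  fixes a :: "nat \<Rightarrow> nat \<Rightarrow> complex"
  assumes "finite I" "finite J" "card I < card J"
  shows "\<exists>c. (\<exists>j\<in>J. c j \<noteq> 0) \<and> (\<forall>i\<in>I. (\<Sum>j\<in>J. c j * a j i) = 0)"
  using assms
proof (induction I arbitrary: J a)
  case empty
  then have "J \<noteq> {}" by auto
  then show ?case by (intro exI[of _ "\<lambda>_. 1"]) auto
next
  case (insert x F)
  show ?case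
  proof (cases "\<forall>j\<in>J. a j x = 0")
    case True
    have "card F < card J" using insert by simp
    from insert.IH[OF insert.prems(1) this, of a] show ?thesis using True by auto
  next
    case False
    then obtain p where p: "p \<in> J" "a p x \<noteq> 0" by blast
    have cJ: "card J = Suc (card (J - {p}))" using card_Suc_Diff1[OF insert.prems(1) p(1)] by simp
    define a' where "a' = (\<lambda>j i. a j i - a j x / a p x * a p i)"
    have "card F < card (J - {p})" "finite (J - {p})" using insert cJ by auto
    from insert.IH[OF this(2,1), of a'] obtain c where c: "\<exists>j\<in>J - {p}. c j \<noteq> 0"
      "\<forall>i\<in>F. (\<Sum>j\<in>J - {p}. c j * a' j i) = 0" by blast
    define e where "e = (\<Sum>j\<in>J - {p}. c j * a j x) / a p x"
    define d where "d = c(p := - e)"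
    have sum: "(\<Sum>j\<in>J. d j * a j i) = (\<Sum>j\<in>J - {p}. c j * a j i) - e * a p i" for i
    proof -
      have "(\<Sum>j\<in>J. d j * a j i) = d p * a p i + (\<Sum>j\<in>J - {p}. d j * a j i)"
        by (rule sum.remove[OF insert.prems(1) p(1)])
      also have "(\<Sum>j\<in>J - {p}. d j * a j i) = (\<Sum>j\<in>J - {p}. c j * a j i)"
        by (rule sum.cong) (auto simp: d_def)
      finally show ?thesis by (simp add: d_def)
    qed
    have "(\<Sum>j\<in>J. d j * a j x) = 0" unfolding sum using p by (simp add: e_def)
    moreover have "(\<Sum>j\<in>J. d j * a j i) = 0" if i: "i \<in> F" for i
    proof -
      have "0 = (\<Sum>j\<in>J - {p}. c j * a j i - (c j * a j x) * (a p i / a p x))"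
        using c(2) i by (simp add: a'_def algebra_simps)
      also have "\<dots> = (\<Sum>j\<in>J - {p}. c j * a j i) - e * a p i"
        by (simp add: sum_subtractf e_def sum_distrib_right sum_divide_distrib)
      finally show ?thesis unfolding sum by simp
    qed
    moreover have "\<exists>j\<in>J. d j \<noteq> 0" using c(1) by (auto simp: d_def)
    ultimately show ?thesis by blast
  qed
qed

lemma (in cyclic_rep) lincomb_lincomb:
  assumes b: "b \<in> I \<rightarrow> carrier M" "finite I" and J: "finite J"
  shows "lincomb J c (\<lambda>j. lincomb I (a j) b) = lincomb I (\<lambda>i. \<Sum>j\<in>J. c j * a j i) b"
  using J
proof (induction J)
  case empty
  show ?case using lincomb_zero[OF b(1), of "\<lambda>i. 0"] by (simp add: lincomb_def)
next
  case (insert x F)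
  have y: "(\<lambda>j. lincomb I (a j) b) \<in> insert x F \<rightarrow> carrier M" using lincomb_closed[OF b(1)] by auto
  have "lincomb (insert x F) c (\<lambda>j. lincomb I (a j) b)
      = scale (c x) (lincomb I (a x) b) \<oplus>\<^bsub>M\<^esub> lincomb (insert x F - {x}) c (\<lambda>j. lincomb I (a j) b)"
    by (rule lincomb_remove[OF y]) (use insert in auto)
  also have "insert x F - {x} = F" using insert by auto
  also have "scale (c x) (lincomb I (a x) b) \<oplus>\<^bsub>M\<^esub> lincomb F c (\<lambda>j. lincomb I (a j) b)
      = lincomb I (\<lambda>i. c x * a x i + (\<Sum>j\<in>F. c j * a j i)) b"
    unfolding insert.IH scale_lincomb[OF b] lincomb_add[OF b(1)] ..
  also have "(\<lambda>i. c x * a x i + (\<Sum>j\<in>F. c j * a j i)) = (\<lambda>i. \<Sum>j\<in>insert x F. c j * a j i)"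
    using insert by simp
  finally show ?case .
qed

locale complete_cyclic_algebra = cyclic_algebra n A cf "\<lambda>_. True"
  for n and A :: "(complex, 'x) module" and cf +
  assumes cf_ex_all: "(\<And>i k. w (i + int n) k = w i k) \<Longrightarrow> \<exists>a \<in> carrier A. \<forall>i k. cf a i k = w i k"
begin

text \<open>
  The power series \<open>f\<close> in the sum of all paths of length \<open>n\<close>, which is a central element. Power series are
  used because a series with nonzero constant term has an inverse.
\<close>

definition ser :: "complex fps \<Rightarrow> 'x" where
  "ser f = (SOME a. a \<in> carrier A \<and> (\<forall>i k. cf a i k = (if n dvd k then fps_nth f (k div n) else 0)))"

lemma ser: "ser f \<in> carrier A" "cf (ser f) i k = (if n dvd k then fps_nth f (k div n) else 0)"
proof -
  have "\<exists>a. a \<in> carrier A \<and> (\<forall>i k. cf a i k = (if n dvd k then fps_nth f (k div n) else 0))"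
    using cf_ex_all[of "\<lambda>i k. if n dvd k then fps_nth f (k div n) else 0"] by blast
  from someI_ex[OF this]
  show "ser f \<in> carrier A" "cf (ser f) i k = (if n dvd k then fps_nth f (k div n) else 0)"
    unfolding ser_def by auto
qed

lemma ser_mult: "ser (f * g) = ser f \<otimes>\<^bsub>A\<^esub> ser g"
proof (rule cf_ext)
  fix i k
  have "cf (ser f \<otimes>\<^bsub>A\<^esub> ser g) i k = (\<Sum>j\<le>k. cf (ser f) i j * cf (ser g) (i + int j) (k - j))"
    by (rule cf_mult[OF ser(1) ser(1)]) simp
  also have "\<dots> = cf (ser (f * g)) i k"
  proof (cases "n dvd k")
    case False
    have "\<not> n dvd j \<or> \<not> n dvd (k - j)" if "j \<le> k" for j
      using False that by (metis dvd_add le_add_diff_inverse)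
    then show ?thesis using False by (auto simp: ser(2) intro!: sum.neutral)
  next
    case True
    then obtain m where m: "k = n * m" by (elim dvdE)
    have "(\<Sum>j\<le>k. cf (ser f) i j * cf (ser g) (i + int j) (k - j))
      = (\<Sum>j\<in>(\<lambda>l. n * l) ` {0..m}. cf (ser f) i j * cf (ser g) (i + int j) (k - j))"
    proof (rule sum.mono_neutral_right)
      show "\<forall>j\<in>{..k} - (\<lambda>l. n * l) ` {0..m}. cf (ser f) i j * cf (ser g) (i + int j) (k - j) = 0"
      proof
        fix j assume j: "j \<in> {..k} - (\<lambda>l. n * l) ` {0..m}"
        have "\<not> n dvd j"
        proof
          assume "n dvd j"
          then obtain l where "j = n * l" by (elim dvdE)
          then show False using j m n_pos by auto
        qed
        then show "cf (ser f) i j * cf (ser g) (i + int j) (k - j) = 0" by (simp add: ser(2))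
      qed
    qed (use m in auto)
    also have "\<dots> = (\<Sum>l=0..m. cf (ser f) i (n * l) * cf (ser g) (i + int (n * l)) (k - n * l))"
      by (rule sum.reindex_cong[of "\<lambda>l. n * l"]) (use n_pos in \<open>auto simp: inj_on_def\<close>)
    also have "\<dots> = (\<Sum>l=0..m. fps_nth f l * fps_nth g (m - l))"
    proof (rule sum.cong)
      fix l assume l: "l \<in> {0..m}"
      have "k - n * l = n * (m - l)" using m by (simp add: diff_mult_distrib2)
      then show "cf (ser f) i (n * l) * cf (ser g) (i + int (n * l)) (k - n * l)
          = fps_nth f l * fps_nth g (m - l)"
        using n_pos by (simp add: ser(2))
    qed simp
    also have "\<dots> = cf (ser (f * g)) i k" using m n_pos by (simp add: ser(2) fps_mult_nth)
    finally show ?thesis .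
  qed
  finally show "cf (ser (f * g)) i k = cf (ser f \<otimes>\<^bsub>A\<^esub> ser g) i k" by simp
qed (auto intro: ser mult_closed)

end

locale complete_cyclic_rep = complete_cyclic_algebra n A cf + cyclic_rep n A cf "\<lambda>_. True" M
  for n and A :: "(complex, 'x) module" and cf and M
begin

text \<open>
  The powers of the central element applied to \<open>v\<close> are linearly dependent, so some nonzero polynomial \<open>p\<close>
  in it kills \<open>v\<close>. As a power series, \<open>p\<close> is a power of the indeterminate times a unit.
\<close>

lemma nilpotent_on_vector:
  assumes sp: "spans I b" and v: "v \<in> carrier M"
  shows "\<exists>m. ser (fps_X ^ m) \<odot>\<^bsub>M\<^esub> v = \<zero>\<^bsub>M\<^esub>"
proof -
  have b: "b \<in> I \<rightarrow> carrier M" "finite I" "\<And>x. x \<in> carrier M \<Longrightarrow> \<exists>d. x = lincomb I d b"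
    using sp unfolding spans_def by auto
  define y where "y = (\<lambda>j. ser (fps_X ^ j) \<odot>\<^bsub>M\<^esub> v)"
  have y: "y j \<in> carrier M" for j unfolding y_def by (rule act_closed[OF ser(1) v])
  define a where "a = (\<lambda>j. SOME d. y j = lincomb I d b)"
  have a: "y j = lincomb I (a j) b" for j unfolding a_def by (rule someI_ex[OF b(3)[OF y]])
  let ?J = "{..card I}"
  obtain c where c: "\<exists>j\<in>?J. c j \<noteq> 0" "\<forall>i\<in>I. (\<Sum>j\<in>?J. c j * a j i) = 0"
    using linear_dependence[of I ?J a] b(2) by auto
  have "y = (\<lambda>j. lincomb I (a j) b)" by (rule ext) (rule a)
  from arg_cong[OF this] have "lincomb ?J c y = lincomb ?J c (\<lambda>j. lincomb I (a j) b)" .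
  also have "\<dots> = lincomb I (\<lambda>i. \<Sum>j\<in>?J. c j * a j i) b" by (rule lincomb_lincomb[OF b(1,2)]) simp
  also have "\<dots> = \<zero>\<^bsub>M\<^esub>" by (rule lincomb_zero[OF b(1)]) (use c(2) in simp)
  finally have dep: "lincomb ?J c y = \<zero>\<^bsub>M\<^esub>" .
  have ser_lincomb: "ser (\<Sum>j\<in>F. fps_const (c j) * fps_X ^ j) \<odot>\<^bsub>M\<^esub> v = lincomb F c y" if "finite F" for F
    using that
  proof (induction F)
    case empty
    have "ser 0 \<odot>\<^bsub>M\<^esub> v = \<zero>\<^bsub>M\<^esub>" by (rule zero_act) (simp_all add: ser v)
    then show ?case by (simp add: lincomb_def)
  next
    case (insert x F)
    let ?p = "\<Sum>j\<in>F. fps_const (c j) * fps_X ^ j"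
    have "ser (fps_const (c x) * fps_X ^ x + ?p)
        = ((c x \<odot>\<^bsub>A\<^esub> \<one>\<^bsub>A\<^esub>) \<otimes>\<^bsub>A\<^esub> ser (fps_X ^ x)) \<oplus>\<^bsub>A\<^esub> ser ?p"
      by (rule cf_ext)
        (auto simp: ser cf_add mult_closed add_closed scalar_in cf_scalar_mult)
    then have "ser (\<Sum>j\<in>insert x F. fps_const (c j) * fps_X ^ j) \<odot>\<^bsub>M\<^esub> v
        = scale (c x) (y x) \<oplus>\<^bsub>M\<^esub> ser ?p \<odot>\<^bsub>M\<^esub> v"
      using insert act_add[OF mult_closed[OF scalar_in ser(1)] ser(1) v] smult_act[OF ser(1) v]
      by (simp add: y_def)
    also have "\<dots> = lincomb (insert x F) c y"
    proof -
      have "insert x F - {x} = F" using insert by auto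
      then show ?thesis
        using lincomb_remove[of y "insert x F" x c] y insert by (simp add: Pi_iff)
    qed
    finally show ?case .
  qed
  define p where "p = (\<Sum>j\<in>?J. fps_const (c j) * fps_X ^ j)"
  have pv: "ser p \<odot>\<^bsub>M\<^esub> v = \<zero>\<^bsub>M\<^esub>" unfolding p_def ser_lincomb[OF finite_atMost] by (rule dep)
  have "p \<noteq> 0"
  proof -
    obtain j where j: "j \<in> ?J" "c j \<noteq> 0" using c(1) by blast
    have "fps_nth p j = (\<Sum>l\<in>?J. if l = j then c j else 0)"
      unfolding p_def fps_sum_nth by (rule sum.cong) (auto simp: fps_X_power_nth)
    then have "fps_nth p j = c j" using j by (simp add: sum.delta)
    then show ?thesis using j(2) by auto
  qed
  define m q where "m = subdegree p" and "q = fps_shift m p"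
  have pq: "p = q * fps_X ^ m" unfolding m_def q_def by (rule subdegree_decompose)
  have "fps_nth q 0 \<noteq> 0" using \<open>p \<noteq> 0\<close> by (simp add: q_def m_def)
  then have "inverse q * q = 1" by (rule inverse_mult_eq_1)
  then have "inverse q * p = fps_X ^ m" unfolding pq by (simp add: mult.assoc[symmetric])
  then have "ser (fps_X ^ m) \<odot>\<^bsub>M\<^esub> v = ser (inverse q) \<odot>\<^bsub>M\<^esub> (ser p \<odot>\<^bsub>M\<^esub> v)"
    using act_mult[OF ser(1) ser(1) v, of "inverse q" p] by (simp add: ser_mult[symmetric])
  then have "ser (fps_X ^ m) \<odot>\<^bsub>M\<^esub> v = \<zero>\<^bsub>M\<^esub>" unfolding pv by (simp add: act_zero[OF ser(1)])
  then show ?thesis ..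
qed

text \<open>
  If the power number \<open>m\<close> of the central element acts by zero, then so does every element without paths
  shorter than \<open>n * m\<close>, because it is divisible by this power.
\<close>

lemma finite_dim_killed:
  assumes fd: "fin_dim A M"
  shows "\<exists>N. kills N"
proof -
  obtain I b where sp: "spans I b" using fin_dim_spans[OF fd] .
  have b: "b \<in> I \<rightarrow> carrier M" "finite I" "\<And>x. x \<in> carrier M \<Longrightarrow> \<exists>d. x = lincomb I d b"
    using sp unfolding spans_def by auto
  have "\<exists>m. \<forall>i\<in>I. ser (fps_X ^ m) \<odot>\<^bsub>M\<^esub> b i = \<zero>\<^bsub>M\<^esub>"
  proof -
    have "\<forall>i\<in>I. \<exists>m. ser (fps_X ^ m) \<odot>\<^bsub>M\<^esub> b i = \<zero>\<^bsub>M\<^esub>"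
      using nilpotent_on_vector[OF sp] funcset_mem[OF b(1)] by blast
    then obtain m where m: "\<And>i. i \<in> I \<Longrightarrow> ser (fps_X ^ m i) \<odot>\<^bsub>M\<^esub> b i = \<zero>\<^bsub>M\<^esub>" by metis
    have "ser (fps_X ^ (\<Sum>i\<in>I. m i)) \<odot>\<^bsub>M\<^esub> b i = \<zero>\<^bsub>M\<^esub>" if i: "i \<in> I" for i
    proof -
      have "(\<Sum>i\<in>I. m i) = (\<Sum>i\<in>I - {i}. m i) + m i" using sum.remove[OF b(2) i, of m] by simp
      then have "ser (fps_X ^ (\<Sum>i\<in>I. m i)) = ser (fps_X ^ (\<Sum>i\<in>I - {i}. m i)) \<otimes>\<^bsub>A\<^esub> ser (fps_X ^ m i)"
        by (simp add: power_add ser_mult)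
      then show ?thesis
        using act_mult[OF ser(1) ser(1) funcset_mem[OF b(1) i]] m[OF i] act_zero[OF ser(1)] by simp
    qed
    then show ?thesis by blast
  qed
  then obtain m where m: "\<And>i. i \<in> I \<Longrightarrow> ser (fps_X ^ m) \<odot>\<^bsub>M\<^esub> b i = \<zero>\<^bsub>M\<^esub>" by blast
  have kill: "ser (fps_X ^ m) \<odot>\<^bsub>M\<^esub> x = \<zero>\<^bsub>M\<^esub>" if x: "x \<in> carrier M" for x
  proof -
    obtain c where c: "x = lincomb I c b" using b(3)[OF x] by blast
    have "ser (fps_X ^ m) \<odot>\<^bsub>M\<^esub> x = finsum M (\<lambda>i. ser (fps_X ^ m) \<odot>\<^bsub>M\<^esub> scale (c i) (b i)) I"
      unfolding c lincomb_def
      by (rule finsum_hom[OF M.abelian_group_axioms M.abelian_group_axioms])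
        (use b in \<open>auto simp: Pi_iff act_add_r act_closed ser(1)\<close>)
    also have "\<dots> = finsum M (\<lambda>i. \<zero>\<^bsub>M\<^esub>) I"
      by (rule M.finsum_cong') (use b m in \<open>auto simp: Pi_iff act_scale ser(1) scale_zero_r\<close>)
    finally show ?thesis by simp
  qed
  have "kills (n * m)"
    unfolding kills_def
  proof (intro ballI impI)
    fix a x assume a: "a \<in> carrier A" and a0: "\<forall>i. \<forall>k<n * m. cf a i k = 0" and x: "x \<in> carrier M"
    obtain e where e: "e \<in> carrier A" "\<And>i k. cf e i k = cf a i (k + n * m)"
      using cf_ex_all[of "\<lambda>i k. cf a i (k + n * m)"] cf_period[OF a] by blast
    have "a = ser (fps_X ^ m) \<otimes>\<^bsub>A\<^esub> e"
    proof (rule cf_ext)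
      fix i k
      have "cf (ser (fps_X ^ m) \<otimes>\<^bsub>A\<^esub> e) i k
          = (\<Sum>j\<le>k. cf (ser (fps_X ^ m)) i j * cf e (i + int j) (k - j))"
        by (rule cf_mult[OF ser(1) e(1)]) simp
      also have "\<dots> = (\<Sum>j\<le>k. if j = n * m then cf e (i + int (n * m)) (k - n * m) else 0)"
        by (rule sum.cong) (use n_pos in \<open>auto simp: ser(2) fps_X_power_nth\<close>)
      also have "\<dots> = cf a i k"
        using a0 cf_shift[OF a, of i "int m" k] by (auto simp: sum.delta e(2))
      finally show "cf a i k = cf (ser (fps_X ^ m) \<otimes>\<^bsub>A\<^esub> e) i k" by simp
    qed (auto intro: a e ser mult_closed)
    then show "a \<odot>\<^bsub>M\<^esub> x = \<zero>\<^bsub>M\<^esub>"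
      using act_mult[OF ser(1) e(1) x] kill[OF act_closed[OF e(1) x]] by simp
  qed
  then show ?thesis ..
qed

end

lemma (in complete_cyclic_algebra) cyclic_algebra_nil: "cyclic_algebra_nil n A cf (\<lambda>_. True)"
proof (intro cyclic_algebra_nil.intro cyclic_algebra_nil_axioms.intro cyclic_algebra_axioms)
  fix M assume M: "M \<in> reps A"
  have "complete_cyclic_rep n A cf M"
    using M by (intro complete_cyclic_rep.intro cyclic_rep.intro cyclic_rep_axioms.intro
        complete_cyclic_algebra_axioms cyclic_algebra_axioms) (auto simp: reps_def left_module_def)
  then interpret M: complete_cyclic_rep n A cf M .
  show "\<exists>N. \<forall>a\<in>carrier A. (\<forall>i. \<forall>k<N. cf a i k = 0) \<longrightarrow> (\<forall>x\<in>carrier M. a \<odot>\<^bsub>M\<^esub> x = \<zero>\<^bsub>M\<^esub>)"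
    using M.finite_dim_killed M unfolding M.kills_def reps_def by blast
qed

section \<open>The path algebra of the oriented cycle\<close>

locale cycle =
  fixes n :: nat
  assumes n_pos: "n \<ge> 1"
begin

abbreviation Q :: "(nat, nat) pre_digraph" where "Q \<equiv> cycle_quiver n"
abbreviation R :: "(complex, (nat, nat) path \<Rightarrow> complex) module" where "R \<equiv> path_algebra Q"

definition path_from :: "nat \<Rightarrow> nat \<Rightarrow> (nat, nat) path" where
  "path_from u k = (u, map (\<lambda>j. (u + j) mod n) [0..<k])"

lemma path_from_simps [simp]: "fst (path_from u k) = u" "length (snd (path_from u k)) = k"
  by (simp_all add: path_from_def)

lemma path_from_eq_iff [simp]: "path_from u k = path_from v m \<longleftrightarrow> u = v \<and> k = m"
proof
  assume "path_from u k = path_from v m"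
  then have "fst (path_from u k) = fst (path_from v m)" "length (snd (path_from u k)) = length (snd (path_from v m))" by simp_all
  then show "u = v \<and> k = m" by simp
qed simp

lemma path_from_Suc: "snd (path_from u (Suc k)) = u mod n # snd (path_from ((u + 1) mod n) k)"
proof -
  have "map (\<lambda>j. (u + j) mod n) [0..<Suc k] = u mod n # map (\<lambda>j. (u + Suc j) mod n) [0..<k]"
    by (subst map_upt_Suc) simp
  moreover have "(u + Suc j) mod n = ((u + 1) mod n + j) mod n" for j
    by (simp add: mod_add_left_eq)
  ultimately show ?thesis by (simp add: path_from_def)
qed

lemma cas_iff:
  assumes "u < n"
  shows "pre_digraph.cas Q u p v \<longleftrightarrow> p = snd (path_from u (length p)) \<and> v = (u + length p) mod n"
  using assms
proof (induction p arbitrary: u)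
  case Nil
  then show ?case by (auto simp: pre_digraph.cas.simps path_from_def)
next
  case (Cons e es)
  have "(u + 1) mod n < n" using Cons.prems by simp
  note IH = Cons.IH[OF this]
  have "(u + Suc (length es)) mod n = ((u + 1) mod n + length es) mod n"
    by (simp add: mod_add_left_eq)
  then show ?case
    using Cons.prems IH
    by (auto simp: pre_digraph.cas.simps cycle_quiver_def path_from_Suc)
qed

lemma path_from_arcs: "set (snd (path_from u k)) \<subseteq> {0..<n}"
  using n_pos by (auto simp: path_from_def)

lemma paths_eq: "paths Q = {path_from u k | u k. u < n}"
proof
  show "paths Q \<subseteq> {path_from u k | u k. u < n}"
  proof
    fix r assume "r \<in> paths Q"
    then obtain u p v where r: "r = (u, p)" "pre_digraph.awalk Q u p v" by (auto simp: paths_def)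
    then have u: "u < n" "pre_digraph.cas Q u p v"
      by (auto simp: pre_digraph.awalk_def cycle_quiver_def)
    then have "r = path_from u (length p)" using r cas_iff[OF u(1), of p v] by (auto simp: path_from_def)
    then show "r \<in> {path_from u k | u k. u < n}" using u by blast
  qed
  show "{path_from u k | u k. u < n} \<subseteq> paths Q"
  proof
    fix r assume "r \<in> {path_from u k | u k. u < n}"
    then obtain u k where r: "r = path_from u k" "u < n" by blast
    have "pre_digraph.cas Q u (snd (path_from u k)) ((u + k) mod n)" using cas_iff[OF r(2)] by simp
    then have "pre_digraph.awalk Q u (snd (path_from u k)) ((u + k) mod n)"
      using r path_from_arcs by (auto simp: pre_digraph.awalk_def cycle_quiver_def)
    moreover have "r = (u, snd (path_from u k))" using r by (simp add: path_from_def)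
    ultimately show "r \<in> paths Q" by (auto simp: paths_def)
  qed
qed

lemma path_end_path_from: "u < n \<Longrightarrow> path_end Q (path_from u k) = (u + k) mod n"
proof (induction k arbitrary: u)
  case 0
  then show ?case by (simp add: path_end_def path_from_def pre_digraph.awalk_verts.simps)
next
  case (Suc k)
  have e: "path_from v m = (v, snd (path_from v m))" for v m by (simp add: path_from_def)
  have ne: "pre_digraph.awalk_verts Q v p \<noteq> []" for v p
    by (cases p) (simp_all add: pre_digraph.awalk_verts.simps)
  have "path_end Q (path_from u (Suc k)) = path_end Q (path_from ((u + 1) mod n) k)"
    using Suc.prems ne
    by (subst (1 2) e) (simp add: path_end_def path_from_Suc pre_digraph.awalk_verts.simps cycle_quiver_def)
  also have "\<dots> = ((u + 1) mod n + k) mod n" using Suc by simp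
  also have "\<dots> = (u + Suc k) mod n" by (simp add: mod_add_left_eq)
  finally show ?case .
qed

lemma path_from_append: "snd (path_from u j) @ snd (path_from ((u + j) mod n) m) = snd (path_from u (j + m))"
  by (rule nth_equalityI) (auto simp: path_from_def nth_append mod_add_left_eq)

lemma path_splits_path_from:
  assumes u: "u < n"
  shows "path_splits Q (path_from u k) = (\<lambda>j. (path_from u j, path_from ((u + j) mod n) (k - j))) ` {..k}"
proof
  show "path_splits Q (path_from u k) \<subseteq> (\<lambda>j. (path_from u j, path_from ((u + j) mod n) (k - j))) ` {..k}"
  proof
    fix x assume "x \<in> path_splits Q (path_from u k)"
    then obtain p q where x: "x = (p, q)" "p \<in> paths Q" "q \<in> paths Q" "path_end Q p = fst q"
      "(fst p, snd p @ snd q) = path_from u k" by (auto simp: path_splits_def)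
    obtain v j where p: "p = path_from v j" "v < n" using x(2) by (auto simp: paths_eq)
    obtain w m where q: "q = path_from w m" using x(3) by (auto simp: paths_eq)
    have w: "w = (v + j) mod n" using x(4) p q path_end_path_from by simp
    have "path_from u k = (v, snd (path_from v (j + m)))" using x(5) p q w path_from_append[of v j m] by simp
    moreover have "path_from v (j + m) = (v, snd (path_from v (j + m)))" by (simp add: path_from_def)
    ultimately have "path_from u k = path_from v (j + m)" by (simp only:)
    then have "v = u" "k = j + m" by auto
    then show "x \<in> (\<lambda>j. (path_from u j, path_from ((u + j) mod n) (k - j))) ` {..k}"
      using x(1) p q w by auto
  qed
  show "(\<lambda>j. (path_from u j, path_from ((u + j) mod n) (k - j))) ` {..k} \<subseteq> path_splits Q (path_from u k)"
  proof
    fix x assume "x \<in> (\<lambda>j. (path_from u j, path_from ((u + j) mod n) (k - j))) ` {..k}"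
    then obtain j where j: "j \<le> k" "x = (path_from u j, path_from ((u + j) mod n) (k - j))" by auto
    have "path_from u j \<in> paths Q" "path_from ((u + j) mod n) (k - j) \<in> paths Q"
      using u by (auto simp: paths_eq)
    moreover have "(u, snd (path_from u j) @ snd (path_from ((u + j) mod n) (k - j))) = path_from u k"
      using path_from_append[of u j "k - j"] j by (simp add: path_from_def)
    ultimately show "x \<in> path_splits Q (path_from u k)"
      using j path_end_path_from[OF u] by (simp add: path_splits_def)
  qed
qed

lemma path_splits_not_path: "r \<notin> paths Q \<Longrightarrow> path_splits Q r = {}"
proof (rule ccontr)
  assume r: "r \<notin> paths Q" and "path_splits Q r \<noteq> {}"
  then obtain p q where x: "p \<in> paths Q" "q \<in> paths Q" "path_end Q p = fst q"
      "(fst p, snd p @ snd q) = r" by (auto simp: path_splits_def)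
  obtain v j where p: "p = path_from v j" "v < n" using x(1) by (auto simp: paths_eq)
  obtain w m where q: "q = path_from w m" using x(2) by (auto simp: paths_eq)
  have w: "w = (v + j) mod n" using x(3) p q path_end_path_from by simp
  have "r = path_from v (j + m)" using x(4) p q w path_from_append[of v j m] by (simp add: path_from_def)
  then show False using r p by (auto simp: paths_eq)
qed

text \<open>
  Coefficients are indexed by all integers, periodically, to match \<open>cyclic_algebra\<close>.
\<close>

definition coef :: "((nat, nat) path \<Rightarrow> complex) \<Rightarrow> int \<Rightarrow> nat \<Rightarrow> complex" where
  "coef f i k = f (path_from (nat (i mod int n)) k)"

definition of_coef :: "(int \<Rightarrow> nat \<Rightarrow> complex) \<Rightarrow> (nat, nat) path \<Rightarrow> complex" where
  "of_coef c r = (if r \<in> paths Q then c (int (fst r)) (length (snd r)) else 0)"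

lemma mod_less: "nat (i mod int n) < n"
  using n_pos by (simp add: nat_less_iff)

lemma coef_period: "coef f (i + int n) k = coef f i k"
  by (simp add: coef_def)

lemma coef_of_coef: "coef (of_coef c) i k = c (i mod int n) k"
  using mod_less[of i] n_pos by (auto simp: coef_def of_coef_def paths_eq)

lemma periodic_mod:
  assumes "\<And>i k. c (i + int n) k = c i k"
  shows "c (i mod int n) k = c i k"
  using periodic_shift[of "\<lambda>i. c i k" "int n" "i mod int n" "i div int n", OF assms] by simp

lemma R_carrier: "f \<in> carrier R \<longleftrightarrow> (\<exists>N. \<forall>i k. N \<le> k \<longrightarrow> coef f i k = 0) \<and> (\<forall>r. r \<notin> paths Q \<longrightarrow> f r = 0)"
proof
  assume f: "f \<in> carrier R"
  then have fin: "finite {r. f r \<noteq> 0}" and sub: "{r. f r \<noteq> 0} \<subseteq> paths Q" by (auto simp: path_algebra_def)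
  have "coef f i k = 0" if "Suc (Max (insert 0 ((\<lambda>r. length (snd r)) ` {r. f r \<noteq> 0}))) \<le> k" for i k
  proof (rule ccontr)
    assume "coef f i k \<noteq> 0"
    then have "k \<in> (\<lambda>r. length (snd r)) ` {r. f r \<noteq> 0}"
      by (intro image_eqI[of _ _ "path_from (nat (i mod int n)) k"]) (auto simp: coef_def)
    then have "k \<le> Max (insert 0 ((\<lambda>r. length (snd r)) ` {r. f r \<noteq> 0}))" using fin by (intro Max_ge) auto
    then show False using that by simp
  qed
  then show "(\<exists>N. \<forall>i k. N \<le> k \<longrightarrow> coef f i k = 0) \<and> (\<forall>r. r \<notin> paths Q \<longrightarrow> f r = 0)" using sub by blast
next
  assume *: "(\<exists>N. \<forall>i k. N \<le> k \<longrightarrow> coef f i k = 0) \<and> (\<forall>r. r \<notin> paths Q \<longrightarrow> f r = 0)"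
  then obtain N where N: "\<And>i k. N \<le> k \<Longrightarrow> coef f i k = 0" by blast
  have "{r. f r \<noteq> 0} \<subseteq> (\<lambda>(u, k). path_from u k) ` ({..<n} \<times> {..<N})"
  proof
    fix r assume r: "r \<in> {r. f r \<noteq> 0}"
    then have "r \<in> paths Q" using * by blast
    then obtain u k where uk: "r = path_from u k" "u < n" by (auto simp: paths_eq)
    then have "coef f (int u) k \<noteq> 0" using r by (simp add: coef_def)
    then have "k < N" using N[of k "int u"] by (cases "N \<le> k") auto
    then show "r \<in> (\<lambda>(u, k). path_from u k) ` ({..<n} \<times> {..<N})" using uk by auto
  qed
  then have "finite {r. f r \<noteq> 0}" by (rule finite_subset) simp
  then show "f \<in> carrier R" using * by (auto simp: path_algebra_def)
qed

lemma R_off: "f \<in> carrier R \<Longrightarrow> r \<notin> paths Q \<Longrightarrow> f r = 0"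
  using R_carrier by blast

lemma R_ext:
  assumes "f \<in> carrier R" "g \<in> carrier R" "\<And>i k. coef f i k = coef g i k"
  shows "f = g"
proof
  fix r
  show "f r = g r"
  proof (cases "r \<in> paths Q")
    case True
    then obtain u k where uk: "r = path_from u k" "u < n" by (auto simp: paths_eq)
    then show ?thesis using assms(3)[of "int u" k] by (simp add: coef_def)
  next
    case False
    then show ?thesis using assms(1,2) R_off by metis
  qed
qed

lemma of_coef_carrier: "(\<And>i k. N \<le> k \<Longrightarrow> c i k = 0) \<Longrightarrow> of_coef c \<in> carrier R"
  unfolding R_carrier coef_of_coef by (auto simp: of_coef_def)

lemma coef_add: "coef (f \<oplus>\<^bsub>R\<^esub> g) i k = coef f i k + coef g i k"
  by (simp add: coef_def path_algebra_def)

lemma coef_zero: "coef \<zero>\<^bsub>R\<^esub> i k = 0"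
  by (simp add: coef_def path_algebra_def)

lemma coef_smult: "coef (c \<odot>\<^bsub>R\<^esub> f) i k = c * coef f i k"
  by (simp add: coef_def path_algebra_def)

lemma coef_one: "coef \<one>\<^bsub>R\<^esub> i k = of_bool (k = 0)"
  using mod_less[of i] by (auto simp: coef_def path_algebra_def cycle_quiver_def path_from_def)

lemma coef_mult: "coef (f \<otimes>\<^bsub>R\<^esub> g) i k = (\<Sum>j\<le>k. coef f i j * coef g (i + int j) (k - j))"
proof -
  let ?u = "nat (i mod int n)"
  have m: "nat ((i + int j) mod int n) = (?u + j) mod n" for j
  proof -
    have "(i + int j) mod int n = (i mod int n + int j) mod int n" by (simp add: mod_add_left_eq)
    also have "\<dots> = int ((?u + j) mod n)" using n_pos by (simp add: of_nat_mod)
    finally show ?thesis by simp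
  qed
  have "coef (f \<otimes>\<^bsub>R\<^esub> g) i k = (\<Sum>(p, q) \<in> path_splits Q (path_from ?u k). f p * g q)"
    by (simp add: coef_def path_algebra_def)
  also have "\<dots> = (\<Sum>j\<in>{..k}. f (path_from ?u j) * g (path_from ((?u + j) mod n) (k - j)))"
    unfolding path_splits_path_from[OF mod_less] by (subst sum.reindex) (auto simp: inj_on_def)
  also have "\<dots> = (\<Sum>j\<le>k. coef f i j * coef g (i + int j) (k - j))"
    by (simp add: coef_def m)
  finally show ?thesis .
qed

lemma add_R: "f \<in> carrier R \<Longrightarrow> g \<in> carrier R \<Longrightarrow> f \<oplus>\<^bsub>R\<^esub> g \<in> carrier R"
proof -
  assume f: "f \<in> carrier R" and g: "g \<in> carrier R"
  obtain N M where "\<And>i k. N \<le> k \<Longrightarrow> coef f i k = 0" "\<And>i k. M \<le> k \<Longrightarrow> coef g i k = 0"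
    using f g unfolding R_carrier by blast
  then have "\<forall>i k. max N M \<le> k \<longrightarrow> coef (f \<oplus>\<^bsub>R\<^esub> g) i k = 0" by (simp add: coef_add)
  moreover have "\<forall>r. r \<notin> paths Q \<longrightarrow> (f \<oplus>\<^bsub>R\<^esub> g) r = 0"
    using f g unfolding R_carrier by (simp add: path_algebra_def)
  ultimately show ?thesis unfolding R_carrier by blast
qed

lemma smult_R: "f \<in> carrier R \<Longrightarrow> c \<odot>\<^bsub>R\<^esub> f \<in> carrier R"
proof -
  assume f: "f \<in> carrier R"
  obtain N where "\<And>i k. N \<le> k \<Longrightarrow> coef f i k = 0" using f unfolding R_carrier by blast
  then have "\<forall>i k. N \<le> k \<longrightarrow> coef (c \<odot>\<^bsub>R\<^esub> f) i k = 0" by (simp add: coef_smult)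
  moreover have "\<forall>r. r \<notin> paths Q \<longrightarrow> (c \<odot>\<^bsub>R\<^esub> f) r = 0"
    using f unfolding R_carrier by (simp add: path_algebra_def)
  ultimately show ?thesis unfolding R_carrier by blast
qed

lemma zero_R: "\<zero>\<^bsub>R\<^esub> \<in> carrier R"
  unfolding R_carrier coef_zero by (simp add: path_algebra_def)

lemma one_R: "\<one>\<^bsub>R\<^esub> \<in> carrier R"
proof -
  have "\<one>\<^bsub>R\<^esub> r = 0" if "r \<notin> paths Q" for r
  proof -
    have "(u, []) = path_from u 0" for u by (simp add: path_from_def)
    moreover have "u \<in> verts Q \<Longrightarrow> path_from u 0 \<in> paths Q" for u
      unfolding paths_eq by (auto simp: cycle_quiver_def)
    ultimately have "\<not> (\<exists>u\<in>verts Q. r = (u, []))" using that by auto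
    then show ?thesis by (simp add: path_algebra_def)
  qed
  moreover have "\<forall>i k. 1 \<le> k \<longrightarrow> coef \<one>\<^bsub>R\<^esub> i k = 0" by (simp add: coef_one)
  ultimately show ?thesis unfolding R_carrier by blast
qed

lemma mult_R: "f \<in> carrier R \<Longrightarrow> g \<in> carrier R \<Longrightarrow> f \<otimes>\<^bsub>R\<^esub> g \<in> carrier R"
proof -
  assume f: "f \<in> carrier R" and g: "g \<in> carrier R"
  obtain N M where N: "\<And>i k. N \<le> k \<Longrightarrow> coef f i k = 0" and M: "\<And>i k. M \<le> k \<Longrightarrow> coef g i k = 0"
    using f g unfolding R_carrier by blast
  have "coef (f \<otimes>\<^bsub>R\<^esub> g) i k = 0" if "N + M \<le> k" for i k
    unfolding coef_mult
  proof (rule sum.neutral, rule ballI)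
    fix j assume "j \<in> {..k}"
    have "N \<le> j \<or> M \<le> k - j" using that by linarith
    then show "coef f i j * coef g (i + int j) (k - j) = 0" using N M by auto
  qed
  moreover have "\<forall>r. r \<notin> paths Q \<longrightarrow> (f \<otimes>\<^bsub>R\<^esub> g) r = 0"
    by (simp add: path_algebra_def path_splits_not_path)
  ultimately show ?thesis unfolding R_carrier by blast
qed

lemma ring_R: "ring R"
proof (rule ringI)
  show "abelian_group R"
  proof (rule abelian_groupI)
    fix f assume f: "f \<in> carrier R"
    have "(- 1) \<odot>\<^bsub>R\<^esub> f \<in> carrier R" by (rule smult_R[OF f])
    moreover have "(- 1) \<odot>\<^bsub>R\<^esub> f \<oplus>\<^bsub>R\<^esub> f = \<zero>\<^bsub>R\<^esub>"
      by (simp add: path_algebra_def)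
    ultimately show "\<exists>g\<in>carrier R. g \<oplus>\<^bsub>R\<^esub> f = \<zero>\<^bsub>R\<^esub>" by blast
  qed (auto simp: add_R zero_R intro!: R_ext simp: coef_add coef_zero)
  show "Group.monoid R"
  proof (rule monoidI)
    fix f g h assume *: "f \<in> carrier R" "g \<in> carrier R" "h \<in> carrier R"
    show "f \<otimes>\<^bsub>R\<^esub> g \<otimes>\<^bsub>R\<^esub> h = f \<otimes>\<^bsub>R\<^esub> (g \<otimes>\<^bsub>R\<^esub> h)"
    proof (rule R_ext)
      fix i k
      have "coef (f \<otimes>\<^bsub>R\<^esub> g \<otimes>\<^bsub>R\<^esub> h) i k
          = (\<Sum>j=0..k. \<Sum>l=0..j. coef f i l * coef g (i + int l) (j - l) * coef h (i + int j) (k - j))"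
        by (simp add: coef_mult sum_distrib_right atLeast0AtMost)
      also have "\<dots> = (\<Sum>j=0..k. \<Sum>l=0..j. coef f i l * coef g (i + int l) (j - l)
          * coef h (i + int l + int (j - l)) (k - j))"
        by (rule sum.cong[OF refl], rule sum.cong[OF refl]) (simp add: of_nat_diff)
      also have "\<dots> = (\<Sum>j=0..k. \<Sum>l=0..k - j. coef f i j * coef g (i + int j) l
          * coef h (i + int j + int l) (k - j - l))"
        by (rule fps_mult_assoc_lemma[where f = "\<lambda>l m r. coef f i l * coef g (i + int l) m
          * coef h (i + int l + int m) r"])
      also have "\<dots> = coef (f \<otimes>\<^bsub>R\<^esub> (g \<otimes>\<^bsub>R\<^esub> h)) i k"
        by (simp add: coef_mult sum_distrib_left atLeast0AtMost mult.assoc)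
      finally show "coef (f \<otimes>\<^bsub>R\<^esub> g \<otimes>\<^bsub>R\<^esub> h) i k = coef (f \<otimes>\<^bsub>R\<^esub> (g \<otimes>\<^bsub>R\<^esub> h)) i k" .
    qed (simp_all add: * mult_R)
  next
    fix f assume f: "f \<in> carrier R"
    show "\<one>\<^bsub>R\<^esub> \<otimes>\<^bsub>R\<^esub> f = f"
    proof (rule R_ext)
      fix i k
      have "coef (\<one>\<^bsub>R\<^esub> \<otimes>\<^bsub>R\<^esub> f) i k = (\<Sum>j\<le>k. if j = 0 then coef f i k else 0)"
        unfolding coef_mult by (rule sum.cong) (auto simp: coef_one)
      then show "coef (\<one>\<^bsub>R\<^esub> \<otimes>\<^bsub>R\<^esub> f) i k = coef f i k" by (simp add: sum.delta)
    qed (simp_all add: f mult_R one_R)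
    show "f \<otimes>\<^bsub>R\<^esub> \<one>\<^bsub>R\<^esub> = f"
    proof (rule R_ext)
      fix i k
      have "coef (f \<otimes>\<^bsub>R\<^esub> \<one>\<^bsub>R\<^esub>) i k = (\<Sum>j\<le>k. if j = k then coef f i k else 0)"
        unfolding coef_mult by (rule sum.cong) (auto simp: coef_one)
      then show "coef (f \<otimes>\<^bsub>R\<^esub> \<one>\<^bsub>R\<^esub>) i k = coef f i k" by (simp add: sum.delta)
    qed (simp_all add: f mult_R one_R)
  qed (simp_all add: mult_R one_R)
next
  fix f g h assume "f \<in> carrier R" "g \<in> carrier R" "h \<in> carrier R"
  then show "(f \<oplus>\<^bsub>R\<^esub> g) \<otimes>\<^bsub>R\<^esub> h = f \<otimes>\<^bsub>R\<^esub> h \<oplus>\<^bsub>R\<^esub> g \<otimes>\<^bsub>R\<^esub> h" "h \<otimes>\<^bsub>R\<^esub> (f \<oplus>\<^bsub>R\<^esub> g) = h \<otimes>\<^bsub>R\<^esub> f \<oplus>\<^bsub>R\<^esub> h \<otimes>\<^bsub>R\<^esub> g"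
    by (auto intro!: R_ext simp: mult_R add_R coef_add coef_mult distrib_left distrib_right sum.distrib)
qed

section \<open>Powers of the arrow ideal\<close>

text \<open>
  This is both the ideal generated by the paths of length \<open>m\<close> and the power number \<open>m\<close> of the ideal
  generated by the arrows.
\<close>

definition J :: "nat \<Rightarrow> ((nat, nat) path \<Rightarrow> complex) set" where
  "J m = {f \<in> carrier R. \<forall>i. \<forall>k<m. coef f i k = 0}"

lemma ideal_J: "ideal (J m) R"
proof (rule idealI[OF ring_R])
  interpret R: ring R by (rule ring_R)
  show "subgroup (J m) (add_monoid R)"
  proof (rule group.subgroupI)
    show "group (add_monoid R)" by (rule R.a_group)
    show "J m \<subseteq> carrier (add_monoid R)" by (auto simp: J_def)
    have "\<zero>\<^bsub>R\<^esub> \<in> J m" by (simp add: J_def zero_R coef_zero)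
    then show "J m \<noteq> {}" by blast
    fix f assume f: "f \<in> J m"
    have c: "f \<in> carrier R" "(- 1) \<odot>\<^bsub>R\<^esub> f \<in> carrier R" using f smult_R by (auto simp: J_def)
    have "(- 1) \<odot>\<^bsub>R\<^esub> f \<oplus>\<^bsub>R\<^esub> f = \<zero>\<^bsub>R\<^esub>" by (simp add: path_algebra_def)
    then have "a_inv R f = (- 1) \<odot>\<^bsub>R\<^esub> f" using c by (rule R.minus_equality)
    then show "inv\<^bsub>add_monoid R\<^esub> f \<in> J m"
      using f c by (simp add: a_inv_def[symmetric] J_def coef_smult)
    fix g assume "g \<in> J m"
    then show "f \<otimes>\<^bsub>add_monoid R\<^esub> g \<in> J m" using f by (simp add: J_def add_R coef_add)
  qed
qed (auto simp: J_def mult_R coef_mult intro!: sum.neutral)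

lemma mult_J: "f \<in> J a \<Longrightarrow> g \<in> J b \<Longrightarrow> f \<otimes>\<^bsub>R\<^esub> g \<in> J (a + b)"
  unfolding J_def
proof (intro CollectI conjI allI impI)
  fix i k assume f: "f \<in> {f \<in> carrier R. \<forall>i. \<forall>k<a. coef f i k = 0}"
    and g: "g \<in> {f \<in> carrier R. \<forall>i. \<forall>k<b. coef f i k = 0}" and k: "k < a + b"
  show "coef (f \<otimes>\<^bsub>R\<^esub> g) i k = 0"
    unfolding coef_mult
  proof (rule sum.neutral, rule ballI)
    fix j assume "j \<in> {..k}"
    then have "j < a \<or> k - j < b" using k by auto
    then show "coef f i j * coef g (i + int j) (k - j) = 0" using f g by auto
  qed
qed (auto simp: mult_R)

definition layer :: "nat \<Rightarrow> (nat, nat) path \<Rightarrow> complex" where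
  "layer m = of_coef (\<lambda>i k. of_bool (k = m))"

lemma layer: "layer m \<in> carrier R" "coef (layer m) i k = of_bool (k = m)"
  unfolding layer_def coef_of_coef by (auto intro: of_coef_carrier[of "Suc m"])

text \<open>
  Every path of length at least \<open>m\<close> starts with a unique path of length \<open>m\<close>, and the sum of all of these is
  the single element \<open>layer m\<close>. So one product suffices to factor a whole combination of paths.
\<close>

lemma J_factor:
  assumes f: "f \<in> J (m + l)"
  obtains g where "g \<in> J l" "f = layer m \<otimes>\<^bsub>R\<^esub> g"
proof -
  have fR: "f \<in> carrier R" using f by (simp add: J_def)
  obtain N where N: "\<And>i k. N \<le> k \<Longrightarrow> coef f i k = 0" using fR unfolding R_carrier by blast
  define g where "g = of_coef (\<lambda>i k. coef f (i - int m) (m + k))"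
  have cg: "coef g i k = coef f (i - int m) (m + k)" for i k
    unfolding g_def coef_of_coef
    using periodic_mod[of "\<lambda>i k. coef f (i - int m) (m + k)" i k] coef_period[of f "j - int m" for j]
    by (simp add: algebra_simps)
  have gR: "g \<in> carrier R" unfolding g_def by (rule of_coef_carrier[of N]) (simp add: N)
  have "g \<in> J l" using gR f by (auto simp: J_def cg)
  moreover have "f = layer m \<otimes>\<^bsub>R\<^esub> g"
  proof (rule R_ext[OF fR mult_R[OF layer(1) gR]])
    fix i k
    have "coef (layer m \<otimes>\<^bsub>R\<^esub> g) i k = (\<Sum>j\<le>k. if j = m then coef f i k else 0)"
      unfolding coef_mult by (rule sum.cong) (auto simp: layer cg)
    then show "coef f i k = coef (layer m \<otimes>\<^bsub>R\<^esub> g) i k"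
      using f by (auto simp: sum.delta J_def)
  qed
  ultimately show ?thesis using that by blast
qed

lemma path_elem_R:
  assumes u: "u < n"
  shows "path_elem (path_from u m) = of_coef (\<lambda>i k. of_bool (i = int u \<and> k = m))"
proof
  fix r
  show "path_elem (path_from u m) r = of_coef (\<lambda>i k. of_bool (i = int u \<and> k = m)) r"
  proof (cases "r \<in> paths Q")
    case True
    then obtain v k where "r = path_from v k" "v < n" by (auto simp: paths_eq)
    then show ?thesis using True by (simp add: path_elem_def of_coef_def)
  next
    case False
    then have "r \<noteq> path_from u m" using u unfolding paths_eq by blast
    then show ?thesis using False by (simp add: path_elem_def of_coef_def)
  qed
qed

lemma genideal_J: "Idl\<^bsub>R\<^esub> (path_elem ` {r \<in> paths Q. length (snd r) = m}) = J m" (is "Idl\<^bsub>R\<^esub> ?G = _")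
proof
  interpret R: ring R by (rule ring_R)
  have GJ: "?G \<subseteq> J m"
  proof
    fix f assume "f \<in> ?G"
    then obtain u where u: "u < n" "f = path_elem (path_from u m)" by (auto simp: paths_eq)
    show "f \<in> J m"
      unfolding u(2) path_elem_R[OF u(1)] J_def
      by (auto simp: coef_of_coef intro: of_coef_carrier[of "Suc m"])
  qed
  show "Idl\<^bsub>R\<^esub> ?G \<subseteq> J m" by (rule R.genideal_minimal[OF ideal_J GJ])
  have GR: "?G \<subseteq> carrier R" using GJ by (auto simp: J_def)
  interpret I: ideal "Idl\<^bsub>R\<^esub> ?G" R by (rule R.genideal_ideal[OF GR])
  have "of_coef (\<lambda>i k. of_bool (k = m \<and> i < int t)) \<in> Idl\<^bsub>R\<^esub> ?G" if "t \<le> n" for t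
    using that
  proof (induction t)
    case 0
    have "of_coef (\<lambda>i k. of_bool (k = m \<and> i < int 0)) = \<zero>\<^bsub>R\<^esub>"
      by (auto simp: of_coef_def path_algebra_def fun_eq_iff)
    then show ?case by simp
  next
    case (Suc t)
    have tn: "t < n" using Suc by simp
    have "path_from t m \<in> {r \<in> paths Q. length (snd r) = m}" using tn by (auto simp: paths_eq)
    then have "path_elem (path_from t m) \<in> Idl\<^bsub>R\<^esub> ?G" using R.genideal_self[OF GR] by blast
    moreover have "of_coef (\<lambda>i k. of_bool (k = m \<and> i < int t)) \<in> Idl\<^bsub>R\<^esub> ?G" using Suc by simp
    ultimately have "of_coef (\<lambda>i k. of_bool (k = m \<and> i < int t)) \<oplus>\<^bsub>R\<^esub> path_elem (path_from t m) \<in> Idl\<^bsub>R\<^esub> ?G"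
      by (simp add: I.a_closed)
    moreover have "of_coef (\<lambda>i k. of_bool (k = m \<and> i < int t)) \<oplus>\<^bsub>R\<^esub> path_elem (path_from t m)
        = of_coef (\<lambda>i k. of_bool (k = m \<and> i < int (Suc t)))"
      unfolding path_elem_R[OF tn] by (auto simp: of_coef_def path_algebra_def fun_eq_iff)
    ultimately show ?case by simp
  qed
  from this[of n] have n_in: "of_coef (\<lambda>i k. of_bool (k = m \<and> i < int n)) \<in> Idl\<^bsub>R\<^esub> ?G" by simp
  have n_eq: "of_coef (\<lambda>i k. of_bool (k = m \<and> i < int n)) = layer m"
  proof
    fix r
    show "of_coef (\<lambda>i k. of_bool (k = m \<and> i < int n)) r = layer m r"
    proof (cases "r \<in> paths Q")
      case True
      then obtain v k where "r = path_from v k" "v < n" by (auto simp: paths_eq)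
      then show ?thesis using True by (simp add: layer_def of_coef_def)
    qed (simp add: layer_def of_coef_def)
  qed
  have lay: "layer m \<in> Idl\<^bsub>R\<^esub> ?G" using n_in unfolding n_eq .
  show "J m \<subseteq> Idl\<^bsub>R\<^esub> ?G"
  proof
    fix f assume "f \<in> J m"
    then have "f \<in> J (m + 0)" by simp
    then obtain g where g: "g \<in> J 0" "f = layer m \<otimes>\<^bsub>R\<^esub> g" by (rule J_factor)
    then show "f \<in> Idl\<^bsub>R\<^esub> ?G" using I.I_r_closed[OF lay, of g] by (simp add: J_def)
  qed
qed

lemma arrow_ideal_J: "arrow_ideal Q = J 1"
proof -
  have "(\<lambda>a. path_elem (tail Q a, [a])) ` arcs Q = path_elem ` {r \<in> paths Q. length (snd r) = 1}"
  proof -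
    have "{r \<in> paths Q. length (snd r) = 1} = (\<lambda>a. path_from a 1) ` {0..<n}" by (auto simp: paths_eq)
    also have "\<dots> = (\<lambda>a. (tail Q a, [a])) ` arcs Q"
      by (rule image_cong) (auto simp: cycle_quiver_def path_from_def)
    finally have "{r \<in> paths Q. length (snd r) = 1} = (\<lambda>a. (tail Q a, [a])) ` arcs Q" .
    then show ?thesis by (simp add: image_image)
  qed
  then show ?thesis unfolding arrow_ideal_def using genideal_J[of 1] by simp
qed

lemma ideal_power_J: "ideal_power R (J 1) k = J k"
proof (induction k)
  case 0
  show ?case by (simp add: J_def)
next
  case (Suc k)
  have "ideal_prod R (J k) (J 1) = J (Suc k)"
  proof
    show "ideal_prod R (J k) (J 1) \<subseteq> J (Suc k)"
    proof
      fix x assume "x \<in> ideal_prod R (J k) (J 1)"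
      then show "x \<in> J (Suc k)"
      proof (induction rule: ideal_prod.induct)
        case (prod i j)
        then show ?case using mult_J[of i k j 1] by simp
      next
        case (sum s1 s2)
        then show ?case by (simp add: J_def add_R coef_add)
      qed
    qed
    show "J (Suc k) \<subseteq> ideal_prod R (J k) (J 1)"
    proof
      fix f assume "f \<in> J (Suc k)"
      then have "f \<in> J (k + 1)" by simp
      then obtain g where g: "g \<in> J 1" "f = layer k \<otimes>\<^bsub>R\<^esub> g" by (rule J_factor)
      have "layer k \<in> J k" by (simp add: J_def layer)
      then show "f \<in> ideal_prod R (J k) (J 1)" unfolding g(2) using g(1) by (rule ideal_prod.prod)
    qed
  qed
  then show ?case using Suc by simp
qed

section \<open>The quotients by the powers of the arrow ideal\<close>

definition trunc :: "nat \<Rightarrow> (complex, ((nat, nat) path \<Rightarrow> complex) set) module" where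
  "trunc m = quot_algebra R (J m)"

definition pr :: "nat \<Rightarrow> ((nat, nat) path \<Rightarrow> complex) \<Rightarrow> ((nat, nat) path \<Rightarrow> complex) set" where
  "pr m f = J m +>\<^bsub>R\<^esub> f"

lemma pr_eq:
  assumes f: "f \<in> carrier R"
  shows "pr m f = {g \<in> carrier R. \<forall>i. \<forall>k<m. coef g i k = coef f i k}"
proof
  show "pr m f \<subseteq> {g \<in> carrier R. \<forall>i. \<forall>k<m. coef g i k = coef f i k}"
    using f by (auto simp: pr_def a_r_coset_def r_coset_def J_def add_R coef_add)
  show "{g \<in> carrier R. \<forall>i. \<forall>k<m. coef g i k = coef f i k} \<subseteq> pr m f"
  proof
    fix g assume g: "g \<in> {g \<in> carrier R. \<forall>i. \<forall>k<m. coef g i k = coef f i k}"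
    define h where "h = g \<oplus>\<^bsub>R\<^esub> (- 1) \<odot>\<^bsub>R\<^esub> f"
    have "h \<in> J m" using g f by (auto simp: J_def h_def add_R smult_R coef_add coef_smult)
    moreover have "g = h \<oplus>\<^bsub>R\<^esub> f" by (simp add: h_def path_algebra_def)
    ultimately show "g \<in> pr m f" by (auto simp: pr_def a_r_coset_def r_coset_def)
  qed
qed

lemma pr_eq_iff:
  assumes "f \<in> carrier R" "g \<in> carrier R"
  shows "pr m f = pr m g \<longleftrightarrow> (\<forall>i. \<forall>k<m. coef f i k = coef g i k)"
proof
  assume "pr m f = pr m g"
  then have "f \<in> pr m g" using assms pr_eq[OF assms(1), of m] by auto
  then show "\<forall>i. \<forall>k<m. coef f i k = coef g i k" unfolding pr_eq[OF assms(2)] by simp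
qed (auto simp: pr_eq assms)

lemma trunc_simps:
  shows "carrier (trunc m) = pr m ` carrier R"
    "f \<in> carrier R \<Longrightarrow> g \<in> carrier R \<Longrightarrow> pr m f \<oplus>\<^bsub>trunc m\<^esub> pr m g = pr m (f \<oplus>\<^bsub>R\<^esub> g)"
    "f \<in> carrier R \<Longrightarrow> g \<in> carrier R \<Longrightarrow> pr m f \<otimes>\<^bsub>trunc m\<^esub> pr m g = pr m (f \<otimes>\<^bsub>R\<^esub> g)"
    "\<one>\<^bsub>trunc m\<^esub> = pr m \<one>\<^bsub>R\<^esub>"
    "f \<in> carrier R \<Longrightarrow> c \<odot>\<^bsub>trunc m\<^esub> pr m f = pr m (c \<odot>\<^bsub>R\<^esub> f)"
proof -
  interpret I: ideal "J m" R by (rule ideal_J)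
  show "carrier (trunc m) = pr m ` carrier R"
    by (auto simp: trunc_def quot_algebra_def FactRing_def pr_def A_RCOSETS_def' )
  show "\<one>\<^bsub>trunc m\<^esub> = pr m \<one>\<^bsub>R\<^esub>" by (simp add: trunc_def quot_algebra_def FactRing_def pr_def)
  assume f: "f \<in> carrier R"
  show "c \<odot>\<^bsub>trunc m\<^esub> pr m f = pr m (c \<odot>\<^bsub>R\<^esub> f)"
  proof -
    have "pr m (c \<odot>\<^bsub>R\<^esub> g) = pr m (c \<odot>\<^bsub>R\<^esub> f)" if "g \<in> pr m f" for g
      using that f by (simp add: pr_eq smult_R coef_smult)
    moreover have "f \<in> pr m f" using f by (simp add: pr_eq)
    ultimately have "(\<Union>x\<in>pr m f. pr m (c \<odot>\<^bsub>R\<^esub> x)) = pr m (c \<odot>\<^bsub>R\<^esub> f)" by blast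
    then show ?thesis by (simp add: trunc_def quot_algebra_def pr_def)
  qed
  assume g: "g \<in> carrier R"
  show "pr m f \<oplus>\<^bsub>trunc m\<^esub> pr m g = pr m (f \<oplus>\<^bsub>R\<^esub> g)"
    using I.a_rcos_sum[OF f g] by (simp add: trunc_def quot_algebra_def FactRing_def pr_def)
  show "pr m f \<otimes>\<^bsub>trunc m\<^esub> pr m g = pr m (f \<otimes>\<^bsub>R\<^esub> g)"
    using I.rcoset_mult_add[OF f g] by (simp add: trunc_def quot_algebra_def FactRing_def pr_def)
qed

lemma some_pr:
  assumes "f \<in> carrier R" "k < m"
  shows "coef (SOME g. g \<in> pr m f) i k = coef f i k"
proof -
  have "f \<in> pr m f" using assms by (simp add: pr_eq)
  then have "(SOME g. g \<in> pr m f) \<in> pr m f" by (rule someI[of "\<lambda>g. g \<in> pr m f"])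
  then show ?thesis using assms by (simp add: pr_eq)
qed

end

section \<open>The two algebras\<close>

context cycle
begin

text \<open>
  The coefficients of a coset, read off from a representative. They are well defined below length \<open>n\<close>.
\<close>

definition cfq :: "((nat, nat) path \<Rightarrow> complex) set \<Rightarrow> int \<Rightarrow> nat \<Rightarrow> complex" where
  "cfq X i k = (if k < n then coef (SOME f. f \<in> X) i k else 0)"

lemma cfq_pr: "f \<in> carrier R \<Longrightarrow> cfq (pr n f) i k = (if k < n then coef f i k else 0)"
  by (simp add: cfq_def some_pr)

lemma cyclic_tamari_algebra_trunc: "cyclic_tamari_algebra n = trunc n"
  unfolding cyclic_tamari_algebra_def Let_def trunc_def genideal_J ..

lemma pr_trunc: "f \<in> carrier R \<Longrightarrow> pr m f \<in> carrier (trunc m)"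
  by (simp add: trunc_simps(1))

lemma cyclic_algebra_tamari: "cyclic_algebra n (trunc n) cfq (\<lambda>k. k < n)"
proof
  show "1 \<le> n" by (rule n_pos)
  fix a b assume a: "a \<in> carrier (trunc n)" and b: "b \<in> carrier (trunc n)"
  obtain f where f: "f \<in> carrier R" "a = pr n f" using a by (auto simp: trunc_simps(1))
  obtain g where g: "g \<in> carrier R" "b = pr n g" using b by (auto simp: trunc_simps(1))
  show "a \<oplus>\<^bsub>trunc n\<^esub> b \<in> carrier (trunc n)" "a \<otimes>\<^bsub>trunc n\<^esub> b \<in> carrier (trunc n)"
    unfolding f g by (simp_all add: trunc_simps(2,3) f g pr_trunc add_R mult_R)
  show "cfq (a \<oplus>\<^bsub>trunc n\<^esub> b) i k = cfq a i k + cfq b i k" for i k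
    unfolding f g by (simp add: trunc_simps(2) f g cfq_pr add_R coef_add)
  show "cfq (a \<otimes>\<^bsub>trunc n\<^esub> b) i k = (\<Sum>j\<le>k. cfq a i j * cfq b (i + int j) (k - j))" if k: "k < n" for i k
  proof -
    have "cfq (a \<otimes>\<^bsub>trunc n\<^esub> b) i k = coef (f \<otimes>\<^bsub>R\<^esub> g) i k"
      unfolding f g using k by (simp add: trunc_simps(3) f g cfq_pr mult_R)
    also have "\<dots> = (\<Sum>j\<le>k. cfq a i j * cfq b (i + int j) (k - j))"
      unfolding coef_mult by (rule sum.cong) (use k in \<open>auto simp: f g cfq_pr\<close>)
    finally show ?thesis .
  qed
  show "a = b" if eq: "\<And>i k. k < n \<Longrightarrow> cfq a i k = cfq b i k"
    unfolding f(2) g(2) pr_eq_iff[OF f(1) g(1)] using eq by (simp add: f g cfq_pr)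
next
  fix a c assume a: "a \<in> carrier (trunc n)"
  obtain f where f: "f \<in> carrier R" "a = pr n f" using a by (auto simp: trunc_simps(1))
  show "c \<odot>\<^bsub>trunc n\<^esub> a \<in> carrier (trunc n)" unfolding f by (simp add: trunc_simps(5) f pr_trunc smult_R)
  show "cfq (c \<odot>\<^bsub>trunc n\<^esub> a) i k = c * cfq a i k" for i k
    unfolding f by (simp add: trunc_simps(5) f cfq_pr smult_R coef_smult)
  show "cfq a (i + int n) k = cfq a i k" for i k unfolding f by (simp add: f cfq_pr coef_period)
  show "cfq a i k = 0" if "\<not> k < n" for i k using that by (simp add: cfq_def)
next
  show "\<one>\<^bsub>trunc n\<^esub> \<in> carrier (trunc n)" by (simp add: trunc_simps(4) pr_trunc one_R)
  show "cfq \<one>\<^bsub>trunc n\<^esub> i k = of_bool (k = 0)" if "k < n" for i k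
    using that by (simp add: trunc_simps(4) cfq_pr one_R coef_one)
next
  fix w :: "int \<Rightarrow> nat \<Rightarrow> complex" and N
  assume w: "\<And>i k. w (i + int n) k = w i k" "\<And>i k. N \<le> k \<Longrightarrow> w i k = 0"
  have m: "of_coef w \<in> carrier R" by (rule of_coef_carrier[of N]) (rule w(2))
  have "cfq (pr n (of_coef w)) i k = w i k" if "k < n" for i k
    using that periodic_mod[of w i k, OF w(1)] by (simp add: cfq_pr m coef_of_coef)
  then show "\<exists>a\<in>carrier (trunc n). \<forall>i k. k < n \<longrightarrow> cfq a i k = w i k" using pr_trunc[OF m] by blast
qed auto

lemma tamari_lengths: "mgs_lengths (cyclic_tamari_algebra n) = {k. sat_chain (reach n) (\<lambda>i. i) (\<lambda>i. i + int n) k}"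
proof -
  interpret cyclic_algebra n "trunc n" cfq "\<lambda>k. k < n" by (rule cyclic_algebra_tamari)
  \<comment> \<open>Elements without coefficients below \<open>n\<close> are zero, so the Loewy lengths are at most \<open>n\<close>.\<close>
  interpret cyclic_algebra_nil n "trunc n" cfq "\<lambda>k. k < n"
  proof
    fix M :: "((nat, nat) path \<Rightarrow> complex) set rep"
    assume M: "M \<in> reps (trunc n)"
    then interpret M: cyclic_rep n "trunc n" cfq "\<lambda>k. k < n" M
      by (intro cyclic_rep.intro cyclic_rep_axioms.intro cyclic_algebra_axioms)
        (auto simp: reps_def left_module_def)
    show "\<exists>N. \<forall>a\<in>carrier (trunc n). (\<forall>i. \<forall>k<N. cfq a i k = 0) \<longrightarrow> (\<forall>x\<in>carrier M. a \<odot>\<^bsub>M\<^esub> x = \<zero>\<^bsub>M\<^esub>)"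
      using M.zero_act by blast
  qed
  show ?thesis unfolding cyclic_tamari_algebra_trunc by (rule mgs_lengths_reach)
qed

text \<open>
  The component with index \<open>k + 1\<close> of a compatible sequence determines the coefficients at length \<open>k\<close>.
\<close>

definition cfc :: "(nat \<Rightarrow> ((nat, nat) path \<Rightarrow> complex) set) \<Rightarrow> int \<Rightarrow> nat \<Rightarrow> complex" where
  "cfc x i k = coef (SOME f. f \<in> x (Suc k)) i k"

abbreviation Ahat :: "(complex, nat \<Rightarrow> ((nat, nat) path \<Rightarrow> complex) set) module" where
  "Ahat \<equiv> completed_path_algebra Q"

lemma Ahat_eq: "Ahat =
    \<lparr>carrier = {x. (\<forall>k. x k \<in> carrier (trunc k)) \<and> (\<forall>k. J k <+>\<^bsub>R\<^esub> x (Suc k) = x k)},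
     mult = (\<lambda>x y k. x k \<otimes>\<^bsub>trunc k\<^esub> y k), one = (\<lambda>k. \<one>\<^bsub>trunc k\<^esub>), zero = (\<lambda>k. \<zero>\<^bsub>trunc k\<^esub>),
     add = (\<lambda>x y k. x k \<oplus>\<^bsub>trunc k\<^esub> y k), smult = (\<lambda>c x k. c \<odot>\<^bsub>trunc k\<^esub> x k)\<rparr>"
  unfolding completed_path_algebra_def arrow_ideal_J completion_def ideal_power_J Let_def
    trunc_def[symmetric] ..

lemma J_add_pr:
  assumes f: "f \<in> carrier R"
  shows "J k <+>\<^bsub>R\<^esub> pr (Suc k) f = pr k f"
proof
  show "J k <+>\<^bsub>R\<^esub> pr (Suc k) f \<subseteq> pr k f"
    using f by (auto simp: set_add_def' J_def pr_eq add_R coef_add)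
  show "pr k f \<subseteq> J k <+>\<^bsub>R\<^esub> pr (Suc k) f"
  proof
    fix g assume g: "g \<in> pr k f"
    define h where "h = g \<oplus>\<^bsub>R\<^esub> (- 1) \<odot>\<^bsub>R\<^esub> f"
    have "h \<in> J k" using g f by (simp add: J_def h_def pr_eq add_R smult_R coef_add coef_smult)
    moreover have "g = h \<oplus>\<^bsub>R\<^esub> f" by (simp add: h_def path_algebra_def)
    moreover have "f \<in> pr (Suc k) f" using f by (simp add: pr_eq)
    ultimately show "g \<in> J k <+>\<^bsub>R\<^esub> pr (Suc k) f" unfolding set_add_def' by blast
  qed
qed

lemma AhatI:
  assumes "\<And>k. F k \<in> carrier R" "\<And>i j k. j < k \<Longrightarrow> coef (F (Suc k)) i j = coef (F k) i j"
  shows "(\<lambda>k. pr k (F k)) \<in> carrier Ahat"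
proof -
  have "J k <+>\<^bsub>R\<^esub> pr (Suc k) (F (Suc k)) = pr k (F k)" for k
    unfolding J_add_pr[OF assms(1)] pr_eq_iff[OF assms(1) assms(1)] using assms(2) by blast
  then show ?thesis unfolding Ahat_eq using pr_trunc assms(1) by simp
qed

text \<open>
  The representatives of the components agree with each other as far as they are determined, so
  all of them can be compared with the coefficients of the sequence.
\<close>

lemma AhatE:
  assumes "x \<in> carrier Ahat"
  obtains F where "\<And>k. F k \<in> carrier R" "\<And>k. x k = pr k (F k)"
    "\<And>i j k. j < k \<Longrightarrow> coef (F k) i j = cfc x i j"
proof -
  have x: "\<And>k. x k \<in> carrier (trunc k)" "\<And>k. J k <+>\<^bsub>R\<^esub> x (Suc k) = x k" using assms by (auto simp: Ahat_eq)
  have "\<forall>k. \<exists>f. f \<in> carrier R \<and> x k = pr k f"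
    using x(1) unfolding trunc_simps(1) image_iff by blast
  then obtain F where F: "\<And>k. F k \<in> carrier R" "\<And>k. x k = pr k (F k)" by metis
  have step: "coef (F (Suc k)) i j = coef (F k) i j" if "j < k" for i j k
  proof -
    have "pr k (F (Suc k)) = pr k (F k)" using x(2)[of k] unfolding F(2) J_add_pr[OF F(1)] .
    then show ?thesis using that pr_eq_iff[OF F(1) F(1)] by blast
  qed
  have e1: "coef (F k) i j = coef (F (Suc j)) i j" if "Suc j \<le> k" for i j k
    using that
  proof (induction k rule: dec_induct)
    case (step m)
    then show ?case using \<open>\<And>i j k. j < k \<Longrightarrow> coef (F (Suc k)) i j = coef (F k) i j\<close>[of j m i] by simp
  qed simp
  have e2: "cfc x i j = coef (F (Suc j)) i j" for i j
    unfolding cfc_def F(2) by (rule some_pr[OF F(1)]) simp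
  have e3: "coef (F k) i j = cfc x i j" if "j < k" for i j k
    unfolding e2 by (rule e1) (use that in simp)
  show ?thesis by (rule that) (fact F(1), fact F(2), rule e3)
qed

lemma cfc_pr:
  assumes "(\<lambda>k. pr k (F k)) \<in> carrier Ahat" "\<And>k. F k \<in> carrier R"
  shows "cfc (\<lambda>k. pr k (F k)) i j = coef (F (Suc j)) i j"
  unfolding cfc_def by (rule some_pr[OF assms(2)]) simp

lemma Ahat_ex:
  assumes w: "\<And>i k. w (i + int n) k = (w i k :: complex)"
  shows "\<exists>a\<in>carrier Ahat. \<forall>i k. cfc a i k = w i k"
proof -
  define F where "F = (\<lambda>m. of_coef (\<lambda>i k. if k < m then w i k else 0))"
  have F: "F m \<in> carrier R" for m unfolding F_def by (rule of_coef_carrier[of m]) simp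
  have c: "coef (F m) i k = (if k < m then w i k else 0)" for m i k
    unfolding F_def coef_of_coef using periodic_mod[of w i k, OF w] by simp
  have "(\<lambda>k. pr k (F k)) \<in> carrier Ahat" by (rule AhatI[OF F]) (simp add: c)
  moreover have "cfc (\<lambda>k. pr k (F k)) i k = w i k" for i k
    using cfc_pr[OF calculation F] by (simp add: c)
  ultimately show ?thesis by blast
qed

lemma complete_cyclic_algebra_hat: "complete_cyclic_algebra n Ahat cfc"
proof (intro complete_cyclic_algebra.intro complete_cyclic_algebra_axioms.intro)
  show "cyclic_algebra n Ahat cfc (\<lambda>_. True)"
  proof
    show "1 \<le> n" by (rule n_pos)
    fix a b assume a: "a \<in> carrier Ahat" and b: "b \<in> carrier Ahat"
    obtain F where F: "\<And>k. F k \<in> carrier R" "\<And>k. a k = pr k (F k)"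
      "\<And>i j k. j < k \<Longrightarrow> coef (F k) i j = cfc a i j" by (rule AhatE[OF a]) blast
    obtain G where G: "\<And>k. G k \<in> carrier R" "\<And>k. b k = pr k (G k)"
      "\<And>i j k. j < k \<Longrightarrow> coef (G k) i j = cfc b i j" by (rule AhatE[OF b]) blast
    have add: "a \<oplus>\<^bsub>Ahat\<^esub> b = (\<lambda>k. pr k (F k \<oplus>\<^bsub>R\<^esub> G k))"
      by (simp add: Ahat_eq F(2) G(2) trunc_simps(2) F(1) G(1))
    show addc: "a \<oplus>\<^bsub>Ahat\<^esub> b \<in> carrier Ahat"
      unfolding add by (rule AhatI) (simp_all add: add_R F(1) G(1) coef_add F(3) G(3))
    show "cfc (a \<oplus>\<^bsub>Ahat\<^esub> b) i k = cfc a i k + cfc b i k" for i k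
      using cfc_pr[OF addc[unfolded add]] unfolding add
      by (simp add: add_R F(1) G(1) coef_add F(3) G(3))
    have mul: "a \<otimes>\<^bsub>Ahat\<^esub> b = (\<lambda>k. pr k (F k \<otimes>\<^bsub>R\<^esub> G k))"
      by (simp add: Ahat_eq F(2) G(2) trunc_simps(3) F(1) G(1))
    have com: "coef (F m \<otimes>\<^bsub>R\<^esub> G m) i k = (\<Sum>j\<le>k. cfc a i j * cfc b (i + int j) (k - j))"
      if "k < m" for m i k
      unfolding coef_mult by (rule sum.cong) (use that in \<open>auto simp: F(3) G(3)\<close>)
    show mulc: "a \<otimes>\<^bsub>Ahat\<^esub> b \<in> carrier Ahat"
      unfolding mul by (rule AhatI) (simp_all add: mult_R F(1) G(1) com)
    show "cfc (a \<otimes>\<^bsub>Ahat\<^esub> b) i k = (\<Sum>j\<le>k. cfc a i j * cfc b (i + int j) (k - j))" for i k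
      using cfc_pr[OF mulc[unfolded mul]] unfolding mul by (simp add: mult_R F(1) G(1) com)
    show "a = b" if eq: "\<And>i k. True \<Longrightarrow> cfc a i k = cfc b i k"
    proof
      fix k
      show "a k = b k"
        unfolding F(2) G(2) pr_eq_iff[OF F(1) G(1)] by (simp add: F(3) G(3) eq)
    qed
  next
    fix a c assume a: "a \<in> carrier Ahat"
    obtain F where F: "\<And>k. F k \<in> carrier R" "\<And>k. a k = pr k (F k)"
      "\<And>i j k. j < k \<Longrightarrow> coef (F k) i j = cfc a i j" by (rule AhatE[OF a]) blast
    have sm: "c \<odot>\<^bsub>Ahat\<^esub> a = (\<lambda>k. pr k (c \<odot>\<^bsub>R\<^esub> F k))"
      by (simp add: Ahat_eq F(2) trunc_simps(5) F(1))
    show smc: "c \<odot>\<^bsub>Ahat\<^esub> a \<in> carrier Ahat"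
      unfolding sm by (rule AhatI) (simp_all add: smult_R F(1) coef_smult F(3))
    show "cfc (c \<odot>\<^bsub>Ahat\<^esub> a) i k = c * cfc a i k" for i k
      using cfc_pr[OF smc[unfolded sm]] unfolding sm by (simp add: smult_R F(1) coef_smult F(3))
    show "cfc a (i + int n) k = cfc a i k" for i k unfolding cfc_def by (rule coef_period)
  next
    have on: "\<one>\<^bsub>Ahat\<^esub> = (\<lambda>k. pr k \<one>\<^bsub>R\<^esub>)" by (simp add: Ahat_eq trunc_simps(4))
    show onc: "\<one>\<^bsub>Ahat\<^esub> \<in> carrier Ahat" unfolding on by (rule AhatI) (simp_all add: one_R)
    show "cfc \<one>\<^bsub>Ahat\<^esub> i k = of_bool (k = 0)" for i k
      using cfc_pr[OF onc[unfolded on]] unfolding on by (simp add: one_R coef_one)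
  next
    fix w :: "int \<Rightarrow> nat \<Rightarrow> complex" and N
    assume "\<And>i k. w (i + int n) k = w i k"
    then show "\<exists>a\<in>carrier Ahat. \<forall>i k. True \<longrightarrow> cfc a i k = w i k" using Ahat_ex by simp
  qed auto
qed (rule Ahat_ex)

lemma completed_lengths:
  "mgs_lengths (completed_path_algebra Q) = {k. sat_chain (reach n) (\<lambda>i. i) (\<lambda>i. i + int n) k}"
proof -
  interpret complete_cyclic_algebra n Ahat cfc by (rule complete_cyclic_algebra_hat)
  interpret cyclic_algebra_nil n Ahat cfc "\<lambda>_. True" by (rule cyclic_algebra_nil)
  show ?thesis by (rule mgs_lengths_reach)
qed

end

theorem mainTheorem15:
  fixes n :: nat
  assumes "n \<ge> 2"
  shows "mgs_lengths (cyclic_tamari_algebra n) = {2 * n - 1..(n + 1) choose 2}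
    \<and> mgs_lengths (completed_path_algebra (cycle_quiver n)) = {2 * n - 1..(n + 1) choose 2}"
proof -
  have n: "1 \<le> n" using assms by simp
  then interpret cycle n by unfold_locales
  show ?thesis using tamari_lengths completed_lengths reach_chain_lengths[OF n] by simp
qed

end
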